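(* Let $\delta>0$ and $n\ge1$. Equip $\mathrm{Open}(\mathbb{R}^n)$ with the $\ell_\infty$-metric translation $T_\bullet$, let $\mathrm{Cell}(\Lambda)$ be the face relation poset of the cubical cell structure on $\mathbb{R}^n$ induced by $\Lambda=\delta\mathbb{Z}^n$, let $\mathrm{GridO}$ be the poset of grid opens in $\mathbb{R}^n$, and let $i\colon\mathrm{Cell}(\Lambda)\to\mathrm{Open}(\mathbb{R}^n)$, $\sigma\mapsto\mathrm{star}(|\sigma|)$, and $f\colon\mathrm{GridO}\hookrightarrow\mathrm{Open}(\mathbb{R}^n)$ be the natural maps. Then for any pair of cosheaves $M,N$ on $\mathbb{R}^n$ (valued in a cocomplete category $\mathbf{C}$), $$|d_{\mathrm{Cell}(\Lambda)}(i^*M,i^*N)-d(M,N)|=|d_{\mathrm{GridO}}(f^*M,f^*N)-d(M,N)|\le2\delta,$$ where $d$ is the weak interleaving distance on $\mathrm{Open}(\mathbb{R}^n)$-modules defined by $T_\bullet$, $d_{\mathrm{GridO}}$ is the weak interleaving distance on $\mathrm{GridO}$-modules defined by the lower approximation translation $T^\flat_\bullet$, and $d_{\mathrm{Cell}(\Lambda)}$ is the weak relative interleaving distance on $\mathrm{Cell}(\Lambda)$-modules with respect to the map $j\colon\mathrm{Cell}(\Lambda)\to\mathrm{GridO}$, $\sigma\mapsto\mathrm{star}(|\sigma|)$, and $T^\flat_\bullet$.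
   Context: Posets are viewed as categories; a $\mathcal{P}$-module is a functor $\mathcal{P}\to\mathbf{C}$. $\mathrm{Open}(\mathbb{R}^n)$ is the poset of open sets ordered by inclusion. Grid: the cells $|\sigma|$ of the cubical cell structure are the products $\prod_{k=1}^nI_k$ where each $I_k$ is either a point $\{\delta m\}$ or an open interval $(\delta m,\delta(m+1))$, $m\in\mathbb{Z}$. In $\mathrm{Cell}(\Lambda)$, $\sigma\le\tau$ iff $|\tau|\subseteq\overline{|\sigma|}$. The open star $\mathrm{star}(|\sigma|)$ is the union of all cells whose closure contains $|\sigma|$. A grid open is an open set that is a union of open stars of an arbitrary collection of cells (the empty set is a grid open); $\mathrm{GridO}$ is ordered by inclusion. Metric translation: $T_\varepsilon(U)=\bigcup_{x\in U}B(x,\varepsilon)$ for $\varepsilon>0$, with $B(x,\varepsilon)$ the open $\ell_\infty$-ball, and $T_0(U)=U$. Cosheaves: a Čech cover of an open set $U$ is a collection of open sets with union $U$ such that every nonempty intersection of finitely many members is again a member. A functor $F\colon\mathrm{Open}(\mathbb{R}^n)\to\mathbf{C}$ is a cosheaf if for every open $U$ and every Čech cover $\{U_i\}$ of $U$ the canonical map $\varinjlim_iF(U_i)\to F(U)$ is an isomorphism. Pullback and pushforward: for a monotone map $g\colon\mathcal{P}\to\mathcal{Q}$, $g^*M=M\circ g$ and $(g_*M)(q)=\varinjlim_{p\,:\,g(p)\le q}M(p)$; $g_*$ is left adjoint to $g^*$, with unit $\upsilon$ and counit $\chi\colon g_*g^*\Rightarrow\mathrm{id}$. Translations: a translation on $\mathcal{Q}$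 is a monotone $T\colon\mathcal{Q}\to\mathcal{Q}$ with $q\le T(q)$. A superlinear family is an assignment $\varepsilon\mapsto T_\varepsilon$, $\varepsilon\in[0,\infty)$, of translations with $T_{\varepsilon_2}\circ T_{\varepsilon_1}\le T_{\varepsilon_1+\varepsilon_2}$. With $f_\flat(V)=\sup\{U\in\mathrm{GridO}\mid U\subseteq V\}$, the lower approximation translation is $T^\flat_\varepsilon=f_\flat\circ T_\varepsilon\circ f$; it is a superlinear family of translations on $\mathrm{GridO}$. Weak interleavings over a poset $\mathcal{Q}$ with superlinear family $T_\bullet$: $(M)^\varepsilon_{\mathcal{Q}}=M\circ T_\varepsilon$ (with $\varphi^\varepsilon=T_\varepsilon^*\varphi$). Internal maps of $M$ give natural maps $\eta^\varepsilon_{\mathcal{Q}}\colon M\to(M)^\varepsilon_{\mathcal{Q}}$, $\eta^{\varepsilon,\varepsilon'}_{\mathcal{Q}}\colon(M)^\varepsilon_{\mathcal{Q}}\to(M)^{\varepsilon'}_{\mathcal{Q}}$ ($\varepsilon\le\varepsilon'$), $\Sigma^{\varepsilon_1,\varepsilon_2}_{\mathcal{Q}}\colon((M)^{\varepsilon_1}_{\mathcal{Q}})^{\varepsilon_2}_{\mathcal{Q}}\to(M)^{\varepsilon_1+\varepsilon_2}_{\mathcal{Q}}$. A weak $\varepsilon$-interleaving of $M,N$ is a pair $\varphi\colon M\to(N)^\varepsilon_{\mathcal{Q}}$, $\psi\colon N\to(M)^\varepsilon_{\mathcal{Q}}$ with $\Sigma^{\varepsilon,\varepsilon}_{\mathcal{Q}}\circ\psi^\varepsilon\circ\varphi=\eta^{0,2\varepsilon}_{\mathcal{Q}}\circ\eta^0_{\mathcal{Q}}$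 on $M$ and symmetrically on $N$; the weak interleaving distance is the infimum of such $\varepsilon\ge0$ ($\infty$ if none). Weak interleavings relative to a monotone map $g\colon\mathcal{P}\to\mathcal{Q}$, with $\mathcal{Q}$ carrying a superlinear family $T_\bullet$: $(M)^\varepsilon_{\mathcal{P}}=g^*T_\varepsilon^*g_*M$ (with $\varphi^\varepsilon=g^*T_\varepsilon^*g_*\varphi$); $\eta^\varepsilon_{\mathcal{P}}$ is $M\xrightarrow{\upsilon}g^*g_*M\xrightarrow{g^*\eta^\varepsilon_{\mathcal{Q}}}(M)^\varepsilon_{\mathcal{P}}$; $\eta^{\varepsilon,\varepsilon'}_{\mathcal{P}}=g^*\eta^{\varepsilon,\varepsilon'}_{\mathcal{Q}}g_*$; $\Sigma^{\varepsilon_1,\varepsilon_2}_{\mathcal{P}}$ is the composite $g^*T_{\varepsilon_2}^*g_*g^*T_{\varepsilon_1}^*g_*M\xrightarrow{g^*T^*_{\varepsilon_2}\chi}g^*T_{\varepsilon_2}^*T_{\varepsilon_1}^*g_*M\xrightarrow{g^*\Sigma_{\mathcal{Q}}}g^*T_{\varepsilon_1+\varepsilon_2}^*g_*M$. A weak $\varepsilon$-interleaving relative to $g$ is a pair $\varphi\colon M\to(N)^\varepsilon_{\mathcal{P}}$, $\psi\colon N\to(M)^\varepsilon_{\mathcal{P}}$ satisfying the same two equations with subscript $\mathcal{P}$; the weak relative interleaving distance is the infimum of such $\varepsilon$ ($\infty$ if none). Distances take values in $[0,\infty]$; $|a-b|\le c$ means $a\le b+c$ and $b\le a+c$, and the displayed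 equality of differences expresses $d_{\mathrm{Cell}(\Lambda)}(i^*M,i^*N)=d_{\mathrm{GridO}}(f^*M,f^*N)$. *)

theory Defs
  imports "HOL-Algebra.Lattice" "HOL-Analysis.Analysis"
begin

section \<open>Categories, functors and colimits\<close>

text \<open>\<open>Comp C g f\<close> is the composite ``first \<open>f\<close>, then \<open>g\<close>''; composites, domains and codomains
  are only meaningful for composable arrows of the category.\<close>

record ('o, 'm) cat =
  Ob :: "'o set"
  Ar :: "'m set"
  Dom :: "'m \<Rightarrow> 'o"
  Cod :: "'m \<Rightarrow> 'o"
  Id :: "'o \<Rightarrow> 'm"
  Comp :: "'m \<Rightarrow> 'm \<Rightarrow> 'm" (infixl "\<cdot>\<index>" 70)

definition Hom :: "('o, 'm) cat \<Rightarrow> 'o \<Rightarrow> 'o \<Rightarrow> 'm set" where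
  "Hom C x y = {f \<in> Ar C. Dom C f = x \<and> Cod C f = y}"

locale category =
  fixes C :: "('o, 'm) cat" (structure)
  assumes Dom_closed: "f \<in> Ar C \<Longrightarrow> Dom C f \<in> Ob C"
    and Cod_closed: "f \<in> Ar C \<Longrightarrow> Cod C f \<in> Ob C"
    and Id_closed: "x \<in> Ob C \<Longrightarrow> Id C x \<in> Hom C x x"
    and Comp_closed: "f \<in> Hom C x y \<Longrightarrow> g \<in> Hom C y z \<Longrightarrow> g \<cdot> f \<in> Hom C x z"
    and Id_right: "f \<in> Hom C x y \<Longrightarrow> f \<cdot> Id C x = f"
    and Id_left: "f \<in> Hom C x y \<Longrightarrow> Id C y \<cdot> f = f"
    and Comp_assoc: "f \<in> Hom C w x \<Longrightarrow> g \<in> Hom C x y \<Longrightarrow> h \<in> Hom C y z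
      \<Longrightarrow> (h \<cdot> g) \<cdot> f = h \<cdot> (g \<cdot> f)"

definition is_iso :: "('o, 'm) cat \<Rightarrow> 'm \<Rightarrow> bool" where
  "is_iso C f \<longleftrightarrow> f \<in> Ar C \<and>
     (\<exists>g \<in> Hom C (Cod C f) (Dom C f).
        g \<cdot>\<^bsub>C\<^esub> f = Id C (Dom C f) \<and> f \<cdot>\<^bsub>C\<^esub> g = Id C (Cod C f))"

record ('a, 'b, 'o, 'm) cat_functor =
  obj_map :: "'a \<Rightarrow> 'o"
  arr_map :: "'b \<Rightarrow> 'm"

definition is_functor ::
  "('a, 'b) cat \<Rightarrow> ('o, 'm) cat \<Rightarrow> ('a, 'b, 'o, 'm) cat_functor \<Rightarrow> bool" where
  "is_functor J C F \<longleftrightarrow>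
     (\<forall>x \<in> Ob J. obj_map F x \<in> Ob C) \<and>
     (\<forall>a \<in> Ar J. arr_map F a \<in> Hom C (obj_map F (Dom J a)) (obj_map F (Cod J a))) \<and>
     (\<forall>x \<in> Ob J. arr_map F (Id J x) = Id C (obj_map F x)) \<and>
     (\<forall>a \<in> Ar J. \<forall>b \<in> Ar J. Cod J a = Dom J b \<longrightarrow>
        arr_map F (b \<cdot>\<^bsub>J\<^esub> a) = arr_map F b \<cdot>\<^bsub>C\<^esub> arr_map F a)"

definition is_nat_trans ::
  "('a, 'b) cat \<Rightarrow> ('o, 'm) cat \<Rightarrow> ('a, 'b, 'o, 'm) cat_functor \<Rightarrow>
   ('a, 'b, 'o, 'm) cat_functor \<Rightarrow> ('a \<Rightarrow> 'm) \<Rightarrow> bool" where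
  "is_nat_trans J C F G \<phi> \<longleftrightarrow>
     (\<forall>x \<in> Ob J. \<phi> x \<in> Hom C (obj_map F x) (obj_map G x)) \<and>
     (\<forall>a \<in> Ar J. \<phi> (Cod J a) \<cdot>\<^bsub>C\<^esub> arr_map F a = arr_map G a \<cdot>\<^bsub>C\<^esub> \<phi> (Dom J a))"

definition is_cocone ::
  "('a, 'b) cat \<Rightarrow> ('o, 'm) cat \<Rightarrow> ('a, 'b, 'o, 'm) cat_functor \<Rightarrow> 'o \<Rightarrow> ('a \<Rightarrow> 'm) \<Rightarrow> bool" where
  "is_cocone J C D L \<iota> \<longleftrightarrow>
     L \<in> Ob C \<and>
     (\<forall>x \<in> Ob J. \<iota> x \<in> Hom C (obj_map D x) L) \<and>
     (\<forall>a \<in> Ar J. \<iota> (Cod J a) \<cdot>\<^bsub>C\<^esub> arr_map D a = \<iota> (Dom J a))"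

definition is_colimit ::
  "('a, 'b) cat \<Rightarrow> ('o, 'm) cat \<Rightarrow> ('a, 'b, 'o, 'm) cat_functor \<Rightarrow> 'o \<Rightarrow> ('a \<Rightarrow> 'm) \<Rightarrow> bool" where
  "is_colimit J C D L \<iota> \<longleftrightarrow>
     is_cocone J C D L \<iota> \<and>
     (\<forall>X \<kappa>. is_cocone J C D X \<kappa> \<longrightarrow> (\<exists>!u. u \<in> Hom C L X \<and> (\<forall>x \<in> Ob J. u \<cdot>\<^bsub>C\<^esub> \<iota> x = \<kappa> x)))"

text \<open>HOL has no class of all small categories. The universe of small index categories is
  therefore given by two types: a category is small if its objects form a set of elements of \<open>'a\<close>
  and its arrows a set of elements of \<open>'b\<close>.\<close>

definition cocomplete :: "'a itself \<Rightarrow> 'b itself \<Rightarrow> ('o, 'm) cat \<Rightarrow> bool" where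
  "cocomplete _ _ C \<longleftrightarrow>
     (\<forall>(J :: ('a, 'b) cat) D. category J \<and> is_functor J C D \<longrightarrow> (\<exists>L \<iota>. is_colimit J C D L \<iota>))"

text \<open>A chosen colimit. The choice made by \<open>SOME\<close> is only meaningful if a colimit exists, and
  \<open>colim_desc\<close>, the map induced by a cocone \<open>\<kappa>\<close> with apex \<open>X\<close>, only if \<open>\<kappa>\<close> is a cocone.\<close>

definition colim ::
  "('a, 'b) cat \<Rightarrow> ('o, 'm) cat \<Rightarrow> ('a, 'b, 'o, 'm) cat_functor \<Rightarrow> 'o \<times> ('a \<Rightarrow> 'm)" where
  "colim J C D = (SOME (L, \<iota>). is_colimit J C D L \<iota>)"

definition colim_ob ::
  "('a, 'b) cat \<Rightarrow> ('o, 'm) cat \<Rightarrow> ('a, 'b, 'o, 'm) cat_functor \<Rightarrow> 'o" where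
  "colim_ob J C D = fst (colim J C D)"

definition colim_in ::
  "('a, 'b) cat \<Rightarrow> ('o, 'm) cat \<Rightarrow> ('a, 'b, 'o, 'm) cat_functor \<Rightarrow> 'a \<Rightarrow> 'm" where
  "colim_in J C D = snd (colim J C D)"

definition colim_desc ::
  "('a, 'b) cat \<Rightarrow> ('o, 'm) cat \<Rightarrow> ('a, 'b, 'o, 'm) cat_functor \<Rightarrow> 'o \<Rightarrow> ('a \<Rightarrow> 'm) \<Rightarrow> 'm" where
  "colim_desc J C D X \<kappa> =
     (THE u. u \<in> Hom C (colim_ob J C D) X \<and> (\<forall>x \<in> Ob J. u \<cdot>\<^bsub>C\<^esub> colim_in J C D x = \<kappa> x))"

section \<open>Modules over posets\<close>

text \<open>In the category of a poset the arrow from \<open>p\<close> to \<open>q\<close>, for \<open>p \<le> q\<close>, is the pair \<open>(p, q)\<close>.\<close>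

definition poset_cat :: "'p gorder \<Rightarrow> ('p, 'p \<times> 'p) cat" where
  "poset_cat P =
     \<lparr>Ob = carrier P,
      Ar = {(p, q). p \<in> carrier P \<and> q \<in> carrier P \<and> p \<sqsubseteq>\<^bsub>P\<^esub> q},
      Dom = fst, Cod = snd, Id = (\<lambda>p. (p, p)), Comp = (\<lambda>b a. (fst a, snd b))\<rparr>"

type_synonym ('p, 'o, 'm) pmodule = "('p, 'p \<times> 'p, 'o, 'm) cat_functor"

abbreviation is_module :: "('o, 'm) cat \<Rightarrow> 'p gorder \<Rightarrow> ('p, 'o, 'm) pmodule \<Rightarrow> bool" where
  "is_module C P \<equiv> is_functor (poset_cat P) C"

abbreviation is_module_hom ::
  "('o, 'm) cat \<Rightarrow> 'p gorder \<Rightarrow> ('p, 'o, 'm) pmodule \<Rightarrow> ('p, 'o, 'm) pmodule \<Rightarrow> ('p \<Rightarrow> 'm) \<Rightarrow> bool"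
  where "is_module_hom C P \<equiv> is_nat_trans (poset_cat P) C"

definition pullback :: "('p \<Rightarrow> 'q) \<Rightarrow> ('q, 'o, 'm) pmodule \<Rightarrow> ('p, 'o, 'm) pmodule" where
  "pullback g M =
     \<lparr>obj_map = (\<lambda>p. obj_map M (g p)), arr_map = (\<lambda>(p, p'). arr_map M (g p, g p'))\<rparr>"

definition below :: "'p gorder \<Rightarrow> 'q gorder \<Rightarrow> ('p \<Rightarrow> 'q) \<Rightarrow> 'q \<Rightarrow> 'p gorder" where
  "below P Q g q = P\<lparr>carrier := {p \<in> carrier P. g p \<sqsubseteq>\<^bsub>Q\<^esub> q}\<rparr>"

definition push_ob ::
  "('o, 'm) cat \<Rightarrow> 'p gorder \<Rightarrow> 'q gorder \<Rightarrow> ('p \<Rightarrow> 'q) \<Rightarrow> ('p, 'o, 'm) pmodule \<Rightarrow> 'q \<Rightarrow> 'o" where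
  "push_ob C P Q g M q = colim_ob (poset_cat (below P Q g q)) C M"

definition push_in ::
  "('o, 'm) cat \<Rightarrow> 'p gorder \<Rightarrow> 'q gorder \<Rightarrow> ('p \<Rightarrow> 'q) \<Rightarrow> ('p, 'o, 'm) pmodule \<Rightarrow> 'q \<Rightarrow> 'p \<Rightarrow> 'm"
  where "push_in C P Q g M q = colim_in (poset_cat (below P Q g q)) C M"

definition push_desc ::
  "('o, 'm) cat \<Rightarrow> 'p gorder \<Rightarrow> 'q gorder \<Rightarrow> ('p \<Rightarrow> 'q) \<Rightarrow> ('p, 'o, 'm) pmodule \<Rightarrow> 'q \<Rightarrow>
   'o \<Rightarrow> ('p \<Rightarrow> 'm) \<Rightarrow> 'm" where
  "push_desc C P Q g M q = colim_desc (poset_cat (below P Q g q)) C M"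

definition pushforward ::
  "('o, 'm) cat \<Rightarrow> 'p gorder \<Rightarrow> 'q gorder \<Rightarrow> ('p \<Rightarrow> 'q) \<Rightarrow> ('p, 'o, 'm) pmodule \<Rightarrow>
   ('q, 'o, 'm) pmodule" where
  "pushforward C P Q g M =
     \<lparr>obj_map = push_ob C P Q g M,
      arr_map = (\<lambda>(q, q'). push_desc C P Q g M q (push_ob C P Q g M q') (push_in C P Q g M q'))\<rparr>"

definition pushforward_hom ::
  "('o, 'm) cat \<Rightarrow> 'p gorder \<Rightarrow> 'q gorder \<Rightarrow> ('p \<Rightarrow> 'q) \<Rightarrow> ('p, 'o, 'm) pmodule \<Rightarrow>
   ('p, 'o, 'm) pmodule \<Rightarrow> ('p \<Rightarrow> 'm) \<Rightarrow> 'q \<Rightarrow> 'm" where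
  "pushforward_hom C P Q g M N \<phi> q =
     push_desc C P Q g M q (push_ob C P Q g N q) (\<lambda>p. push_in C P Q g N q p \<cdot>\<^bsub>C\<^esub> \<phi> p)"

text \<open>The unit \<open>M \<rightarrow> g\<^sup>* g\<^sub>* M\<close> and the counit \<open>g\<^sub>* g\<^sup>* N \<rightarrow> N\<close>.\<close>

definition push_unit ::
  "('o, 'm) cat \<Rightarrow> 'p gorder \<Rightarrow> 'q gorder \<Rightarrow> ('p \<Rightarrow> 'q) \<Rightarrow> ('p, 'o, 'm) pmodule \<Rightarrow> 'p \<Rightarrow> 'm" where
  "push_unit C P Q g M p = push_in C P Q g M (g p) p"

definition push_counit ::
  "('o, 'm) cat \<Rightarrow> 'p gorder \<Rightarrow> 'q gorder \<Rightarrow> ('p \<Rightarrow> 'q) \<Rightarrow> ('q, 'o, 'm) pmodule \<Rightarrow> 'q \<Rightarrow> 'm" where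
  "push_counit C P Q g N q =
     push_desc C P Q g (pullback g N) q (obj_map N q) (\<lambda>p. arr_map N (g p, q))"

section \<open>Weak interleavings\<close>

text \<open>In this section \<open>T \<epsilon>\<close>, \<open>\<epsilon> \<ge> 0\<close>, is a superlinear family of translations on \<open>Q\<close>.\<close>

definition shift :: "(real \<Rightarrow> 'q \<Rightarrow> 'q) \<Rightarrow> real \<Rightarrow> ('q, 'o, 'm) pmodule \<Rightarrow> ('q, 'o, 'm) pmodule" where
  "shift T \<epsilon> M = pullback (T \<epsilon>) M"

definition shift_hom :: "(real \<Rightarrow> 'q \<Rightarrow> 'q) \<Rightarrow> real \<Rightarrow> ('q \<Rightarrow> 'm) \<Rightarrow> 'q \<Rightarrow> 'm" where
  "shift_hom T \<epsilon> \<phi> q = \<phi> (T \<epsilon> q)"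

definition shift_eta :: "(real \<Rightarrow> 'q \<Rightarrow> 'q) \<Rightarrow> real \<Rightarrow> ('q, 'o, 'm) pmodule \<Rightarrow> 'q \<Rightarrow> 'm" where
  "shift_eta T \<epsilon> M q = arr_map M (q, T \<epsilon> q)"

definition shift_eta2 ::
  "(real \<Rightarrow> 'q \<Rightarrow> 'q) \<Rightarrow> real \<Rightarrow> real \<Rightarrow> ('q, 'o, 'm) pmodule \<Rightarrow> 'q \<Rightarrow> 'm" where
  "shift_eta2 T \<epsilon> \<epsilon>' M q = arr_map M (T \<epsilon> q, T \<epsilon>' q)"

definition shift_sigma ::
  "(real \<Rightarrow> 'q \<Rightarrow> 'q) \<Rightarrow> real \<Rightarrow> real \<Rightarrow> ('q, 'o, 'm) pmodule \<Rightarrow> 'q \<Rightarrow> 'm" where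
  "shift_sigma T \<epsilon>1 \<epsilon>2 M q = arr_map M (T \<epsilon>1 (T \<epsilon>2 q), T (\<epsilon>1 + \<epsilon>2) q)"

definition weakly_interleaved ::
  "('o, 'm) cat \<Rightarrow> 'q gorder \<Rightarrow> (real \<Rightarrow> 'q \<Rightarrow> 'q) \<Rightarrow> real \<Rightarrow> ('q, 'o, 'm) pmodule \<Rightarrow>
   ('q, 'o, 'm) pmodule \<Rightarrow> bool" where
  "weakly_interleaved C Q T \<epsilon> M N \<longleftrightarrow>
     (\<exists>\<phi> \<psi>. is_module_hom C Q M (shift T \<epsilon> N) \<phi> \<and> is_module_hom C Q N (shift T \<epsilon> M) \<psi> \<and>
        (\<forall>q \<in> carrier Q.
           shift_sigma T \<epsilon> \<epsilon> M q \<cdot>\<^bsub>C\<^esub> (shift_hom T \<epsilon> \<psi> q \<cdot>\<^bsub>C\<^esub> \<phi> q) =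
             shift_eta2 T 0 (2 * \<epsilon>) M q \<cdot>\<^bsub>C\<^esub> shift_eta T 0 M q) \<and>
        (\<forall>q \<in> carrier Q.
           shift_sigma T \<epsilon> \<epsilon> N q \<cdot>\<^bsub>C\<^esub> (shift_hom T \<epsilon> \<phi> q \<cdot>\<^bsub>C\<^esub> \<psi> q) =
             shift_eta2 T 0 (2 * \<epsilon>) N q \<cdot>\<^bsub>C\<^esub> shift_eta T 0 N q))"

definition weak_dist ::
  "('o, 'm) cat \<Rightarrow> 'q gorder \<Rightarrow> (real \<Rightarrow> 'q \<Rightarrow> 'q) \<Rightarrow> ('q, 'o, 'm) pmodule \<Rightarrow>
   ('q, 'o, 'm) pmodule \<Rightarrow> ennreal" where
  "weak_dist C Q T M N = Inf {ennreal \<epsilon> |\<epsilon>. 0 \<le> \<epsilon> \<and> weakly_interleaved C Q T \<epsilon> M N}"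

subsection \<open>Weak interleavings relative to a monotone map\<close>

definition rel_shift ::
  "('o, 'm) cat \<Rightarrow> 'p gorder \<Rightarrow> 'q gorder \<Rightarrow> ('p \<Rightarrow> 'q) \<Rightarrow> (real \<Rightarrow> 'q \<Rightarrow> 'q) \<Rightarrow> real \<Rightarrow>
   ('p, 'o, 'm) pmodule \<Rightarrow> ('p, 'o, 'm) pmodule" where
  "rel_shift C P Q g T \<epsilon> M = pullback g (shift T \<epsilon> (pushforward C P Q g M))"

definition rel_shift_hom ::
  "('o, 'm) cat \<Rightarrow> 'p gorder \<Rightarrow> 'q gorder \<Rightarrow> ('p \<Rightarrow> 'q) \<Rightarrow> (real \<Rightarrow> 'q \<Rightarrow> 'q) \<Rightarrow> real \<Rightarrow>
   ('p, 'o, 'm) pmodule \<Rightarrow> ('p, 'o, 'm) pmodule \<Rightarrow> ('p \<Rightarrow> 'm) \<Rightarrow> 'p \<Rightarrow> 'm" where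
  "rel_shift_hom C P Q g T \<epsilon> M N \<phi> p = shift_hom T \<epsilon> (pushforward_hom C P Q g M N \<phi>) (g p)"

definition rel_eta ::
  "('o, 'm) cat \<Rightarrow> 'p gorder \<Rightarrow> 'q gorder \<Rightarrow> ('p \<Rightarrow> 'q) \<Rightarrow> (real \<Rightarrow> 'q \<Rightarrow> 'q) \<Rightarrow> real \<Rightarrow>
   ('p, 'o, 'm) pmodule \<Rightarrow> 'p \<Rightarrow> 'm" where
  "rel_eta C P Q g T \<epsilon> M p =
     shift_eta T \<epsilon> (pushforward C P Q g M) (g p) \<cdot>\<^bsub>C\<^esub> push_unit C P Q g M p"

definition rel_eta2 ::
  "('o, 'm) cat \<Rightarrow> 'p gorder \<Rightarrow> 'q gorder \<Rightarrow> ('p \<Rightarrow> 'q) \<Rightarrow> (real \<Rightarrow> 'q \<Rightarrow> 'q) \<Rightarrow> real \<Rightarrow> real \<Rightarrow>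
   ('p, 'o, 'm) pmodule \<Rightarrow> 'p \<Rightarrow> 'm" where
  "rel_eta2 C P Q g T \<epsilon> \<epsilon>' M p = shift_eta2 T \<epsilon> \<epsilon>' (pushforward C P Q g M) (g p)"

definition rel_sigma ::
  "('o, 'm) cat \<Rightarrow> 'p gorder \<Rightarrow> 'q gorder \<Rightarrow> ('p \<Rightarrow> 'q) \<Rightarrow> (real \<Rightarrow> 'q \<Rightarrow> 'q) \<Rightarrow> real \<Rightarrow> real \<Rightarrow>
   ('p, 'o, 'm) pmodule \<Rightarrow> 'p \<Rightarrow> 'm" where
  "rel_sigma C P Q g T \<epsilon>1 \<epsilon>2 M p =
     shift_sigma T \<epsilon>1 \<epsilon>2 (pushforward C P Q g M) (g p) \<cdot>\<^bsub>C\<^esub>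
     shift_hom T \<epsilon>2 (push_counit C P Q g (shift T \<epsilon>1 (pushforward C P Q g M))) (g p)"

definition rel_weakly_interleaved ::
  "('o, 'm) cat \<Rightarrow> 'p gorder \<Rightarrow> 'q gorder \<Rightarrow> ('p \<Rightarrow> 'q) \<Rightarrow> (real \<Rightarrow> 'q \<Rightarrow> 'q) \<Rightarrow> real \<Rightarrow>
   ('p, 'o, 'm) pmodule \<Rightarrow> ('p, 'o, 'm) pmodule \<Rightarrow> bool" where
  "rel_weakly_interleaved C P Q g T \<epsilon> M N \<longleftrightarrow>
     (\<exists>\<phi> \<psi>. is_module_hom C P M (rel_shift C P Q g T \<epsilon> N) \<phi> \<and>
        is_module_hom C P N (rel_shift C P Q g T \<epsilon> M) \<psi> \<and>
        (\<forall>p \<in> carrier P.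
           rel_sigma C P Q g T \<epsilon> \<epsilon> M p \<cdot>\<^bsub>C\<^esub>
             (rel_shift_hom C P Q g T \<epsilon> N (rel_shift C P Q g T \<epsilon> M) \<psi> p \<cdot>\<^bsub>C\<^esub> \<phi> p) =
           rel_eta2 C P Q g T 0 (2 * \<epsilon>) M p \<cdot>\<^bsub>C\<^esub> rel_eta C P Q g T 0 M p) \<and>
        (\<forall>p \<in> carrier P.
           rel_sigma C P Q g T \<epsilon> \<epsilon> N p \<cdot>\<^bsub>C\<^esub>
             (rel_shift_hom C P Q g T \<epsilon> M (rel_shift C P Q g T \<epsilon> N) \<phi> p \<cdot>\<^bsub>C\<^esub> \<psi> p) =
           rel_eta2 C P Q g T 0 (2 * \<epsilon>) N p \<cdot>\<^bsub>C\<^esub> rel_eta C P Q g T 0 N p))"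

definition rel_weak_dist ::
  "('o, 'm) cat \<Rightarrow> 'p gorder \<Rightarrow> 'q gorder \<Rightarrow> ('p \<Rightarrow> 'q) \<Rightarrow> (real \<Rightarrow> 'q \<Rightarrow> 'q) \<Rightarrow>
   ('p, 'o, 'm) pmodule \<Rightarrow> ('p, 'o, 'm) pmodule \<Rightarrow> ennreal" where
  "rel_weak_dist C P Q g T M N =
     Inf {ennreal \<epsilon> |\<epsilon>. 0 \<le> \<epsilon> \<and> rel_weakly_interleaved C P Q g T \<epsilon> M N}"

section \<open>Open sets and cosheaves\<close>

definition inclusion_poset :: "'a set set \<Rightarrow> 'a set gorder" where
  "inclusion_poset A = \<lparr>carrier = A, eq = (=), le = (\<subseteq>)\<rparr>"

definition Open_poset :: "(real ^ 'n) set gorder" where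
  "Open_poset = inclusion_poset {U. open U}"

definition metric_translation :: "real \<Rightarrow> (real ^ 'n) set \<Rightarrow> (real ^ 'n) set" where
  "metric_translation \<epsilon> U =
     (if \<epsilon> = 0 then U else (\<Union>x \<in> U. {y. infnorm (y - x) < \<epsilon>}))"

text \<open>Only the intersections that are nonempty as sets have to be members of a Cech cover. In
  particular the empty collection is a Cech cover of the empty set.\<close>

definition cech_cover :: "(real ^ 'n) set \<Rightarrow> (real ^ 'n) set set \<Rightarrow> bool" where
  "cech_cover U \<U> \<longleftrightarrow>
     (\<forall>V \<in> \<U>. open V) \<and> \<Union>\<U> = U \<and>
     (\<forall>\<V>. \<V> \<subseteq> \<U> \<and> finite \<V> \<and> \<V> \<noteq> {} \<and> \<Inter>\<V> \<noteq> {} \<longrightarrow> \<Inter>\<V> \<in> \<U>)"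

definition cosheaf :: "('o, 'm) cat \<Rightarrow> ((real ^ 'n) set, 'o, 'm) pmodule \<Rightarrow> bool" where
  "cosheaf C F \<longleftrightarrow>
     is_module C Open_poset F \<and>
     (\<forall>U \<U>. open U \<and> cech_cover U \<U> \<longrightarrow>
        is_iso C (colim_desc (poset_cat (inclusion_poset \<U>)) C F
                    (obj_map F U) (\<lambda>V. arr_map F (V, U))))"

section \<open>The cubical grid\<close>

text \<open>A cell is identified with its underlying set \<open>|\<sigma>|\<close>.\<close>

definition grid_cells :: "real \<Rightarrow> (real ^ 'n) set set" where
  "grid_cells \<delta> =
     {{x. \<forall>k. x $ k \<in> I k} | I :: 'n \<Rightarrow> real set.
        \<forall>k. \<exists>m::int. I k = {\<delta> * of_int m} \<or> I k = {\<delta> * of_int m <..< \<delta> * (of_int m + 1)}}"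

definition Cell_poset :: "real \<Rightarrow> (real ^ 'n) set gorder" where
  "Cell_poset \<delta> = \<lparr>carrier = grid_cells \<delta>, eq = (=), le = (\<lambda>\<sigma> \<tau>. \<tau> \<subseteq> closure \<sigma>)\<rparr>"

definition open_star :: "real \<Rightarrow> (real ^ 'n) set \<Rightarrow> (real ^ 'n) set" where
  "open_star \<delta> \<sigma> = \<Union>{\<tau> \<in> grid_cells \<delta>. \<sigma> \<subseteq> closure \<tau>}"

definition grid_opens :: "real \<Rightarrow> (real ^ 'n) set set" where
  "grid_opens \<delta> = {U. open U \<and> (\<exists>S \<subseteq> grid_cells \<delta>. U = (\<Union>\<sigma> \<in> S. open_star \<delta> \<sigma>))}"

definition GridO_poset :: "real \<Rightarrow> (real ^ 'n) set gorder" where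
  "GridO_poset \<delta> = inclusion_poset (grid_opens \<delta>)"

definition cell_to_open :: "real \<Rightarrow> (real ^ 'n) set \<Rightarrow> (real ^ 'n) set" where
  "cell_to_open \<delta> \<sigma> = open_star \<delta> \<sigma>"

definition cell_to_grid :: "real \<Rightarrow> (real ^ 'n) set \<Rightarrow> (real ^ 'n) set" where
  "cell_to_grid \<delta> \<sigma> = open_star \<delta> \<sigma>"

definition grid_to_open :: "(real ^ 'n) set \<Rightarrow> (real ^ 'n) set" where
  "grid_to_open U = U"

definition lower_approx :: "real \<Rightarrow> (real ^ 'n) set \<Rightarrow> (real ^ 'n) set" where
  "lower_approx \<delta> V = \<Squnion>\<^bsub>GridO_poset \<delta>\<^esub> {U \<in> grid_opens \<delta>. grid_to_open U \<subseteq> V}"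

definition lower_translation :: "real \<Rightarrow> real \<Rightarrow> (real ^ 'n) set \<Rightarrow> (real ^ 'n) set" where
  "lower_translation \<delta> \<epsilon> = lower_approx \<delta> \<circ> metric_translation \<epsilon> \<circ> grid_to_open"

end

theory Submission
  imports Defs
begin

text \<open>The relative distance over cells and the distance over grid opens agree because a cosheaf, restricted
  to grid opens, can be recovered from its values on open stars. The stars inside a grid open \<open>U\<close> form
  a Cech cover of \<open>U\<close>, and the face relation between cells is the inclusion between their stars. Hence
  \<open>F U\<close> is the colimit of the values of \<open>F\<close> on the stars inside \<open>U\<close>
  (\<open>cosheaf_determined\<close>); in other words, \<open>F\<close> is the left Kan extension of its restriction along the
  star map \<open>j\<close>, and the counit of pushforward and pullback along \<open>j\<close> is invertible at \<open>F\<close>. By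
  adjunction, morphisms \<open>j\<^sup>* M \<rightarrow> j\<^sup>* T\<^sup>* j\<^sub>* j\<^sup>* N\<close> then correspond to morphisms \<open>M \<rightarrow> T\<^sup>* N\<close> over grid opens.
  Under this correspondence the relative interleaving identities become the ordinary ones on stars,
  and these extend to all grid opens by the colimit property. So the two kinds of interleavings
  exist for the same parameters (\<open>rel_weakly_interleaved_iff\<close>).

  The comparison with the distance over all open sets rests on one geometric fact: the star of the
  cell through a point lies in the ball of radius \<open>\<delta>\<close> about that point. So every open set \<open>V\<close> lies in a
  grid open, its grid hull, which in turn lies in the \<open>\<delta>\<close>-neighbourhood of \<open>V\<close>. An interleaving over
  open sets restricts to grid opens once the parameter is enlarged by \<open>\<delta>\<close>, because the grid open inside
  the larger neighbourhood contains the smaller neighbourhood. An interleaving over grid opens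
  extends to open sets by evaluating it at grid hulls, again at the cost of \<open>\<delta>\<close>. Both passages are
  instances of \<open>weakly_interleaved_transport\<close>. They bound the difference of the distances by \<open>\<delta>\<close>, and
  thus by \<open>2\<delta>\<close>.\<close>

section \<open>Colimits\<close>

context category
begin

lemma Hom_iff: "f \<in> Hom C x y \<longleftrightarrow> f \<in> Ar C \<and> Dom C f = x \<and> Cod C f = y"
  by (simp add: Hom_def)

text \<open>Membership in \<open>Hom\<close> names the end points of an arrow, which the simplifier would have to
  guess when it reassociates. The laws are therefore restated with domains and codomains, so that
  all side conditions can be decided by rewriting.\<close>

lemma Comp_Ar: "f \<in> Ar C \<Longrightarrow> g \<in> Ar C \<Longrightarrow> Cod C f = Dom C g \<Longrightarrow> g \<cdot> f \<in> Ar C"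
  and Dom_Comp: "f \<in> Ar C \<Longrightarrow> g \<in> Ar C \<Longrightarrow> Cod C f = Dom C g \<Longrightarrow> Dom C (g \<cdot> f) = Dom C f"
  and Cod_Comp: "f \<in> Ar C \<Longrightarrow> g \<in> Ar C \<Longrightarrow> Cod C f = Dom C g \<Longrightarrow> Cod C (g \<cdot> f) = Cod C g"
  using Comp_closed[of f "Dom C f" "Cod C f" g "Cod C g"] by (auto simp: Hom_def)

lemma Id_Ar: "x \<in> Ob C \<Longrightarrow> Id C x \<in> Ar C"
  and Dom_Id: "x \<in> Ob C \<Longrightarrow> Dom C (Id C x) = x"
  and Cod_Id: "x \<in> Ob C \<Longrightarrow> Cod C (Id C x) = x"
  using Id_closed[of x] by (auto simp: Hom_def)

lemma Id_Comp: "f \<in> Ar C \<Longrightarrow> Cod C f = x \<Longrightarrow> Id C x \<cdot> f = f"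
  and Comp_Id: "f \<in> Ar C \<Longrightarrow> Dom C f = x \<Longrightarrow> f \<cdot> Id C x = f"
  using Id_left[of f] Id_right[of f] by (auto simp: Hom_def)

lemma assoc: "f \<in> Ar C \<Longrightarrow> g \<in> Ar C \<Longrightarrow> h \<in> Ar C \<Longrightarrow> Cod C f = Dom C g \<Longrightarrow> Cod C g = Dom C h
    \<Longrightarrow> (h \<cdot> g) \<cdot> f = h \<cdot> (g \<cdot> f)"
  using Comp_assoc[of f "Dom C f" "Cod C f" g "Cod C g" h "Cod C h"] by (auto simp: Hom_def)

lemmas arrow_simps = Hom_iff Comp_Ar Dom_Comp Cod_Comp Id_Ar Dom_Id Cod_Id Id_Comp Comp_Id assoc

lemma comp_reassoc:
  assumes "f \<cdot> g = h" "k \<in> Ar C" "g \<in> Ar C" "f \<in> Ar C" "Cod C k = Dom C g" "Cod C g = Dom C f"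
  shows "f \<cdot> (g \<cdot> k) = h \<cdot> k"
  using assms assoc by metis

lemma cocone_postcompose:
  assumes "category J" "is_functor J C D" "is_cocone J C D L \<iota>" "u \<in> Hom C L X"
  shows "is_cocone J C D X (\<lambda>x. u \<cdot> \<iota> x)"
proof -
  interpret J: category J by fact
  show ?thesis
    using assms(2-) J.Dom_closed J.Cod_closed Cod_closed
    by (auto simp: is_cocone_def is_functor_def arrow_simps)
qed

lemma colimit_eqI:
  assumes "category J" "is_functor J C D" "is_colimit J C D L \<iota>"
    and "u \<in> Hom C L X" "v \<in> Hom C L X"
    and "\<And>x. x \<in> Ob J \<Longrightarrow> u \<cdot> \<iota> x = v \<cdot> \<iota> x"
  shows "u = v"
proof -
  have "is_cocone J C D X (\<lambda>x. v \<cdot> \<iota> x)"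
    using assms cocone_postcompose is_colimit_def by metis
  then have "\<exists>!w. w \<in> Hom C L X \<and> (\<forall>x\<in>Ob J. w \<cdot> \<iota> x = v \<cdot> \<iota> x)"
    using assms(3) unfolding is_colimit_def by blast
  then show ?thesis
    using assms(4-) by blast
qed

lemma colimits_isomorphic:
  assumes J: "category J" and D: "is_functor J C D"
    and L: "is_colimit J C D L \<iota>" and L': "is_colimit J C D L' \<iota>'"
    and c: "c \<in> Hom C L L'" "\<And>x. x \<in> Ob J \<Longrightarrow> c \<cdot> \<iota> x = \<iota>' x"
  shows "\<exists>d \<in> Hom C L' L. c \<cdot> d = Id C L' \<and> d \<cdot> c = Id C L"
proof -
  have coc: "is_cocone J C D L \<iota>" "is_cocone J C D L' \<iota>'"
    using L L' by (auto simp: is_colimit_def)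
  then have legs: "\<iota> x \<in> Hom C (obj_map D x) L" "\<iota>' x \<in> Hom C (obj_map D x) L'"
    if "x \<in> Ob J" for x
    using that by (auto simp: is_cocone_def)
  have obs: "L \<in> Ob C" "L' \<in> Ob C"
    using coc by (auto simp: is_cocone_def)
  obtain d where d: "d \<in> Hom C L' L" "\<And>x. x \<in> Ob J \<Longrightarrow> d \<cdot> \<iota>' x = \<iota> x"
    using L' coc(1) unfolding is_colimit_def by meson
  have "c \<cdot> d = Id C L'"
  proof (rule colimit_eqI[OF J D L'])
    show "c \<cdot> d \<cdot> \<iota>' x = Id C L' \<cdot> \<iota>' x" if "x \<in> Ob J" for x
      using c d(1) d(2)[OF that] c(2)[OF that] legs[OF that] obs by (simp add: arrow_simps)
  qed (use c d obs in \<open>auto simp: arrow_simps\<close>)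
  moreover have "d \<cdot> c = Id C L"
  proof (rule colimit_eqI[OF J D L])
    show "d \<cdot> c \<cdot> \<iota> x = Id C L \<cdot> \<iota> x" if "x \<in> Ob J" for x
      using c d(1) d(2)[OF that] c(2)[OF that] legs[OF that] obs by (simp add: arrow_simps)
  qed (use c d obs in \<open>auto simp: arrow_simps\<close>)
  ultimately show ?thesis
    using d by blast
qed

lemma colimit_along_iso:
  assumes J: "category J" and D: "is_functor J C D" and L: "is_colimit J C D L \<iota>"
    and c: "is_iso C c" "c \<in> Hom C L L'"
  shows "is_colimit J C D L' (\<lambda>x. c \<cdot> \<iota> x)"
proof -
  obtain d where d: "d \<in> Hom C L' L" "d \<cdot> c = Id C L" "c \<cdot> d = Id C L'"
    using c by (auto simp: is_iso_def Hom_iff)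
  have coc: "is_cocone J C D L \<iota>"
    using L by (simp add: is_colimit_def)
  then have legs: "\<iota> x \<in> Hom C (obj_map D x) L" if "x \<in> Ob J" for x
    using that by (auto simp: is_cocone_def)
  have obs: "L \<in> Ob C" "L' \<in> Ob C"
    using coc c(2) Cod_closed by (auto simp: is_cocone_def Hom_iff)
  have "\<exists>!u. u \<in> Hom C L' X \<and> (\<forall>x\<in>Ob J. u \<cdot> (c \<cdot> \<iota> x) = \<kappa> x)" if \<kappa>: "is_cocone J C D X \<kappa>" for X \<kappa>
  proof -
    obtain u where u: "u \<in> Hom C L X" "\<And>x. x \<in> Ob J \<Longrightarrow> u \<cdot> \<iota> x = \<kappa> x"
      using L \<kappa> unfolding is_colimit_def by meson
    show ?thesis
    proof (rule ex1I[of _ "u \<cdot> d"])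
      have "(u \<cdot> d) \<cdot> (c \<cdot> \<iota> x) = \<kappa> x" if x: "x \<in> Ob J" for x
      proof -
        have "(u \<cdot> d) \<cdot> (c \<cdot> \<iota> x) = u \<cdot> ((d \<cdot> c) \<cdot> \<iota> x)"
          using u(1) d(1) c(2) legs[OF x] by (simp add: arrow_simps)
        also have "\<dots> = \<kappa> x"
          unfolding d(2) using u(2)[OF x] legs[OF x] by (simp add: arrow_simps)
        finally show ?thesis .
      qed
      then show "u \<cdot> d \<in> Hom C L' X \<and> (\<forall>x\<in>Ob J. (u \<cdot> d) \<cdot> (c \<cdot> \<iota> x) = \<kappa> x)"
        using u(1) d(1) by (auto simp: arrow_simps)
    next
      fix v assume v: "v \<in> Hom C L' X \<and> (\<forall>x\<in>Ob J. v \<cdot> (c \<cdot> \<iota> x) = \<kappa> x)"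
      have "v \<cdot> c = u"
      proof (rule colimit_eqI[OF J D L])
        show "v \<cdot> c \<cdot> \<iota> x = u \<cdot> \<iota> x" if "x \<in> Ob J" for x
          using v c(2) legs[OF that] u(2)[OF that] that by (auto simp: arrow_simps)
      qed (use v c u in \<open>auto simp: arrow_simps\<close>)
      then have "u \<cdot> d = v \<cdot> (c \<cdot> d)"
        using v c(2) d(1) by (auto simp: arrow_simps)
      then show "v = u \<cdot> d"
        unfolding d(3) using v by (auto simp: arrow_simps)
    qed
  qed
  then show ?thesis
    using cocone_postcompose[OF J D coc c(2)] by (simp add: is_colimit_def)
qed

end

text \<open>Being a colimit only constrains the legs at objects of the diagram.\<close>

lemma is_colimit_cong:
  assumes "category J" and "\<And>x. x \<in> Ob J \<Longrightarrow> \<iota> x = \<iota>' x" and "is_colimit J C D L \<iota>"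
  shows "is_colimit J C D L \<iota>'"
  using assms category.Dom_closed[OF assms(1)] category.Cod_closed[OF assms(1)]
  by (simp add: is_colimit_def is_cocone_def)

lemma colim_is_colimit:
  assumes "is_colimit J C D L \<iota>"
  shows "is_colimit J C D (colim_ob J C D) (colim_in J C D)"
proof -
  have "case (L, \<iota>) of (L, \<iota>) \<Rightarrow> is_colimit J C D L \<iota>"
    using assms by simp
  from someI[of "\<lambda>z. case z of (L, \<iota>) \<Rightarrow> is_colimit J C D L \<iota>", OF this] show ?thesis
    by (simp add: colim_ob_def colim_in_def colim_def split_def)
qed

lemma
  assumes "is_colimit J C D L \<iota>" and "is_cocone J C D X \<kappa>"
  shows colim_desc_Hom: "colim_desc J C D X \<kappa> \<in> Hom C (colim_ob J C D) X"
    and colim_desc_in: "x \<in> Ob J \<Longrightarrow> colim_desc J C D X \<kappa> \<cdot>\<^bsub>C\<^esub> colim_in J C D x = \<kappa> x"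
proof -
  have "\<exists>!u. u \<in> Hom C (colim_ob J C D) X \<and> (\<forall>x \<in> Ob J. u \<cdot>\<^bsub>C\<^esub> colim_in J C D x = \<kappa> x)"
    using colim_is_colimit[OF assms(1)] assms(2) by (simp add: is_colimit_def)
  from theI'[OF this] show "colim_desc J C D X \<kappa> \<in> Hom C (colim_ob J C D) X"
    and "x \<in> Ob J \<Longrightarrow> colim_desc J C D X \<kappa> \<cdot>\<^bsub>C\<^esub> colim_in J C D x = \<kappa> x"
    by (auto simp: colim_desc_def)
qed

section \<open>Modules over posets\<close>

lemma poset_cat_simps [simp]:
  "Ob (poset_cat P) = carrier P"
  "a \<in> Ar (poset_cat P) \<longleftrightarrow> fst a \<in> carrier P \<and> snd a \<in> carrier P \<and> fst a \<sqsubseteq>\<^bsub>P\<^esub> snd a"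
  "Dom (poset_cat P) = fst"
  "Cod (poset_cat P) = snd"
  "Id (poset_cat P) p = (p, p)"
  "Comp (poset_cat P) b a = (fst a, snd b)"
  by (auto simp: poset_cat_def)

text \<open>Lets naturality and cocone conditions quantify over pairs of comparable elements.\<close>

lemma ball_Ar_poset_cat: "(\<forall>a \<in> Ar (poset_cat P). R a) \<longleftrightarrow>
    (\<forall>p \<in> carrier P. \<forall>q \<in> carrier P. p \<sqsubseteq>\<^bsub>P\<^esub> q \<longrightarrow> R (p, q))"
  by (auto simp: poset_cat_def)

lemma category_poset_cat:
  assumes "partial_order P"
  shows "category (poset_cat P)"
proof -
  interpret partial_order P by fact
  show ?thesis
    by unfold_locales (auto simp: Hom_def intro: le_trans)
qed

lemma partial_order_below:
  assumes "partial_order P"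
  shows "partial_order (below P Q g q)"
proof -
  interpret partial_order P by fact
  show ?thesis
    by unfold_locales (simp_all add: below_def eq_is_equal, blast intro: le_antisym, blast intro: le_trans)
qed

lemma partial_order_inclusion_poset: "partial_order (inclusion_poset A)"
  by unfold_locales (auto simp: inclusion_poset_def)

lemma is_moduleD:
  assumes "is_module C P M"
  shows "p \<in> carrier P \<Longrightarrow> obj_map M p \<in> Ob C"
    and "p \<in> carrier P \<Longrightarrow> q \<in> carrier P \<Longrightarrow> p \<sqsubseteq>\<^bsub>P\<^esub> q
      \<Longrightarrow> arr_map M (p, q) \<in> Hom C (obj_map M p) (obj_map M q)"
    and "p \<in> carrier P \<Longrightarrow> arr_map M (p, p) = Id C (obj_map M p)"
    and "p \<in> carrier P \<Longrightarrow> q \<in> carrier P \<Longrightarrow> r \<in> carrier P \<Longrightarrow> p \<sqsubseteq>\<^bsub>P\<^esub> q \<Longrightarrow> q \<sqsubseteq>\<^bsub>P\<^esub> r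
      \<Longrightarrow> arr_map M (q, r) \<cdot>\<^bsub>C\<^esub> arr_map M (p, q) = arr_map M (p, r)"
proof -
  note f = assms[unfolded is_functor_def]
  show "p \<in> carrier P \<Longrightarrow> obj_map M p \<in> Ob C"
    and "p \<in> carrier P \<Longrightarrow> arr_map M (p, p) = Id C (obj_map M p)"
    using f by auto
  show "p \<in> carrier P \<Longrightarrow> q \<in> carrier P \<Longrightarrow> p \<sqsubseteq>\<^bsub>P\<^esub> q
      \<Longrightarrow> arr_map M (p, q) \<in> Hom C (obj_map M p) (obj_map M q)"
    using f by (metis fst_conv poset_cat_simps(2,3,4) snd_conv)
  assume "p \<in> carrier P" "q \<in> carrier P" "r \<in> carrier P" "p \<sqsubseteq>\<^bsub>P\<^esub> q" "q \<sqsubseteq>\<^bsub>P\<^esub> r"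
  then have "arr_map M (Comp (poset_cat P) (q, r) (p, q)) = arr_map M (q, r) \<cdot>\<^bsub>C\<^esub> arr_map M (p, q)"
    using f by (metis fst_conv poset_cat_simps(2,3,4) snd_conv)
  then show "arr_map M (q, r) \<cdot>\<^bsub>C\<^esub> arr_map M (p, q) = arr_map M (p, r)"
    by simp
qed

lemma is_moduleI:
  assumes "\<And>p. p \<in> carrier P \<Longrightarrow> obj_map M p \<in> Ob C"
    and "\<And>p q. p \<in> carrier P \<Longrightarrow> q \<in> carrier P \<Longrightarrow> p \<sqsubseteq>\<^bsub>P\<^esub> q
      \<Longrightarrow> arr_map M (p, q) \<in> Hom C (obj_map M p) (obj_map M q)"
    and "\<And>p. p \<in> carrier P \<Longrightarrow> arr_map M (p, p) = Id C (obj_map M p)"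
    and "\<And>p q r. p \<in> carrier P \<Longrightarrow> q \<in> carrier P \<Longrightarrow> r \<in> carrier P \<Longrightarrow> p \<sqsubseteq>\<^bsub>P\<^esub> q \<Longrightarrow> q \<sqsubseteq>\<^bsub>P\<^esub> r
      \<Longrightarrow> arr_map M (q, r) \<cdot>\<^bsub>C\<^esub> arr_map M (p, q) = arr_map M (p, r)"
  shows "is_module C P M"
  using assms by (auto simp: is_functor_def)

lemma is_module_hom_iff:
  "is_module_hom C P M N \<phi> \<longleftrightarrow>
     (\<forall>p \<in> carrier P. \<phi> p \<in> Hom C (obj_map M p) (obj_map N p)) \<and>
     (\<forall>p \<in> carrier P. \<forall>q \<in> carrier P. p \<sqsubseteq>\<^bsub>P\<^esub> q \<longrightarrow>
        \<phi> q \<cdot>\<^bsub>C\<^esub> arr_map M (p, q) = arr_map N (p, q) \<cdot>\<^bsub>C\<^esub> \<phi> p)"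
  by (simp add: is_nat_trans_def ball_Ar_poset_cat)

lemma is_cocone_poset_iff:
  "is_cocone (poset_cat P) C D L \<iota> \<longleftrightarrow>
     L \<in> Ob C \<and> (\<forall>p \<in> carrier P. \<iota> p \<in> Hom C (obj_map D p) L) \<and>
     (\<forall>p \<in> carrier P. \<forall>q \<in> carrier P. p \<sqsubseteq>\<^bsub>P\<^esub> q \<longrightarrow> \<iota> q \<cdot>\<^bsub>C\<^esub> arr_map D (p, q) = \<iota> p)"
  by (simp add: is_cocone_def ball_Ar_poset_cat)

lemma pullback_simps [simp]:
  "obj_map (pullback g M) p = obj_map M (g p)"
  "arr_map (pullback g M) (p, q) = arr_map M (g p, g q)"
  by (auto simp: pullback_def)

lemma pullback_identity: "pullback (\<lambda>p. p) M = M"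
  by (cases M) (simp add: pullback_def)

lemma is_module_pullback:
  assumes "is_module C Q M"
    and "\<And>p. p \<in> carrier P \<Longrightarrow> g p \<in> carrier Q"
    and "\<And>p p'. p \<in> carrier P \<Longrightarrow> p' \<in> carrier P \<Longrightarrow> p \<sqsubseteq>\<^bsub>P\<^esub> p' \<Longrightarrow> g p \<sqsubseteq>\<^bsub>Q\<^esub> g p'"
  shows "is_module C P (pullback g M)"
  by (rule is_moduleI) (auto simp: assms is_moduleD[OF assms(1)])

lemma below_simps [simp]:
  "carrier (below P Q g q) = {p \<in> carrier P. g p \<sqsubseteq>\<^bsub>Q\<^esub> q}"
  "le (below P Q g q) = le P"
  by (auto simp: below_def)

lemma is_module_below: "is_module C P M \<Longrightarrow> is_module C (below P Q g q) M"
  by (rule is_moduleI) (auto simp: is_moduleD)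

text \<open>Used to pass from diagrams indexed by the stars inside an open set, where the cosheaf condition
  speaks, to diagrams indexed by cells, where the pushforward along the star map is computed.\<close>

lemma colimit_reindex:
  assumes col: "is_colimit (poset_cat R) C D L \<iota>"
    and bij: "bij_betw g (carrier P) (carrier R)"
    and emb: "\<And>p p'. p \<in> carrier P \<Longrightarrow> p' \<in> carrier P \<Longrightarrow> p \<sqsubseteq>\<^bsub>P\<^esub> p' \<longleftrightarrow> g p \<sqsubseteq>\<^bsub>R\<^esub> g p'"
  shows "is_colimit (poset_cat P) C (pullback g D) L (\<lambda>p. \<iota> (g p))"
proof -
  define h where "h = inv_into (carrier P) g"
  have h: "h r \<in> carrier P" "g (h r) = r" if "r \<in> carrier R" for r
    using that bij by (auto simp: h_def bij_betw_def f_inv_into_f inv_into_into)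
  have hg: "h (g p) = p" if "p \<in> carrier P" for p
    using that bij by (auto simp: h_def bij_betw_def)
  have g: "g p \<in> carrier R" if "p \<in> carrier P" for p
    using that bij by (auto simp: bij_betw_def)
  have "is_cocone (poset_cat P) C (pullback g D) L (\<lambda>p. \<iota> (g p))"
    using col g emb by (auto simp: is_colimit_def is_cocone_poset_iff)
  moreover have "\<exists>!u. u \<in> Hom C L X \<and> (\<forall>p\<in>carrier P. u \<cdot>\<^bsub>C\<^esub> \<iota> (g p) = \<kappa> p)"
    if \<kappa>: "is_cocone (poset_cat P) C (pullback g D) X \<kappa>" for X \<kappa>
  proof -
    have leg: "\<kappa> (h r) \<in> Hom C (obj_map D r) X" if "r \<in> carrier R" for r
      using \<kappa> h[OF that] by (auto simp: is_cocone_poset_iff)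
    have "\<kappa> (h s) \<cdot>\<^bsub>C\<^esub> arr_map D (r, s) = \<kappa> (h r)"
      if "r \<in> carrier R" "s \<in> carrier R" "r \<sqsubseteq>\<^bsub>R\<^esub> s" for r s
    proof -
      have "h r \<sqsubseteq>\<^bsub>P\<^esub> h s"
        using emb[of "h r" "h s"] h that by simp
      then have "\<kappa> (h s) \<cdot>\<^bsub>C\<^esub> arr_map D (g (h r), g (h s)) = \<kappa> (h r)"
        using \<kappa> h(1) that by (simp add: is_cocone_poset_iff)
      then show ?thesis
        using h(2) that by simp
    qed
    then have "is_cocone (poset_cat R) C D X (\<lambda>r. \<kappa> (h r))"
      using \<kappa> leg by (auto simp: is_cocone_poset_iff)
    then have "\<exists>!u. u \<in> Hom C L X \<and> (\<forall>r\<in>carrier R. u \<cdot>\<^bsub>C\<^esub> \<iota> r = \<kappa> (h r))"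
      using col by (simp add: is_colimit_def)
    moreover have "(\<forall>r\<in>carrier R. u \<cdot>\<^bsub>C\<^esub> \<iota> r = \<kappa> (h r)) \<longleftrightarrow> (\<forall>p\<in>carrier P. u \<cdot>\<^bsub>C\<^esub> \<iota> (g p) = \<kappa> p)" for u
      using g h hg by metis
    ultimately show ?thesis
      by simp
  qed
  ultimately show ?thesis
    by (simp add: is_colimit_def)
qed

section \<open>Pushforward along a monotone map\<close>

locale pushforward_setting = category C
  for C :: "('o, 'm) cat" (structure) and P :: "'p gorder" and Q :: "'q gorder" and g :: "'p \<Rightarrow> 'q" +
  assumes P: "partial_order P" and Q: "partial_order Q"
    and g_closed: "p \<in> carrier P \<Longrightarrow> g p \<in> carrier Q"
    and g_mono: "p \<in> carrier P \<Longrightarrow> p' \<in> carrier P \<Longrightarrow> p \<sqsubseteq>\<^bsub>P\<^esub> p' \<Longrightarrow> g p \<sqsubseteq>\<^bsub>Q\<^esub> g p'"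
    and cocomplete: "cocomplete TYPE('p) TYPE('p \<times> 'p) C"
begin

abbreviation "push_diagram q \<equiv> poset_cat (below P Q g q)"
abbreviation "push \<equiv> pushforward C P Q g"
abbreviation "incl \<equiv> push_in C P Q g"
abbreviation "counit \<equiv> push_counit C P Q g"

lemma Q_refl: "q \<in> carrier Q \<Longrightarrow> q \<sqsubseteq>\<^bsub>Q\<^esub> q"
  using Q by (simp add: partial_order_def weak_partial_order.le_refl)

lemma Q_trans: "a \<in> carrier Q \<Longrightarrow> b \<in> carrier Q \<Longrightarrow> c \<in> carrier Q
    \<Longrightarrow> a \<sqsubseteq>\<^bsub>Q\<^esub> b \<Longrightarrow> b \<sqsubseteq>\<^bsub>Q\<^esub> c \<Longrightarrow> a \<sqsubseteq>\<^bsub>Q\<^esub> c"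
  using Q weak_partial_order.le_trans[of Q a b c] by (simp add: partial_order_def)

lemma category_push_diagram: "category (push_diagram q)"
  using P by (intro category_poset_cat partial_order_below)

lemma push_colimit:
  assumes "is_module C P M"
  shows "is_colimit (push_diagram q) C M (obj_map (push M) q) (incl M q)"
proof -
  obtain L \<iota> where "is_colimit (push_diagram q) C M L \<iota>"
    using cocomplete[unfolded cocomplete_def, rule_format,
        OF conjI[OF category_push_diagram is_module_below[OF assms]]] by blast
  then show ?thesis
    by (simp add: colim_is_colimit pushforward_def push_ob_def push_in_def)
qed

lemma push_ob_Ob: "is_module C P M \<Longrightarrow> obj_map (push M) q \<in> Ob C"
  using push_colimit[of M q] by (simp add: is_colimit_def is_cocone_def)

lemma incl_Hom:
  "is_module C P M \<Longrightarrow> p \<in> carrier P \<Longrightarrow> g p \<sqsubseteq>\<^bsub>Q\<^esub> q \<Longrightarrow> incl M q p \<in> Hom C (obj_map M p) (obj_map (push M) q)"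
  using push_colimit[of M q] by (simp add: is_colimit_def is_cocone_poset_iff)

lemma incl_arr:
  "is_module C P M \<Longrightarrow> q \<in> carrier Q \<Longrightarrow> p \<in> carrier P \<Longrightarrow> p' \<in> carrier P \<Longrightarrow> p \<sqsubseteq>\<^bsub>P\<^esub> p' \<Longrightarrow> g p' \<sqsubseteq>\<^bsub>Q\<^esub> q
   \<Longrightarrow> incl M q p' \<cdot> arr_map M (p, p') = incl M q p"
  using push_colimit[of M q] Q_trans[of "g p" "g p'" q] g_mono[of p p'] g_closed[of p] g_closed[of p']
  by (simp add: is_colimit_def is_cocone_poset_iff)

lemma push_eqI:
  assumes "is_module C P M" "u \<in> Hom C (obj_map (push M) q) X" "v \<in> Hom C (obj_map (push M) q) X"
    and "\<And>p. p \<in> carrier P \<Longrightarrow> g p \<sqsubseteq>\<^bsub>Q\<^esub> q \<Longrightarrow> u \<cdot> incl M q p = v \<cdot> incl M q p"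
  shows "u = v"
  by (rule colimit_eqI[OF category_push_diagram is_module_below[OF assms(1)]
        push_colimit[OF assms(1)] assms(2,3)]) (simp add: assms(4))

lemma
  assumes M: "is_module C P M" and \<kappa>: "is_cocone (push_diagram q) C M X \<kappa>"
  shows push_desc_Hom: "push_desc C P Q g M q X \<kappa> \<in> Hom C (obj_map (push M) q) X"
    and push_desc_incl: "p \<in> carrier P \<Longrightarrow> g p \<sqsubseteq>\<^bsub>Q\<^esub> q
      \<Longrightarrow> push_desc C P Q g M q X \<kappa> \<cdot> incl M q p = \<kappa> p"
  using colim_desc_Hom[OF push_colimit[OF M] \<kappa>] colim_desc_in[OF push_colimit[OF M] \<kappa>]
  by (simp_all add: push_desc_def push_in_def pushforward_def push_ob_def)

lemma
  assumes M: "is_module C P M" and q: "q \<in> carrier Q" "q' \<in> carrier Q" "q \<sqsubseteq>\<^bsub>Q\<^esub> q'"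
  shows push_arr_Hom: "arr_map (push M) (q, q') \<in> Hom C (obj_map (push M) q) (obj_map (push M) q')"
    and push_arr_incl: "p \<in> carrier P \<Longrightarrow> g p \<sqsubseteq>\<^bsub>Q\<^esub> q
      \<Longrightarrow> arr_map (push M) (q, q') \<cdot> incl M q p = incl M q' p"
proof -
  have "is_cocone (push_diagram q) C M (obj_map (push M) q') (incl M q')"
    using push_colimit[OF M, of q'] q Q_trans[of _ q q'] g_closed
    by (auto simp: is_colimit_def is_cocone_poset_iff)
  note desc = push_desc_Hom[OF M this] push_desc_incl[OF M this]
  have arr: "arr_map (push M) (q, q') = push_desc C P Q g M q (obj_map (push M) q') (incl M q')"
    by (simp add: pushforward_def)
  show "arr_map (push M) (q, q') \<in> Hom C (obj_map (push M) q) (obj_map (push M) q')"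
    and "p \<in> carrier P \<Longrightarrow> g p \<sqsubseteq>\<^bsub>Q\<^esub> q \<Longrightarrow> arr_map (push M) (q, q') \<cdot> incl M q p = incl M q' p"
    unfolding arr using desc by auto
qed

lemma is_module_push:
  assumes M: "is_module C P M"
  shows "is_module C Q (push M)"
proof (rule is_moduleI)
  show "obj_map (push M) q \<in> Ob C" for q
    using push_ob_Ob[OF M] .
  show "arr_map (push M) (q, q') \<in> Hom C (obj_map (push M) q) (obj_map (push M) q')"
    if "q \<in> carrier Q" "q' \<in> carrier Q" "q \<sqsubseteq>\<^bsub>Q\<^esub> q'" for q q'
    using push_arr_Hom[OF M that] .
  show "arr_map (push M) (q, q) = Id C (obj_map (push M) q)" if q: "q \<in> carrier Q" for q
  proof (rule push_eqI[OF M push_arr_Hom[OF M q q Q_refl[OF q]] Id_closed[OF push_ob_Ob[OF M]]])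
    show "arr_map (push M) (q, q) \<cdot> incl M q p = Id C (obj_map (push M) q) \<cdot> incl M q p"
      if p: "p \<in> carrier P" "g p \<sqsubseteq>\<^bsub>Q\<^esub> q" for p
      using push_arr_incl[OF M q q Q_refl[OF q] p] incl_Hom[OF M p] by (simp add: arrow_simps)
  qed
  fix q r s assume q: "q \<in> carrier Q" "r \<in> carrier Q" "s \<in> carrier Q" "q \<sqsubseteq>\<^bsub>Q\<^esub> r" "r \<sqsubseteq>\<^bsub>Q\<^esub> s"
  have "q \<sqsubseteq>\<^bsub>Q\<^esub> s"
    using Q_trans q by blast
  note homs = push_arr_Hom[OF M q(1,2,4)] push_arr_Hom[OF M q(2,3,5)] push_arr_Hom[OF M q(1,3) this]
  show "arr_map (push M) (r, s) \<cdot> arr_map (push M) (q, r) = arr_map (push M) (q, s)"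
  proof (rule push_eqI[OF M])
    fix p assume p: "p \<in> carrier P" "g p \<sqsubseteq>\<^bsub>Q\<^esub> q"
    then have "g p \<sqsubseteq>\<^bsub>Q\<^esub> r"
      using Q_trans q g_closed by blast
    then show "(arr_map (push M) (r, s) \<cdot> arr_map (push M) (q, r)) \<cdot> incl M q p
      = arr_map (push M) (q, s) \<cdot> incl M q p"
      using homs incl_Hom[OF M p] p push_arr_incl[OF M q(1,2,4)] push_arr_incl[OF M q(2,3,5)]
        push_arr_incl[OF M q(1,3) \<open>q \<sqsubseteq>\<^bsub>Q\<^esub> s\<close>]
      by (simp add: arrow_simps)
  qed (use homs in \<open>auto simp: arrow_simps\<close>)
qed

lemma is_module_restrict: "is_module C Q N \<Longrightarrow> is_module C P (pullback g N)"
  by (erule is_module_pullback) (simp_all add: g_closed g_mono)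

lemma
  assumes N: "is_module C Q N" and q: "q \<in> carrier Q"
  shows counit_Hom: "counit N q \<in> Hom C (obj_map (push (pullback g N)) q) (obj_map N q)"
    and counit_incl: "p \<in> carrier P \<Longrightarrow> g p \<sqsubseteq>\<^bsub>Q\<^esub> q
      \<Longrightarrow> counit N q \<cdot> incl (pullback g N) q p = arr_map N (g p, q)"
proof -
  have "is_cocone (push_diagram q) C (pullback g N) (obj_map N q) (\<lambda>p. arr_map N (g p, q))"
    using q g_closed g_mono by (auto simp: is_cocone_poset_iff is_moduleD[OF N])
  note desc = push_desc_Hom[OF is_module_restrict[OF N] this]
    push_desc_incl[OF is_module_restrict[OF N] this]
  show "counit N q \<in> Hom C (obj_map (push (pullback g N)) q) (obj_map N q)"
    and "p \<in> carrier P \<Longrightarrow> g p \<sqsubseteq>\<^bsub>Q\<^esub> q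
      \<Longrightarrow> counit N q \<cdot> incl (pullback g N) q p = arr_map N (g p, q)"
    unfolding push_counit_def using desc by auto
qed

text \<open>Both sides agree after precomposition with every leg of the colimit at \<open>q\<close>, since each leg turns
  the counit into an internal map of \<open>N\<close>.\<close>

lemma counit_natural:
  assumes N: "is_module C Q N" and q: "q \<in> carrier Q" "q' \<in> carrier Q" "q \<sqsubseteq>\<^bsub>Q\<^esub> q'"
  shows "counit N q' \<cdot> arr_map (push (pullback g N)) (q, q') = arr_map N (q, q') \<cdot> counit N q"
proof (rule push_eqI[OF is_module_restrict[OF N]])
  note R = is_module_restrict[OF N]
  note homs = counit_Hom[OF N q(1)] counit_Hom[OF N q(2)] push_arr_Hom[OF R q] is_moduleD(2)[OF N q]
  fix p assume p: "p \<in> carrier P" "g p \<sqsubseteq>\<^bsub>Q\<^esub> q"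
  then have "g p \<sqsubseteq>\<^bsub>Q\<^esub> q'"
    using Q_trans q g_closed by blast
  then show "(counit N q' \<cdot> arr_map (push (pullback g N)) (q, q')) \<cdot> incl (pullback g N) q p
    = (arr_map N (q, q') \<cdot> counit N q) \<cdot> incl (pullback g N) q p"
    using homs incl_Hom[OF R p] p q g_closed push_arr_incl[OF R q] counit_incl[OF N q(1)] counit_incl[OF N q(2)]
    by (simp add: arrow_simps is_moduleD(4)[OF N])
qed (use counit_Hom[OF N] push_arr_Hom[OF is_module_restrict[OF N]] is_moduleD(2)[OF N] q
      in \<open>auto simp: arrow_simps\<close>)

text \<open>A module is determined by its restriction along \<open>g\<close> if it is the pointwise left Kan extension of
  that restriction. On grid opens every cosheaf has this property for the star map.\<close>

definition determined :: "('q, 'o, 'm) pmodule \<Rightarrow> bool" where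
  "determined M \<longleftrightarrow> is_module C Q M \<and>
     (\<forall>q \<in> carrier Q. is_colimit (push_diagram q) C (pullback g M) (obj_map M q) (\<lambda>p. arr_map M (g p, q)))"

text \<open>For a determined module the counit is a comparison map between two colimits of the same diagram,
  hence invertible; the choice below is meaningful only in that case.\<close>

definition counit_inv :: "('q, 'o, 'm) pmodule \<Rightarrow> 'q \<Rightarrow> 'm" where
  "counit_inv M q = (SOME d. d \<in> Hom C (obj_map M q) (obj_map (push (pullback g M)) q) \<and>
     counit M q \<cdot> d = Id C (obj_map M q) \<and> d \<cdot> counit M q = Id C (obj_map (push (pullback g M)) q))"

lemma determined_is_module: "determined M \<Longrightarrow> is_module C Q M"
  by (simp add: determined_def)

lemma
  assumes M: "determined M" and q: "q \<in> carrier Q"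
  shows counit_inv_Hom: "counit_inv M q \<in> Hom C (obj_map M q) (obj_map (push (pullback g M)) q)"
    and counit_counit_inv: "counit M q \<cdot> counit_inv M q = Id C (obj_map M q)"
    and counit_inv_counit: "counit_inv M q \<cdot> counit M q = Id C (obj_map (push (pullback g M)) q)"
proof -
  have N: "is_module C Q M"
    and col: "is_colimit (push_diagram q) C (pullback g M) (obj_map M q) (\<lambda>p. arr_map M (g p, q))"
    using M q by (auto simp: determined_def)
  have "\<exists>d. d \<in> Hom C (obj_map M q) (obj_map (push (pullback g M)) q) \<and>
     counit M q \<cdot> d = Id C (obj_map M q) \<and> d \<cdot> counit M q = Id C (obj_map (push (pullback g M)) q)"
    using colimits_isomorphic[OF category_push_diagram is_module_below[OF is_module_restrict[OF N]]
        push_colimit[OF is_module_restrict[OF N]] col counit_Hom[OF N q]] counit_incl[OF N q]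
    by auto
  from someI_ex[OF this, folded counit_inv_def]
  show "counit_inv M q \<in> Hom C (obj_map M q) (obj_map (push (pullback g M)) q)"
    and "counit M q \<cdot> counit_inv M q = Id C (obj_map M q)"
    and "counit_inv M q \<cdot> counit M q = Id C (obj_map (push (pullback g M)) q)"
    by auto
qed

lemma counit_inv_natural:
  assumes M: "determined M" and q: "q \<in> carrier Q" "q' \<in> carrier Q" "q \<sqsubseteq>\<^bsub>Q\<^esub> q'"
  shows "counit_inv M q' \<cdot> arr_map M (q, q') = arr_map (push (pullback g M)) (q, q') \<cdot> counit_inv M q"
proof -
  note N = determined_is_module[OF M]
  note R = is_module_restrict[OF N]
  note homs = counit_Hom[OF N q(1)] counit_Hom[OF N q(2)] push_arr_Hom[OF R q] is_moduleD(2)[OF N q]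
    counit_inv_Hom[OF M q(1)] counit_inv_Hom[OF M q(2)]
  have "counit_inv M q' \<cdot> arr_map M (q, q')
    = counit_inv M q' \<cdot> (arr_map M (q, q') \<cdot> (counit M q \<cdot> counit_inv M q))"
    using homs counit_counit_inv[OF M q(1)] by (simp add: arrow_simps)
  also have "\<dots> = counit_inv M q' \<cdot> ((arr_map M (q, q') \<cdot> counit M q) \<cdot> counit_inv M q)"
    using homs by (simp add: arrow_simps)
  also have "\<dots> = (counit_inv M q' \<cdot> counit M q') \<cdot> (arr_map (push (pullback g M)) (q, q') \<cdot> counit_inv M q)"
    unfolding counit_natural[OF N q, symmetric] using homs by (simp add: arrow_simps)
  also have "\<dots> = arr_map (push (pullback g M)) (q, q') \<cdot> counit_inv M q"
    using homs counit_inv_counit[OF M q(2)] by (simp add: arrow_simps)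
  finally show ?thesis .
qed

text \<open>At \<open>g p\<close> the diagram has \<open>p\<close> itself as an index, and its leg into \<open>M (g p)\<close> is an identity. So the
  unit is the inverse of the counit there.\<close>

lemma push_unit_eq_counit_inv:
  assumes M: "determined M" and p: "p \<in> carrier P"
  shows "push_unit C P Q g (pullback g M) p = counit_inv M (g p)"
proof -
  note N = determined_is_module[OF M]
  note R = is_module_restrict[OF N]
  note q = g_closed[OF p]
  note pp = Q_refl[OF q]
  have "counit_inv M (g p) = counit_inv M (g p) \<cdot> arr_map M (g p, g p)"
    using is_moduleD(3)[OF N q] counit_inv_Hom[OF M q] by (simp add: arrow_simps)
  also have "\<dots> = counit_inv M (g p) \<cdot> (counit M (g p) \<cdot> incl (pullback g M) (g p) p)"
    using counit_incl[OF N q p pp] by simp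
  also have "\<dots> = (counit_inv M (g p) \<cdot> counit M (g p)) \<cdot> incl (pullback g M) (g p) p"
    using counit_inv_Hom[OF M q] counit_Hom[OF N q] incl_Hom[OF R p pp] by (simp add: arrow_simps)
  also have "\<dots> = incl (pullback g M) (g p) p"
    using counit_inv_counit[OF M q] incl_Hom[OF R p pp] by (simp add: arrow_simps)
  finally show ?thesis
    by (simp add: push_unit_def)
qed

end

section \<open>Relative interleavings\<close>

locale translation_family =
  fixes Q :: "'q gorder" and T :: "real \<Rightarrow> 'q \<Rightarrow> 'q"
  assumes T_closed: "0 \<le> \<epsilon> \<Longrightarrow> q \<in> carrier Q \<Longrightarrow> T \<epsilon> q \<in> carrier Q"
    and T_mono: "0 \<le> \<epsilon> \<Longrightarrow> q \<in> carrier Q \<Longrightarrow> q' \<in> carrier Q \<Longrightarrow> q \<sqsubseteq>\<^bsub>Q\<^esub> q' \<Longrightarrow> T \<epsilon> q \<sqsubseteq>\<^bsub>Q\<^esub> T \<epsilon> q'"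
    and T_extensive: "0 \<le> \<epsilon> \<Longrightarrow> q \<in> carrier Q \<Longrightarrow> q \<sqsubseteq>\<^bsub>Q\<^esub> T \<epsilon> q"
    and T_superlinear: "0 \<le> \<epsilon> \<Longrightarrow> 0 \<le> \<epsilon>' \<Longrightarrow> q \<in> carrier Q
      \<Longrightarrow> T \<epsilon>' (T \<epsilon> q) \<sqsubseteq>\<^bsub>Q\<^esub> T (\<epsilon> + \<epsilon>') q"

context translation_family
begin

lemma T_twice: "0 \<le> \<epsilon> \<Longrightarrow> q \<in> carrier Q \<Longrightarrow> T \<epsilon> (T \<epsilon> q) \<sqsubseteq>\<^bsub>Q\<^esub> T (2 * \<epsilon>) q"
  using T_superlinear[of \<epsilon> \<epsilon> q] by simp

text \<open>Monotonicity in the parameter follows from superlinearity and extensivity: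
  \<open>T 0 q \<le> T \<epsilon> (T 0 q) \<le> T (0 + \<epsilon>) q\<close>.\<close>

lemma T_zero_le:
  assumes "partial_order Q" and \<epsilon>: "0 \<le> \<epsilon>" and q: "q \<in> carrier Q"
  shows "T 0 q \<sqsubseteq>\<^bsub>Q\<^esub> T \<epsilon> q"
proof -
  interpret partial_order Q by fact
  have "T 0 q \<in> carrier Q"
    using T_closed q by simp
  then show ?thesis
    using le_trans[of "T 0 q" "T \<epsilon> (T 0 q)" "T \<epsilon> q"] T_superlinear[of 0 \<epsilon> q] T_extensive[OF \<epsilon>]
      T_closed[OF \<epsilon>] q \<epsilon> by simp
qed

end

lemma shift_simps [simp]:
  "obj_map (shift T \<epsilon> M) q = obj_map M (T \<epsilon> q)"
  "arr_map (shift T \<epsilon> M) (q, r) = arr_map M (T \<epsilon> q, T \<epsilon> r)"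
  by (simp_all add: shift_def)

locale relative_setting = pushforward_setting C P Q g + translation_family Q T
  for C :: "('o, 'm) cat" (structure) and P :: "'p gorder" and Q :: "'q gorder" and g :: "'p \<Rightarrow> 'q"
    and T :: "real \<Rightarrow> 'q \<Rightarrow> 'q" +
  fixes \<epsilon> :: real
  assumes eps: "0 \<le> \<epsilon>"
begin

abbreviation "S \<equiv> T \<epsilon>"
abbreviation "rel \<equiv> rel_shift C P Q g T \<epsilon>"

lemmas S_closed = T_closed[OF eps]
lemmas S_mono = T_mono[OF eps]

lemmas SS_le = T_twice[OF eps]

lemma T0_le: "q \<in> carrier Q \<Longrightarrow> T 0 q \<sqsubseteq>\<^bsub>Q\<^esub> T (2 * \<epsilon>) q"
  using T_zero_le[OF Q] eps by simp

lemma is_module_shift: "is_module C Q M \<Longrightarrow> is_module C Q (shift T \<epsilon> M)"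
  unfolding shift_def by (erule is_module_pullback) (simp_all add: S_closed S_mono)

lemma rel_simps:
  "obj_map (rel M) p = obj_map (push M) (S (g p))"
  "arr_map (rel M) (p, p') = arr_map (push M) (S (g p), S (g p'))"
  by (simp_all add: rel_shift_def)

text \<open>A morphism \<open>M \<rightarrow> N \<circ> S\<close> restricts to the image of \<open>g\<close>, and the inverse counit moves its target to the
  pushforward. For determined modules this is the bijection between morphisms over \<open>Q\<close> and relative
  morphisms over \<open>P\<close>; the next lemmas show that it is well defined, onto, and compatible with the
  interleaving identities.\<close>

definition mate :: "('q, 'o, 'm) pmodule \<Rightarrow> ('q \<Rightarrow> 'm) \<Rightarrow> 'p \<Rightarrow> 'm" where
  "mate N \<phi> p = counit_inv N (S (g p)) \<cdot> \<phi> (g p)"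

lemma is_module_hom_mate:
  assumes M: "determined M" and N: "determined N" and \<phi>: "is_module_hom C Q M (shift T \<epsilon> N) \<phi>"
  shows "is_module_hom C P (pullback g M) (rel (pullback g N)) (mate N \<phi>)"
  unfolding is_module_hom_iff rel_simps pullback_simps
proof (intro conjI ballI impI)
  note modN = determined_is_module[OF N] and modM = determined_is_module[OF M]
  note RN = is_module_restrict[OF modN]
  have \<phi>_Hom: "\<phi> q \<in> Hom C (obj_map M q) (obj_map N (S q))" if "q \<in> carrier Q" for q
    using \<phi> that by (simp add: is_module_hom_iff)
  show "mate N \<phi> p \<in> Hom C (obj_map M (g p)) (obj_map (push (pullback g N)) (S (g p)))"
    if p: "p \<in> carrier P" for p
    using \<phi>_Hom[OF g_closed[OF p]] counit_inv_Hom[OF N S_closed[OF g_closed[OF p]]]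
    by (simp add: mate_def arrow_simps)
  fix p p' assume p: "p \<in> carrier P" "p' \<in> carrier P" "p \<sqsubseteq>\<^bsub>P\<^esub> p'"
  note q = g_closed[OF p(1)] g_closed[OF p(2)] g_mono[OF p]
  note Sq = S_closed[OF q(1)] S_closed[OF q(2)] S_mono[OF q]
  note homs = is_moduleD(2)[OF modM q] is_moduleD(2)[OF modN Sq] push_arr_Hom[OF RN Sq]
    counit_inv_Hom[OF N Sq(1)] counit_inv_Hom[OF N Sq(2)] \<phi>_Hom[OF q(1)] \<phi>_Hom[OF q(2)]
  have "mate N \<phi> p' \<cdot> arr_map M (g p, g p')
    = counit_inv N (S (g p')) \<cdot> (\<phi> (g p') \<cdot> arr_map M (g p, g p'))"
    using homs by (simp add: mate_def arrow_simps)
  also have "\<phi> (g p') \<cdot> arr_map M (g p, g p') = arr_map N (S (g p), S (g p')) \<cdot> \<phi> (g p)"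
    using \<phi> q by (simp add: is_module_hom_iff)
  also have "counit_inv N (S (g p')) \<cdot> (arr_map N (S (g p), S (g p')) \<cdot> \<phi> (g p))
    = (counit_inv N (S (g p')) \<cdot> arr_map N (S (g p), S (g p'))) \<cdot> \<phi> (g p)"
    using homs by (simp add: arrow_simps)
  also have "\<dots> = (arr_map (push (pullback g N)) (S (g p), S (g p')) \<cdot> counit_inv N (S (g p))) \<cdot> \<phi> (g p)"
    by (simp only: counit_inv_natural[OF N Sq])
  also have "\<dots> = arr_map (push (pullback g N)) (S (g p), S (g p')) \<cdot> mate N \<phi> p"
    using homs by (simp add: mate_def arrow_simps)
  finally show "mate N \<phi> p' \<cdot> arr_map M (g p, g p')
    = arr_map (push (pullback g N)) (S (g p), S (g p')) \<cdot> mate N \<phi> p" .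
qed

text \<open>The value of a determined module at \<open>q\<close> is a colimit, so maps out of it are detected and constructed
  on the elements \<open>g p\<close> below \<open>q\<close>.\<close>

lemma determined_hom_eqI:
  assumes M: "determined M" and q: "q \<in> carrier Q"
    and uv: "u \<in> Hom C (obj_map M q) X" "v \<in> Hom C (obj_map M q) X"
    and eq: "\<And>p. p \<in> carrier P \<Longrightarrow> g p \<sqsubseteq>\<^bsub>Q\<^esub> q \<Longrightarrow> u \<cdot> arr_map M (g p, q) = v \<cdot> arr_map M (g p, q)"
  shows "u = v"
proof (rule colimit_eqI[OF category_push_diagram _ _ uv])
  show "is_module C (below P Q g q) (pullback g M)"
    using is_module_below[OF is_module_restrict[OF determined_is_module[OF M]]] .
  show "is_colimit (push_diagram q) C (pullback g M) (obj_map M q) (\<lambda>p. arr_map M (g p, q))"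
    using M q by (simp add: determined_def)
qed (simp add: eq)

lemma determined_desc:
  assumes M: "determined M" and q: "q \<in> carrier Q"
    and \<kappa>: "is_cocone (push_diagram q) C (pullback g M) X \<kappa>"
  shows "\<exists>u \<in> Hom C (obj_map M q) X. \<forall>p \<in> carrier P. g p \<sqsubseteq>\<^bsub>Q\<^esub> q \<longrightarrow> u \<cdot> arr_map M (g p, q) = \<kappa> p"
proof -
  have "is_colimit (push_diagram q) C (pullback g M) (obj_map M q) (\<lambda>p. arr_map M (g p, q))"
    using M q by (simp add: determined_def)
  then have "\<exists>!u. u \<in> Hom C (obj_map M q) X \<and>
      (\<forall>p \<in> carrier (below P Q g q). u \<cdot> arr_map M (g p, q) = \<kappa> p)"
    using \<kappa> by (simp add: is_colimit_def)
  then show ?thesis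
    by auto
qed

text \<open>Composing \<open>\<phi>\<close> with the counit gives compatible maps \<open>M (g p) \<rightarrow> N (S (g p))\<close>; followed by internal
  maps of \<open>N\<close> they form a cocone with apex \<open>N (S q)\<close> for every \<open>q\<close>, and the induced maps are the wanted
  morphism.\<close>

lemma ex_mate:
  assumes M: "determined M" and N: "determined N"
    and \<phi>: "is_module_hom C P (pullback g M) (rel (pullback g N)) \<phi>"
  shows "\<exists>\<phi>'. is_module_hom C Q M (shift T \<epsilon> N) \<phi>' \<and> (\<forall>p \<in> carrier P. \<phi> p = mate N \<phi>' p)"
proof -
  note modN = determined_is_module[OF N] and modM = determined_is_module[OF M]
  note RN = is_module_restrict[OF modN]
  have \<phi>_Hom: "\<phi> p \<in> Hom C (obj_map M (g p)) (obj_map (push (pullback g N)) (S (g p)))"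
    if "p \<in> carrier P" for p
    using \<phi> that by (simp add: is_module_hom_iff rel_simps)
  define \<theta> where "\<theta> p = counit N (S (g p)) \<cdot> \<phi> p" for p
  have \<theta>_Hom: "\<theta> p \<in> Hom C (obj_map M (g p)) (obj_map N (S (g p)))" if p: "p \<in> carrier P" for p
    using \<phi>_Hom[OF p] counit_Hom[OF modN S_closed[OF g_closed[OF p]]]
    by (simp add: \<theta>_def arrow_simps)
  have \<theta>_natural: "\<theta> p' \<cdot> arr_map M (g p, g p') = arr_map N (S (g p), S (g p')) \<cdot> \<theta> p"
    if p: "p \<in> carrier P" "p' \<in> carrier P" "p \<sqsubseteq>\<^bsub>P\<^esub> p'" for p p'
  proof -
    note q = g_closed[OF p(1)] g_closed[OF p(2)] g_mono[OF p]
    note Sq = S_closed[OF q(1)] S_closed[OF q(2)] S_mono[OF q]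
    note homs = is_moduleD(2)[OF modM q] is_moduleD(2)[OF modN Sq] push_arr_Hom[OF RN Sq]
      counit_Hom[OF modN Sq(1)] counit_Hom[OF modN Sq(2)] \<phi>_Hom[OF p(1)] \<phi>_Hom[OF p(2)]
    have "\<theta> p' \<cdot> arr_map M (g p, g p') = counit N (S (g p')) \<cdot> (\<phi> p' \<cdot> arr_map M (g p, g p'))"
      using homs by (simp add: \<theta>_def arrow_simps)
    also have "\<phi> p' \<cdot> arr_map M (g p, g p') = arr_map (push (pullback g N)) (S (g p), S (g p')) \<cdot> \<phi> p"
      using \<phi> p by (simp add: is_module_hom_iff rel_simps)
    also have "counit N (S (g p')) \<cdot> (arr_map (push (pullback g N)) (S (g p), S (g p')) \<cdot> \<phi> p)
      = (counit N (S (g p')) \<cdot> arr_map (push (pullback g N)) (S (g p), S (g p'))) \<cdot> \<phi> p"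
      using homs by (simp add: arrow_simps)
    also have "\<dots> = (arr_map N (S (g p), S (g p')) \<cdot> counit N (S (g p))) \<cdot> \<phi> p"
      by (simp only: counit_natural[OF modN Sq])
    also have "\<dots> = arr_map N (S (g p), S (g p')) \<cdot> \<theta> p"
      using homs by (simp add: \<theta>_def arrow_simps)
    finally show ?thesis .
  qed
  have "\<exists>u \<in> Hom C (obj_map M q) (obj_map N (S q)).
      \<forall>p \<in> carrier P. g p \<sqsubseteq>\<^bsub>Q\<^esub> q \<longrightarrow> u \<cdot> arr_map M (g p, q) = arr_map N (S (g p), S q) \<cdot> \<theta> p"
    if q: "q \<in> carrier Q" for q
  proof (rule determined_desc[OF M q])
    have "arr_map N (S (g p), S q) \<cdot> \<theta> p \<in> Hom C (obj_map M (g p)) (obj_map N (S q))"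
      if p: "p \<in> carrier P" "g p \<sqsubseteq>\<^bsub>Q\<^esub> q" for p
      using \<theta>_Hom[OF p(1)] is_moduleD(2)[OF modN S_closed S_closed S_mono, OF g_closed q g_closed q p(2)] p
      by (simp add: arrow_simps)
    moreover have "(arr_map N (S (g p'), S q) \<cdot> \<theta> p') \<cdot> arr_map M (g p, g p') = arr_map N (S (g p), S q) \<cdot> \<theta> p"
      if p: "p \<in> carrier P" "p' \<in> carrier P" "g p \<sqsubseteq>\<^bsub>Q\<^esub> q" "g p' \<sqsubseteq>\<^bsub>Q\<^esub> q" "p \<sqsubseteq>\<^bsub>P\<^esub> p'" for p p'
    proof -
      note r = g_closed[OF p(1)] g_closed[OF p(2)] g_mono[OF p(1,2,5)]
      note Sr = S_closed[OF r(1)] S_closed[OF r(2)] S_mono[OF r]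
      note Sp = S_mono[OF r(1) q p(3)] S_mono[OF r(2) q p(4)]
      note homs = is_moduleD(2)[OF modM r] is_moduleD(2)[OF modN Sr] \<theta>_Hom[OF p(1)] \<theta>_Hom[OF p(2)]
        is_moduleD(2)[OF modN Sr(1) S_closed[OF q] Sp(1)] is_moduleD(2)[OF modN Sr(2) S_closed[OF q] Sp(2)]
      have "(arr_map N (S (g p'), S q) \<cdot> \<theta> p') \<cdot> arr_map M (g p, g p')
        = arr_map N (S (g p'), S q) \<cdot> (\<theta> p' \<cdot> arr_map M (g p, g p'))"
        using homs by (simp add: arrow_simps)
      also have "\<dots> = (arr_map N (S (g p'), S q) \<cdot> arr_map N (S (g p), S (g p'))) \<cdot> \<theta> p"
        unfolding \<theta>_natural[OF p(1,2,5)] using homs by (simp add: arrow_simps)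
      also have "\<dots> = arr_map N (S (g p), S q) \<cdot> \<theta> p"
        by (simp only: is_moduleD(4)[OF modN Sr(1,2) S_closed[OF q] Sr(3) Sp(2)])
      finally show ?thesis .
    qed
    ultimately show "is_cocone (push_diagram q) C (pullback g M) (obj_map N (S q))
        (\<lambda>p. arr_map N (S (g p), S q) \<cdot> \<theta> p)"
      using is_moduleD(1)[OF modN S_closed[OF q]] by (simp add: is_cocone_poset_iff)
  qed
  then obtain \<phi>' where \<phi>'_Hom: "\<And>q. q \<in> carrier Q \<Longrightarrow> \<phi>' q \<in> Hom C (obj_map M q) (obj_map N (S q))"
    and \<phi>'_arr: "\<And>p q. q \<in> carrier Q \<Longrightarrow> p \<in> carrier P \<Longrightarrow> g p \<sqsubseteq>\<^bsub>Q\<^esub> q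
      \<Longrightarrow> \<phi>' q \<cdot> arr_map M (g p, q) = arr_map N (S (g p), S q) \<cdot> \<theta> p"
    by metis
  have "\<phi>' r \<cdot> arr_map M (q, r) = arr_map N (S q, S r) \<cdot> \<phi>' q"
    if q: "q \<in> carrier Q" "r \<in> carrier Q" "q \<sqsubseteq>\<^bsub>Q\<^esub> r" for q r
  proof (rule determined_hom_eqI[OF M q(1)])
    note Sq = S_closed[OF q(1)] S_closed[OF q(2)] S_mono[OF q]
    note homs = \<phi>'_Hom[OF q(1)] \<phi>'_Hom[OF q(2)] is_moduleD(2)[OF modM q] is_moduleD(2)[OF modN Sq]
    show "\<phi>' r \<cdot> arr_map M (q, r) \<in> Hom C (obj_map M q) (obj_map N (S r))"
      "arr_map N (S q, S r) \<cdot> \<phi>' q \<in> Hom C (obj_map M q) (obj_map N (S r))"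
      using homs by (simp_all add: arrow_simps)
    fix p assume p: "p \<in> carrier P" "g p \<sqsubseteq>\<^bsub>Q\<^esub> q"
    have pr: "g p \<sqsubseteq>\<^bsub>Q\<^esub> r"
      using Q_trans[OF g_closed[OF p(1)] q(1,2) p(2) q(3)] .
    note s = g_closed[OF p(1)] S_closed[OF g_closed[OF p(1)]] S_mono[OF g_closed[OF p(1)] q(1) p(2)]
    note homs = homs is_moduleD(2)[OF modM s(1) q(1) p(2)] \<theta>_Hom[OF p(1)]
      is_moduleD(2)[OF modN s(2) Sq(1) s(3)]
    have "(\<phi>' r \<cdot> arr_map M (q, r)) \<cdot> arr_map M (g p, q) = \<phi>' r \<cdot> (arr_map M (q, r) \<cdot> arr_map M (g p, q))"
      using homs by (simp add: arrow_simps)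
    also have "\<dots> = arr_map N (S (g p), S r) \<cdot> \<theta> p"
      by (simp only: is_moduleD(4)[OF modM s(1) q(1,2) p(2) q(3)] \<phi>'_arr[OF q(2) p(1) pr])
    also have "\<dots> = (arr_map N (S q, S r) \<cdot> arr_map N (S (g p), S q)) \<cdot> \<theta> p"
      by (simp only: is_moduleD(4)[OF modN s(2) Sq(1,2) s(3) Sq(3)])
    also have "\<dots> = arr_map N (S q, S r) \<cdot> (\<phi>' q \<cdot> arr_map M (g p, q))"
      unfolding \<phi>'_arr[OF q(1) p] using homs by (simp add: arrow_simps)
    also have "\<dots> = (arr_map N (S q, S r) \<cdot> \<phi>' q) \<cdot> arr_map M (g p, q)"
      using homs by (simp add: arrow_simps)
    finally show "(\<phi>' r \<cdot> arr_map M (q, r)) \<cdot> arr_map M (g p, q)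
      = (arr_map N (S q, S r) \<cdot> \<phi>' q) \<cdot> arr_map M (g p, q)" .
  qed
  then have "is_module_hom C Q M (shift T \<epsilon> N) \<phi>'"
    using \<phi>'_Hom by (simp add: is_module_hom_iff)
  moreover have "\<phi> p = mate N \<phi>' p" if p: "p \<in> carrier P" for p
  proof -
    note q = g_closed[OF p] Q_refl[OF g_closed[OF p]] S_closed[OF g_closed[OF p]]
    have "\<phi>' (g p) = \<phi>' (g p) \<cdot> arr_map M (g p, g p)"
      using \<phi>'_Hom[OF q(1)] is_moduleD(3)[OF modM q(1)] by (simp add: arrow_simps)
    also have "\<dots> = \<theta> p"
      using \<phi>'_arr[OF q(1) p q(2)] is_moduleD(3)[OF modN q(3)] \<theta>_Hom[OF p] by (simp add: arrow_simps)
    finally have "mate N \<phi>' p = (counit_inv N (S (g p)) \<cdot> counit N (S (g p))) \<cdot> \<phi> p"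
      using \<phi>_Hom[OF p] counit_Hom[OF modN q(3)] counit_inv_Hom[OF N q(3)]
      by (simp add: mate_def \<theta>_def arrow_simps)
    then show ?thesis
      using counit_inv_counit[OF N q(3)] \<phi>_Hom[OF p] by (simp add: arrow_simps)
  qed
  ultimately show ?thesis
    by blast
qed

text \<open>The relative composition of morphisms pushes the second one forward and then collapses the inner
  restriction by a counit. For a mate this amounts to conjugating \<open>\<psi>\<close> by counits: on the leg at \<open>p\<close>
  both sides are \<open>\<psi> (g p)\<close> followed by internal maps, by naturality of \<open>\<psi>\<close>.\<close>

lemma counit_pushforward_mate:
  assumes M: "determined M" and N: "determined N" and \<psi>: "is_module_hom C Q N (shift T \<epsilon> M) \<psi>"
    and \<psi>': "\<forall>p \<in> carrier P. \<psi>' p = mate M \<psi> p" and q: "q \<in> carrier Q"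
  shows "counit (shift T \<epsilon> (push (pullback g M))) q \<cdot>
      pushforward_hom C P Q g (pullback g N) (rel (pullback g M)) \<psi>' q
    = counit_inv M (S q) \<cdot> (\<psi> q \<cdot> counit N q)"
    and "pushforward_hom C P Q g (pullback g N) (rel (pullback g M)) \<psi>' q
      \<in> Hom C (obj_map (push (pullback g N)) q) (obj_map (push (rel (pullback g M))) q)"
proof -
  note modN = determined_is_module[OF N] and modM = determined_is_module[OF M]
  note RN = is_module_restrict[OF modN] and RM = is_module_restrict[OF modM]
  let ?E = "shift T \<epsilon> (push (pullback g M))"
  let ?F = "pushforward_hom C P Q g (pullback g N) (rel (pullback g M)) \<psi>' q"
  have E: "is_module C Q ?E"
    using is_module_shift[OF is_module_push[OF RM]] .
  have rel: "rel (pullback g M) = pullback g ?E"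
    by (simp add: rel_shift_def)
  note RE = is_module_restrict[OF E]
  have \<psi>'_Hom: "\<psi>' p \<in> Hom C (obj_map N (g p)) (obj_map ?E (g p))" if p: "p \<in> carrier P" for p
    using is_module_hom_mate[OF N M \<psi>] \<psi>'[rule_format, OF p] p by (simp add: is_module_hom_iff rel)
  have \<psi>'_natural: "\<psi>' p' \<cdot> arr_map N (g p, g p') = arr_map ?E (g p, g p') \<cdot> \<psi>' p"
    if p: "p \<in> carrier P" "p' \<in> carrier P" "p \<sqsubseteq>\<^bsub>P\<^esub> p'" for p p'
    using is_module_hom_mate[OF N M \<psi>] \<psi>' p by (simp add: is_module_hom_iff rel)
  have \<psi>_Hom: "\<psi> q \<in> Hom C (obj_map N q) (obj_map M (S q))" if "q \<in> carrier Q" for q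
    using \<psi> that by (simp add: is_module_hom_iff)
  have "is_cocone (push_diagram q) C (pullback g N) (obj_map (push (pullback g ?E)) q)
      (\<lambda>p. incl (pullback g ?E) q p \<cdot> \<psi>' p)"
  proof -
    have "incl (pullback g ?E) q p \<cdot> \<psi>' p \<in> Hom C (obj_map N (g p)) (obj_map (push (pullback g ?E)) q)"
      if p: "p \<in> carrier P" "g p \<sqsubseteq>\<^bsub>Q\<^esub> q" for p
      using \<psi>'_Hom[OF p(1)] incl_Hom[OF RE p] by (simp add: arrow_simps)
    moreover have "(incl (pullback g ?E) q p' \<cdot> \<psi>' p') \<cdot> arr_map N (g p, g p')
        = incl (pullback g ?E) q p \<cdot> \<psi>' p"
      if p: "p \<in> carrier P" "p' \<in> carrier P" "g p' \<sqsubseteq>\<^bsub>Q\<^esub> q" "p \<sqsubseteq>\<^bsub>P\<^esub> p'" for p p'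
    proof -
      note r = g_closed[OF p(1)] g_closed[OF p(2)] g_mono[OF p(1,2,4)]
      note homs = \<psi>'_Hom[OF p(1)] \<psi>'_Hom[OF p(2)] incl_Hom[OF RE p(2,3)] is_moduleD(2)[OF modN r]
        is_moduleD(2)[OF E r]
      have "(incl (pullback g ?E) q p' \<cdot> \<psi>' p') \<cdot> arr_map N (g p, g p')
        = incl (pullback g ?E) q p' \<cdot> (\<psi>' p' \<cdot> arr_map N (g p, g p'))"
        using homs by (simp add: arrow_simps)
      also have "\<dots> = (incl (pullback g ?E) q p' \<cdot> arr_map (pullback g ?E) (p, p')) \<cdot> \<psi>' p"
        unfolding \<psi>'_natural[OF p(1,2,4)] using homs by (simp add: arrow_simps)
      also have "\<dots> = incl (pullback g ?E) q p \<cdot> \<psi>' p"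
        by (simp only: incl_arr[OF RE q p(1,2,4,3)])
      finally show ?thesis .
    qed
    ultimately show ?thesis
      using push_ob_Ob[OF RE] by (simp add: is_cocone_poset_iff)
  qed
  note desc = push_desc_Hom[OF RN this] push_desc_incl[OF RN this]
  have F_def: "?F = push_desc C P Q g (pullback g N) q (obj_map (push (pullback g ?E)) q)
      (\<lambda>p. incl (pullback g ?E) q p \<cdot> \<psi>' p)"
    by (simp add: pushforward_hom_def rel pushforward_def)
  show F_Hom: "?F \<in> Hom C (obj_map (push (pullback g N)) q) (obj_map (push (rel (pullback g M))) q)"
    unfolding F_def unfolding rel using desc(1) .
  note Sq = S_closed[OF q]
  show "counit ?E q \<cdot> ?F = counit_inv M (S q) \<cdot> (\<psi> q \<cdot> counit N q)"
  proof (rule push_eqI[OF RN])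
    note homs = F_Hom[unfolded rel] counit_Hom[OF E q] counit_Hom[OF modN q] \<psi>_Hom[OF q] counit_inv_Hom[OF M Sq]
    show "counit ?E q \<cdot> ?F \<in> Hom C (obj_map (push (pullback g N)) q) (obj_map ?E q)"
      "counit_inv M (S q) \<cdot> (\<psi> q \<cdot> counit N q) \<in> Hom C (obj_map (push (pullback g N)) q) (obj_map ?E q)"
      using homs unfolding rel by (simp_all add: arrow_simps)
    fix p assume p: "p \<in> carrier P" "g p \<sqsubseteq>\<^bsub>Q\<^esub> q"
    note r = g_closed[OF p(1)] q p(2)
    note Sr = S_closed[OF r(1)] S_closed[OF r(2)] S_mono[OF r]
    note homs = homs incl_Hom[OF RN p] \<psi>'_Hom[OF p(1)] \<psi>_Hom[OF r(1)] incl_Hom[OF RE p]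
      is_moduleD(2)[OF modN r] is_moduleD(2)[OF modM Sr] is_moduleD(2)[OF E r] counit_inv_Hom[OF M Sr(1)]
    have "(counit ?E q \<cdot> ?F) \<cdot> incl (pullback g N) q p = counit ?E q \<cdot> (?F \<cdot> incl (pullback g N) q p)"
      using homs unfolding rel by (simp add: arrow_simps)
    also have "\<dots> = (counit ?E q \<cdot> incl (pullback g ?E) q p) \<cdot> \<psi>' p"
      unfolding F_def desc(2)[OF p] using homs by (simp add: arrow_simps)
    also have "\<dots> = (arr_map (push (pullback g M)) (S (g p), S q) \<cdot> counit_inv M (S (g p))) \<cdot> \<psi> (g p)"
      unfolding counit_incl[OF E q p] \<psi>'[rule_format, OF p(1)] using homs by (simp add: mate_def arrow_simps)
    also have "\<dots> = counit_inv M (S q) \<cdot> (arr_map M (S (g p), S q) \<cdot> \<psi> (g p))"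
      unfolding counit_inv_natural[OF M Sr, symmetric] using homs by (simp add: arrow_simps)
    also have "arr_map M (S (g p), S q) \<cdot> \<psi> (g p) = \<psi> q \<cdot> (counit N q \<cdot> incl (pullback g N) q p)"
      using \<psi> r unfolding counit_incl[OF modN q p] by (simp add: is_module_hom_iff)
    also have "counit_inv M (S q) \<cdot> \<dots> = (counit_inv M (S q) \<cdot> (\<psi> q \<cdot> counit N q)) \<cdot> incl (pullback g N) q p"
      using homs by (simp add: arrow_simps)
    finally show "(counit ?E q \<cdot> ?F) \<cdot> incl (pullback g N) q p
      = (counit_inv M (S q) \<cdot> (\<psi> q \<cdot> counit N q)) \<cdot> incl (pullback g N) q p" .
  qed
qed

text \<open>All counits cancel in pairs, so that both sides of the relative identity at \<open>p\<close> are the two sides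
  of the identity at \<open>g p\<close> followed by the inverse counit at \<open>T (2\<epsilon>) (g p)\<close>, which is monic.\<close>

lemma interleaving_identity_mate:
  assumes M: "determined M" and N: "determined N"
    and \<phi>: "is_module_hom C Q M (shift T \<epsilon> N) \<phi>" and \<psi>: "is_module_hom C Q N (shift T \<epsilon> M) \<psi>"
    and \<phi>': "\<forall>p \<in> carrier P. \<phi>' p = mate N \<phi> p"
    and \<psi>': "\<forall>p \<in> carrier P. \<psi>' p = mate M \<psi> p" and p: "p \<in> carrier P"
  shows "rel_sigma C P Q g T \<epsilon> \<epsilon> (pullback g M) p \<cdot>
        (rel_shift_hom C P Q g T \<epsilon> (pullback g N) (rel (pullback g M)) \<psi>' p \<cdot> \<phi>' p) =
      rel_eta2 C P Q g T 0 (2 * \<epsilon>) (pullback g M) p \<cdot> rel_eta C P Q g T 0 (pullback g M) p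
    \<longleftrightarrow> shift_sigma T \<epsilon> \<epsilon> M (g p) \<cdot> (shift_hom T \<epsilon> \<psi> (g p) \<cdot> \<phi> (g p)) =
      shift_eta2 T 0 (2 * \<epsilon>) M (g p) \<cdot> shift_eta T 0 M (g p)"
proof -
  note modN = determined_is_module[OF N] and modM = determined_is_module[OF M]
  note RN = is_module_restrict[OF modN] and RM = is_module_restrict[OF modM]
  let ?E = "shift T \<epsilon> (push (pullback g M))"
  let ?F = "pushforward_hom C P Q g (pullback g N) (rel (pullback g M)) \<psi>'"
  have E: "is_module C Q ?E"
    using is_module_shift[OF is_module_push[OF RM]] .
  have rel: "rel (pullback g M) = pullback g ?E"
    by (simp add: rel_shift_def)
  define x where "x = g p"
  define t0 t2 where "t0 = T 0 x" and "t2 = T (2 * \<epsilon>) x"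
  have x: "x \<in> carrier Q" "S x \<in> carrier Q" "S (S x) \<in> carrier Q" "t0 \<in> carrier Q" "t2 \<in> carrier Q"
    using eps by (simp_all add: x_def t0_def t2_def g_closed[OF p] S_closed T_closed)
  have le: "S (S x) \<sqsubseteq>\<^bsub>Q\<^esub> t2" "t0 \<sqsubseteq>\<^bsub>Q\<^esub> t2" "x \<sqsubseteq>\<^bsub>Q\<^esub> t0"
    using x(1) by (simp_all add: SS_le T0_le T_extensive t0_def t2_def)
  note arrs = is_moduleD(2)[OF modM x(3,5) le(1)] is_moduleD(2)[OF modM x(4,5) le(2)]
    is_moduleD(2)[OF modM x(1,4) le(3)] push_arr_Hom[OF RM x(3,5) le(1)]
    push_arr_Hom[OF RM x(4,5) le(2)] push_arr_Hom[OF RM x(1,4) le(3)]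
  have \<phi>_Hom: "\<phi> x \<in> Hom C (obj_map M x) (obj_map N (S x))"
    and \<psi>_Hom: "\<psi> (S x) \<in> Hom C (obj_map N (S x)) (obj_map M (S (S x)))"
    using \<phi> \<psi> x by (simp_all add: is_module_hom_iff)
  note mates = counit_pushforward_mate[OF M N \<psi> \<psi>' x(2)]
  note homs = arrs \<phi>_Hom \<psi>_Hom counit_inv_Hom[OF M x(5)] counit_inv_Hom[OF M x(3)]
    counit_inv_Hom[OF M x(1)] counit_inv_Hom[OF M x(4)]
    counit_inv_Hom[OF N x(2)] counit_Hom[OF modN x(2)] mates(2)[unfolded rel] counit_Hom[OF E x(2)]
  let ?L = "arr_map M (S (S x), t2) \<cdot> (\<psi> (S x) \<cdot> \<phi> x)"
  let ?R = "arr_map M (t0, t2) \<cdot> arr_map M (x, t0)"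
  have "rel_sigma C P Q g T \<epsilon> \<epsilon> (pullback g M) p \<cdot>
        (rel_shift_hom C P Q g T \<epsilon> (pullback g N) (rel (pullback g M)) \<psi>' p \<cdot> \<phi>' p)
    = (arr_map (push (pullback g M)) (S (S x), t2) \<cdot> counit ?E (S x)) \<cdot>
        (?F (S x) \<cdot> (counit_inv N (S x) \<cdot> \<phi> x))"
    using \<phi>'[rule_format, OF p] by (simp add: rel_sigma_def rel_shift_hom_def shift_sigma_def shift_hom_def
        mate_def x_def t2_def)
  also have "\<dots> = arr_map (push (pullback g M)) (S (S x), t2) \<cdot>
      ((counit ?E (S x) \<cdot> ?F (S x)) \<cdot> (counit_inv N (S x) \<cdot> \<phi> x))"
    using homs unfolding rel by (simp add: arrow_simps)
  also have "\<dots> = (arr_map (push (pullback g M)) (S (S x), t2) \<cdot> counit_inv M (S (S x))) \<cdot>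
      (\<psi> (S x) \<cdot> ((counit N (S x) \<cdot> counit_inv N (S x)) \<cdot> \<phi> x))"
    unfolding mates(1) using homs by (simp add: arrow_simps)
  also have "\<dots> = counit_inv M t2 \<cdot> ?L"
    unfolding counit_inv_natural[OF M x(3,5) le(1), symmetric] counit_counit_inv[OF N x(2)]
    using homs by (simp add: arrow_simps)
  finally have L: "rel_sigma C P Q g T \<epsilon> \<epsilon> (pullback g M) p \<cdot>
        (rel_shift_hom C P Q g T \<epsilon> (pullback g N) (rel (pullback g M)) \<psi>' p \<cdot> \<phi>' p)
    = counit_inv M t2 \<cdot> ?L" .
  have "rel_eta2 C P Q g T 0 (2 * \<epsilon>) (pullback g M) p \<cdot> rel_eta C P Q g T 0 (pullback g M) p
    = arr_map (push (pullback g M)) (t0, t2) \<cdot> (arr_map (push (pullback g M)) (x, t0) \<cdot> counit_inv M x)"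
    by (simp add: rel_eta2_def rel_eta_def shift_eta2_def shift_eta_def
        push_unit_eq_counit_inv[OF M p] x_def t0_def t2_def)
  also have "\<dots> = (arr_map (push (pullback g M)) (t0, t2) \<cdot> counit_inv M t0) \<cdot> arr_map M (x, t0)"
    unfolding counit_inv_natural[OF M x(1,4) le(3), symmetric] using homs by (simp add: arrow_simps)
  also have "\<dots> = counit_inv M t2 \<cdot> ?R"
    unfolding counit_inv_natural[OF M x(4,5) le(2), symmetric] using homs by (simp add: arrow_simps)
  finally have R: "rel_eta2 C P Q g T 0 (2 * \<epsilon>) (pullback g M) p \<cdot> rel_eta C P Q g T 0 (pullback g M) p
    = counit_inv M t2 \<cdot> ?R" .
  have LR: "?L \<in> Hom C (obj_map M x) (obj_map M t2)" "?R \<in> Hom C (obj_map M x) (obj_map M t2)"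
    using homs by (simp_all add: arrow_simps)
  have monic: "counit M t2 \<cdot> (counit_inv M t2 \<cdot> u) = u" if u: "u \<in> Hom C (obj_map M x) (obj_map M t2)" for u
    using comp_reassoc[OF counit_counit_inv[OF M x(5)], of u] u counit_inv_Hom[OF M x(5)]
      counit_Hom[OF modM x(5)] by (simp add: arrow_simps)
  have "counit_inv M t2 \<cdot> ?L = counit_inv M t2 \<cdot> ?R \<longleftrightarrow> ?L = ?R"
    using monic[OF LR(1)] monic[OF LR(2)] by metis
  then show ?thesis
    unfolding L R by (simp add: shift_sigma_def shift_hom_def shift_eta2_def shift_eta_def x_def t0_def t2_def)
qed

text \<open>Both sides are natural in \<open>q\<close>, and two maps out of the value of a determined module at \<open>q\<close> agree if
  they agree on the elements \<open>g p\<close> below \<open>q\<close>.\<close>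

lemma interleaving_identity_everywhere:
  assumes M: "determined M" and N: "determined N"
    and \<phi>: "is_module_hom C Q M (shift T \<epsilon> N) \<phi>" and \<psi>: "is_module_hom C Q N (shift T \<epsilon> M) \<psi>"
    and eq: "\<And>p. p \<in> carrier P \<Longrightarrow> shift_sigma T \<epsilon> \<epsilon> M (g p) \<cdot> (shift_hom T \<epsilon> \<psi> (g p) \<cdot> \<phi> (g p)) =
      shift_eta2 T 0 (2 * \<epsilon>) M (g p) \<cdot> shift_eta T 0 M (g p)"
    and q: "q \<in> carrier Q"
  shows "shift_sigma T \<epsilon> \<epsilon> M q \<cdot> (shift_hom T \<epsilon> \<psi> q \<cdot> \<phi> q) =
      shift_eta2 T 0 (2 * \<epsilon>) M q \<cdot> shift_eta T 0 M q"
proof -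
  note modN = determined_is_module[OF N] and modM = determined_is_module[OF M]
  let ?T2 = "T (2 * \<epsilon>)"
  have e2: "0 \<le> 2 * \<epsilon>" "0 \<le> (0::real)"
    using eps by simp_all
  have \<phi>_Hom: "\<phi> x \<in> Hom C (obj_map M x) (obj_map N (S x))" if "x \<in> carrier Q" for x
    using \<phi> that by (simp add: is_module_hom_iff)
  have \<psi>_Hom: "\<psi> x \<in> Hom C (obj_map N x) (obj_map M (S x))" if "x \<in> carrier Q" for x
    using \<psi> that by (simp add: is_module_hom_iff)
  define u where "u x = arr_map M (S (S x), ?T2 x) \<cdot> (\<psi> (S x) \<cdot> \<phi> x)" for x
  define v where "v x = arr_map M (T 0 x, ?T2 x) \<cdot> arr_map M (x, T 0 x)" for x
  have v: "v x = arr_map M (x, ?T2 x)" if x: "x \<in> carrier Q" for x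
    unfolding v_def using is_moduleD(4)[OF modM x T_closed[OF e2(2) x] T_closed[OF e2(1) x]
        T_extensive[OF e2(2) x] T0_le[OF x]] .
  have u_Hom: "u x \<in> Hom C (obj_map M x) (obj_map M (?T2 x))" if x: "x \<in> carrier Q" for x
    using \<phi>_Hom[OF x] \<psi>_Hom[OF S_closed[OF x]]
      is_moduleD(2)[OF modM S_closed[OF S_closed[OF x]] T_closed[OF e2(1) x] SS_le[OF x]]
    by (simp add: u_def arrow_simps)
  have u_natural: "u y \<cdot> arr_map M (x, y) = arr_map M (?T2 x, ?T2 y) \<cdot> u x"
    if xy: "x \<in> carrier Q" "y \<in> carrier Q" "x \<sqsubseteq>\<^bsub>Q\<^esub> y" for x y
  proof -
    note S1 = S_closed[OF xy(1)] S_closed[OF xy(2)] S_mono[OF xy]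
    note S2 = S_closed[OF S1(1)] S_closed[OF S1(2)] S_mono[OF S1]
    note T2 = T_closed[OF e2(1) xy(1)] T_closed[OF e2(1) xy(2)] T_mono[OF e2(1) xy]
    note le = SS_le[OF xy(1)] SS_le[OF xy(2)]
    note homs = is_moduleD(2)[OF modM xy] is_moduleD(2)[OF modN S1] is_moduleD(2)[OF modM S2]
      is_moduleD(2)[OF modM T2] is_moduleD(2)[OF modM S2(1) T2(1) le(1)]
      is_moduleD(2)[OF modM S2(2) T2(2) le(2)]
      \<phi>_Hom[OF xy(1)] \<phi>_Hom[OF xy(2)] \<psi>_Hom[OF S1(1)] \<psi>_Hom[OF S1(2)]
    have "u y \<cdot> arr_map M (x, y) = arr_map M (S (S y), ?T2 y) \<cdot> (\<psi> (S y) \<cdot> (\<phi> y \<cdot> arr_map M (x, y)))"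
      using homs by (simp add: u_def arrow_simps)
    also have "\<phi> y \<cdot> arr_map M (x, y) = arr_map N (S x, S y) \<cdot> \<phi> x"
      using \<phi> xy by (simp add: is_module_hom_iff)
    also have "\<psi> (S y) \<cdot> (arr_map N (S x, S y) \<cdot> \<phi> x) = (\<psi> (S y) \<cdot> arr_map N (S x, S y)) \<cdot> \<phi> x"
      using homs by (simp add: arrow_simps)
    also have "\<psi> (S y) \<cdot> arr_map N (S x, S y) = arr_map M (S (S x), S (S y)) \<cdot> \<psi> (S x)"
      using \<psi> S1 by (simp add: is_module_hom_iff)
    also have "arr_map M (S (S y), ?T2 y) \<cdot> (arr_map M (S (S x), S (S y)) \<cdot> \<psi> (S x) \<cdot> \<phi> x)
      = (arr_map M (S (S y), ?T2 y) \<cdot> arr_map M (S (S x), S (S y))) \<cdot> (\<psi> (S x) \<cdot> \<phi> x)"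
      using homs by (simp add: arrow_simps)
    also have "arr_map M (S (S y), ?T2 y) \<cdot> arr_map M (S (S x), S (S y))
      = arr_map M (?T2 x, ?T2 y) \<cdot> arr_map M (S (S x), ?T2 x)"
      using is_moduleD(4)[OF modM S2(1,2) T2(2) S2(3) le(2)]
        is_moduleD(4)[OF modM S2(1) T2(1,2) le(1) T2(3)] by simp
    also have "\<dots> \<cdot> (\<psi> (S x) \<cdot> \<phi> x) = arr_map M (?T2 x, ?T2 y) \<cdot> u x"
      using homs by (simp add: u_def arrow_simps)
    finally show ?thesis .
  qed
  have "u q = v q"
  proof (rule determined_hom_eqI[OF M q u_Hom[OF q]])
    note T2 = T_closed[OF e2(1) q] T_extensive[OF e2(1) q]
    show "v q \<in> Hom C (obj_map M q) (obj_map M (?T2 q))"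
      using is_moduleD(2)[OF modM q T2] by (simp add: v[OF q])
    fix p assume p: "p \<in> carrier P" "g p \<sqsubseteq>\<^bsub>Q\<^esub> q"
    note x = g_closed[OF p(1)]
    note Tx = T_closed[OF e2(1) x] T_extensive[OF e2(1) x] T_mono[OF e2(1) x q p(2)]
    have "u (g p) = v (g p)"
      using eq[OF p(1)] by (simp add: u_def v_def shift_sigma_def shift_hom_def shift_eta2_def shift_eta_def)
    then have "u q \<cdot> arr_map M (g p, q) = arr_map M (?T2 (g p), ?T2 q) \<cdot> arr_map M (g p, ?T2 (g p))"
      by (simp add: u_natural[OF x q p(2)] v[OF x])
    also have "\<dots> = arr_map M (q, ?T2 q) \<cdot> arr_map M (g p, q)"
      using is_moduleD(4)[OF modM x Tx(1) T2(1) Tx(2,3)] is_moduleD(4)[OF modM x q T2(1) p(2) T2(2)]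
      by simp
    finally show "u q \<cdot> arr_map M (g p, q) = v q \<cdot> arr_map M (g p, q)"
      by (simp add: v[OF q])
  qed
  then show ?thesis
    by (simp add: u_def v_def shift_sigma_def shift_hom_def shift_eta2_def shift_eta_def)
qed

theorem rel_weakly_interleaved_iff:
  assumes M: "determined M" and N: "determined N"
  shows "rel_weakly_interleaved C P Q g T \<epsilon> (pullback g M) (pullback g N) \<longleftrightarrow>
    weakly_interleaved C Q T \<epsilon> M N"
proof
  assume "weakly_interleaved C Q T \<epsilon> M N"
  then obtain \<phi> \<psi> where \<phi>: "is_module_hom C Q M (shift T \<epsilon> N) \<phi>"
    and \<psi>: "is_module_hom C Q N (shift T \<epsilon> M) \<psi>"
    and eqs: "\<forall>q \<in> carrier Q. shift_sigma T \<epsilon> \<epsilon> M q \<cdot> (shift_hom T \<epsilon> \<psi> q \<cdot> \<phi> q) =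
          shift_eta2 T 0 (2 * \<epsilon>) M q \<cdot> shift_eta T 0 M q"
      "\<forall>q \<in> carrier Q. shift_sigma T \<epsilon> \<epsilon> N q \<cdot> (shift_hom T \<epsilon> \<phi> q \<cdot> \<psi> q) =
          shift_eta2 T 0 (2 * \<epsilon>) N q \<cdot> shift_eta T 0 N q"
    unfolding weakly_interleaved_def by blast
  show "rel_weakly_interleaved C P Q g T \<epsilon> (pullback g M) (pullback g N)"
    unfolding rel_weakly_interleaved_def
  proof (rule exI[of _ "mate N \<phi>"], rule exI[of _ "mate M \<psi>"], intro conjI ballI)
    show "is_module_hom C P (pullback g M) (rel (pullback g N)) (mate N \<phi>)"
      "is_module_hom C P (pullback g N) (rel (pullback g M)) (mate M \<psi>)"
      by (fact is_module_hom_mate[OF M N \<phi>], fact is_module_hom_mate[OF N M \<psi>])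
    fix p assume p: "p \<in> carrier P"
    show "rel_sigma C P Q g T \<epsilon> \<epsilon> (pullback g M) p \<cdot>
        (rel_shift_hom C P Q g T \<epsilon> (pullback g N) (rel (pullback g M)) (mate M \<psi>) p \<cdot> mate N \<phi> p) =
      rel_eta2 C P Q g T 0 (2 * \<epsilon>) (pullback g M) p \<cdot> rel_eta C P Q g T 0 (pullback g M) p"
      using interleaving_identity_mate[OF M N \<phi> \<psi> ballI[OF refl] ballI[OF refl] p] eqs(1) g_closed[OF p] by blast
    show "rel_sigma C P Q g T \<epsilon> \<epsilon> (pullback g N) p \<cdot>
        (rel_shift_hom C P Q g T \<epsilon> (pullback g M) (rel (pullback g N)) (mate N \<phi>) p \<cdot> mate M \<psi> p) =
      rel_eta2 C P Q g T 0 (2 * \<epsilon>) (pullback g N) p \<cdot> rel_eta C P Q g T 0 (pullback g N) p"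
      using interleaving_identity_mate[OF N M \<psi> \<phi> ballI[OF refl] ballI[OF refl] p] eqs(2) g_closed[OF p] by blast
  qed
next
  assume "rel_weakly_interleaved C P Q g T \<epsilon> (pullback g M) (pullback g N)"
  then obtain \<phi> \<psi> where \<phi>: "is_module_hom C P (pullback g M) (rel (pullback g N)) \<phi>"
    and \<psi>: "is_module_hom C P (pullback g N) (rel (pullback g M)) \<psi>"
    and eqs: "\<forall>p \<in> carrier P. rel_sigma C P Q g T \<epsilon> \<epsilon> (pullback g M) p \<cdot>
          (rel_shift_hom C P Q g T \<epsilon> (pullback g N) (rel (pullback g M)) \<psi> p \<cdot> \<phi> p) =
        rel_eta2 C P Q g T 0 (2 * \<epsilon>) (pullback g M) p \<cdot> rel_eta C P Q g T 0 (pullback g M) p"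
      "\<forall>p \<in> carrier P. rel_sigma C P Q g T \<epsilon> \<epsilon> (pullback g N) p \<cdot>
          (rel_shift_hom C P Q g T \<epsilon> (pullback g M) (rel (pullback g N)) \<phi> p \<cdot> \<psi> p) =
        rel_eta2 C P Q g T 0 (2 * \<epsilon>) (pullback g N) p \<cdot> rel_eta C P Q g T 0 (pullback g N) p"
    unfolding rel_weakly_interleaved_def by blast
  obtain \<phi>' where \<phi>': "is_module_hom C Q M (shift T \<epsilon> N) \<phi>'" "\<forall>p \<in> carrier P. \<phi> p = mate N \<phi>' p"
    using ex_mate[OF M N \<phi>] by blast
  obtain \<psi>' where \<psi>': "is_module_hom C Q N (shift T \<epsilon> M) \<psi>'" "\<forall>p \<in> carrier P. \<psi> p = mate M \<psi>' p"
    using ex_mate[OF N M \<psi>] by blast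
  have "shift_sigma T \<epsilon> \<epsilon> M (g p) \<cdot> (shift_hom T \<epsilon> \<psi>' (g p) \<cdot> \<phi>' (g p)) =
      shift_eta2 T 0 (2 * \<epsilon>) M (g p) \<cdot> shift_eta T 0 M (g p)" if p: "p \<in> carrier P" for p
    using interleaving_identity_mate[OF M N \<phi>'(1) \<psi>'(1) \<phi>'(2) \<psi>'(2) p] eqs(1) p by blast
  moreover have "shift_sigma T \<epsilon> \<epsilon> N (g p) \<cdot> (shift_hom T \<epsilon> \<phi>' (g p) \<cdot> \<psi>' (g p)) =
      shift_eta2 T 0 (2 * \<epsilon>) N (g p) \<cdot> shift_eta T 0 N (g p)" if p: "p \<in> carrier P" for p
    using interleaving_identity_mate[OF N M \<psi>'(1) \<phi>'(1) \<psi>'(2) \<phi>'(2) p] eqs(2) p by blast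
  ultimately show "weakly_interleaved C Q T \<epsilon> M N"
    unfolding weakly_interleaved_def
    using \<phi>'(1) \<psi>'(1) interleaving_identity_everywhere[OF M N \<phi>'(1) \<psi>'(1)]
      interleaving_identity_everywhere[OF N M \<psi>'(1) \<phi>'(1)] by blast
qed

end

section \<open>Comparing interleavings over two families of sets\<close>

lemma inclusion_poset_simps [simp]:
  "carrier (inclusion_poset A) = A" "le (inclusion_poset A) = (\<subseteq>)"
  by (simp_all add: inclusion_poset_def)

text \<open>Sets in \<open>A\<close> are approximated from above by sets in \<open>B\<close> through \<open>c\<close>. If translating the approximation
  within \<open>B\<close> does not lead beyond the translation within \<open>A\<close>, for the parameter and for its double,
  then interleavings over \<open>B\<close> can be carried over to \<open>A\<close>. Open sets and grid opens take both roles: grid opens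
  are open, and an open set is approximated by its grid hull.\<close>

locale interleaving_comparison = category C
  for C :: "('o, 'm) cat" (structure) +
  fixes K A B :: "'a set set" and c :: "'a set \<Rightarrow> 'a set"
    and Y W :: "real \<Rightarrow> 'a set \<Rightarrow> 'a set" and \<epsilon>' \<epsilon> :: real
  assumes A: "A \<subseteq> K" and B: "B \<subseteq> K"
    and Y: "translation_family (inclusion_poset A) Y"
    and W: "translation_family (inclusion_poset B) W"
    and eps: "0 \<le> \<epsilon>" "0 \<le> \<epsilon>'"
    and c_closed: "x \<in> A \<Longrightarrow> c x \<in> B" and c_extensive: "x \<in> A \<Longrightarrow> x \<subseteq> c x"
    and c_mono: "x \<in> A \<Longrightarrow> y \<in> A \<Longrightarrow> x \<subseteq> y \<Longrightarrow> c x \<subseteq> c y"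
    and once: "x \<in> A \<Longrightarrow> W \<epsilon> (c x) \<subseteq> Y \<epsilon>' x"
    and twice: "x \<in> A \<Longrightarrow> W (2 * \<epsilon>) (c x) \<subseteq> Y (2 * \<epsilon>') x"
begin

interpretation Y: translation_family "inclusion_poset A" Y by (fact Y)
interpretation W: translation_family "inclusion_poset B" W by (fact W)

lemmas Y_simps = Y.T_closed[simplified] Y.T_extensive[simplified]
lemmas W_simps = W.T_closed[simplified] W.T_extensive[simplified]

lemmas YY = Y.T_twice[simplified, OF eps(2)]
lemmas WW = W.T_twice[simplified, OF eps(1)]

lemma Y0: "x \<in> A \<Longrightarrow> Y 0 x \<subseteq> Y (2 * \<epsilon>') x"
  using Y.T_zero_le[OF partial_order_inclusion_poset] eps by simp

lemma W0: "x \<in> B \<Longrightarrow> W 0 x \<subseteq> W (2 * \<epsilon>) x"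
  using W.T_zero_le[OF partial_order_inclusion_poset] eps by simp

definition transport ::
  "('a set, 'o, 'm) pmodule \<Rightarrow> ('a set, 'o, 'm) pmodule \<Rightarrow> ('a set \<Rightarrow> 'm) \<Rightarrow> 'a set \<Rightarrow> 'm" where
  "transport M N \<phi> x = arr_map N (W \<epsilon> (c x), Y \<epsilon>' x) \<cdot> (\<phi> (c x) \<cdot> arr_map M (x, c x))"

lemma transport_hom:
  assumes M: "is_module C (inclusion_poset K) M" and N: "is_module C (inclusion_poset K) N"
    and \<phi>: "is_module_hom C (inclusion_poset B) M (shift W \<epsilon> N) \<phi>"
  shows "is_module_hom C (inclusion_poset A) M (shift Y \<epsilon>' N) (transport M N \<phi>)"
  unfolding is_module_hom_iff shift_simps inclusion_poset_simps
proof (intro conjI ballI impI)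
  have \<phi>_Hom: "\<phi> x \<in> Hom C (obj_map M x) (obj_map N (W \<epsilon> x))" if "x \<in> B" for x
    using \<phi> that by (simp add: is_module_hom_iff)
  note arrM = is_moduleD(2)[OF M, simplified] and arrN = is_moduleD(2)[OF N, simplified]
  note compM = is_moduleD(4)[OF M, simplified] and compN = is_moduleD(4)[OF N, simplified]
  have sets: "x \<in> K" "c x \<in> K" "W \<epsilon> (c x) \<in> K" "Y \<epsilon>' x \<in> K" if "x \<in> A" for x
    using that A B c_closed Y_simps(1) W_simps(1) eps by blast+
  show "transport M N \<phi> x \<in> Hom C (obj_map M x) (obj_map N (Y \<epsilon>' x))" if x: "x \<in> A" for x
    using arrM[OF sets(1,2)[OF x] c_extensive[OF x]] arrN[OF sets(3,4)[OF x] once[OF x]]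
      \<phi>_Hom[OF c_closed[OF x]] by (simp add: transport_def arrow_simps)
  fix x y assume xy: "x \<in> A" "y \<in> A" "x \<subseteq> y"
  note sx = sets[OF xy(1)] and sy = sets[OF xy(2)]
  note le = c_mono[OF xy] W.T_mono[simplified, OF eps(1) c_closed[OF xy(1)] c_closed[OF xy(2)] c_mono[OF xy]]
    Y.T_mono[simplified, OF eps(2) xy] c_extensive[OF xy(1)] c_extensive[OF xy(2)] once[OF xy(1)] once[OF xy(2)]
  note homs = arrM[OF sx(1) sy(1) xy(3)] arrM[OF sx(2) sy(2) le(1)] arrN[OF sx(3) sy(3) le(2)]
    arrN[OF sx(4) sy(4) le(3)] arrM[OF sx(1,2) le(4)] arrM[OF sy(1,2) le(5)] arrN[OF sx(3,4) le(6)]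
    arrN[OF sy(3,4) le(7)] \<phi>_Hom[OF c_closed[OF xy(1)]] \<phi>_Hom[OF c_closed[OF xy(2)]]
  have "transport M N \<phi> y \<cdot> arr_map M (x, y)
    = arr_map N (W \<epsilon> (c y), Y \<epsilon>' y) \<cdot> (\<phi> (c y) \<cdot> (arr_map M (y, c y) \<cdot> arr_map M (x, y)))"
    using homs by (simp add: transport_def arrow_simps)
  also have "arr_map M (y, c y) \<cdot> arr_map M (x, y) = arr_map M (c x, c y) \<cdot> arr_map M (x, c x)"
    using compM[OF sx(1) sy(1,2) xy(3) le(5)] compM[OF sx(1,2) sy(2) le(4,1)] by simp
  also have "arr_map N (W \<epsilon> (c y), Y \<epsilon>' y) \<cdot> (\<phi> (c y) \<cdot> \<dots>)
    = arr_map N (W \<epsilon> (c y), Y \<epsilon>' y) \<cdot> ((\<phi> (c y) \<cdot> arr_map M (c x, c y)) \<cdot> arr_map M (x, c x))"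
    using homs by (simp add: arrow_simps)
  also have "\<phi> (c y) \<cdot> arr_map M (c x, c y) = arr_map N (W \<epsilon> (c x), W \<epsilon> (c y)) \<cdot> \<phi> (c x)"
    using \<phi> c_closed[OF xy(1)] c_closed[OF xy(2)] le(1) by (simp add: is_module_hom_iff)
  also have "arr_map N (W \<epsilon> (c y), Y \<epsilon>' y) \<cdot> (\<dots> \<cdot> arr_map M (x, c x))
    = (arr_map N (W \<epsilon> (c y), Y \<epsilon>' y) \<cdot> arr_map N (W \<epsilon> (c x), W \<epsilon> (c y))) \<cdot> (\<phi> (c x) \<cdot> arr_map M (x, c x))"
    using homs by (simp add: arrow_simps)
  also have "arr_map N (W \<epsilon> (c y), Y \<epsilon>' y) \<cdot> arr_map N (W \<epsilon> (c x), W \<epsilon> (c y))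
    = arr_map N (Y \<epsilon>' x, Y \<epsilon>' y) \<cdot> arr_map N (W \<epsilon> (c x), Y \<epsilon>' x)"
    using compN[OF sx(3) sy(3,4) le(2,7)] compN[OF sx(3,4) sy(4) le(6,3)] by simp
  also have "\<dots> \<cdot> (\<phi> (c x) \<cdot> arr_map M (x, c x)) = arr_map N (Y \<epsilon>' x, Y \<epsilon>' y) \<cdot> transport M N \<phi> x"
    using homs by (simp add: transport_def arrow_simps)
  finally show "transport M N \<phi> y \<cdot> arr_map M (x, y) = arr_map N (Y \<epsilon>' x, Y \<epsilon>' y) \<cdot> transport M N \<phi> x" .
qed

text \<open>Sliding \<open>\<psi>\<close> along the inclusion \<open>W \<epsilon> (c x) \<subseteq> c (Y \<epsilon>' x)\<close> by naturality brings \<open>\<psi>\<close> and \<open>\<phi>\<close> next to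
  each other at \<open>c x\<close>. The identity over \<open>B\<close> replaces them by an internal map into \<open>W (2\<epsilon>) (c x)\<close>, and
  since that set lies in \<open>Y (2\<epsilon>') x\<close> the remaining arrows compose to one internal map.\<close>

lemma transport_identity:
  assumes M: "is_module C (inclusion_poset K) M" and N: "is_module C (inclusion_poset K) N"
    and \<phi>: "is_module_hom C (inclusion_poset B) M (shift W \<epsilon> N) \<phi>"
    and \<psi>: "is_module_hom C (inclusion_poset B) N (shift W \<epsilon> M) \<psi>"
    and eq: "\<And>y. y \<in> B \<Longrightarrow> shift_sigma W \<epsilon> \<epsilon> M y \<cdot> (shift_hom W \<epsilon> \<psi> y \<cdot> \<phi> y) =
      shift_eta2 W 0 (2 * \<epsilon>) M y \<cdot> shift_eta W 0 M y"
    and x: "x \<in> A"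
  shows "shift_sigma Y \<epsilon>' \<epsilon>' M x \<cdot> (shift_hom Y \<epsilon>' (transport N M \<psi>) x \<cdot> transport M N \<phi> x) =
      shift_eta2 Y 0 (2 * \<epsilon>') M x \<cdot> shift_eta Y 0 M x"
proof -
  have \<phi>_Hom: "\<phi> x \<in> Hom C (obj_map M x) (obj_map N (W \<epsilon> x))" if "x \<in> B" for x
    using \<phi> that by (simp add: is_module_hom_iff)
  have \<psi>_Hom: "\<psi> x \<in> Hom C (obj_map N x) (obj_map M (W \<epsilon> x))" if "x \<in> B" for x
    using \<psi> that by (simp add: is_module_hom_iff)
  note arrM = is_moduleD(2)[OF M, simplified] and arrN = is_moduleD(2)[OF N, simplified]
  note compM = is_moduleD(4)[OF M, simplified] and compN = is_moduleD(4)[OF N, simplified]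
  define y z where "y = c x" and "z = Y \<epsilon>' x"
  define v where "v = W \<epsilon> y"
  define w where "w = c z"
  define y2 x2 where "y2 = W (2 * \<epsilon>) y" and "x2 = Y (2 * \<epsilon>') x"
  define vv vw zz where "vv = W \<epsilon> v" and "vw = W \<epsilon> w" and "zz = Y \<epsilon>' z"
  have inA: "z \<in> A" "x2 \<in> A" "zz \<in> A" "Y 0 x \<in> A"
    using x eps Y_simps(1) by (simp_all add: z_def x2_def zz_def)
  have inB: "y \<in> B" "v \<in> B" "w \<in> B" "y2 \<in> B" "vv \<in> B" "vw \<in> B" "W 0 y \<in> B"
    using x inA eps W_simps(1) c_closed by (simp_all add: y_def v_def w_def y2_def vv_def vw_def)
  have inK: "x \<in> K" "z \<in> K" "x2 \<in> K" "zz \<in> K" "y \<in> K" "v \<in> K" "w \<in> K" "y2 \<in> K" "vv \<in> K" "vw \<in> K"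
    "Y 0 x \<in> K" "W 0 y \<in> K"
    using x inA inB A B by blast+
  have sub: "x \<subseteq> y" "v \<subseteq> z" "z \<subseteq> w" "vw \<subseteq> zz" "zz \<subseteq> x2" "vv \<subseteq> y2" "y2 \<subseteq> x2" "y \<subseteq> y2"
    using c_extensive[OF x] once[OF x] c_extensive[OF inA(1)] once[OF inA(1)] YY[OF x] WW[OF inB(1)]
      twice[OF x] W_simps(2)[OF _ inB(1), of "2 * \<epsilon>"] eps
    by (simp_all add: y_def v_def z_def w_def vw_def zz_def x2_def vv_def y2_def)
  have vw': "v \<subseteq> w"
    using sub by blast
  have "vv \<subseteq> vw"
    using W.T_mono[simplified, OF eps(1) inB(2,3) vw'] by (simp add: vv_def vw_def)
  note sub = sub vw' this
  have zero: "x \<subseteq> Y 0 x" "Y 0 x \<subseteq> x2" "y \<subseteq> W 0 y" "W 0 y \<subseteq> y2"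
    using Y_simps(2)[OF _ x, of 0] Y0[OF x] W_simps(2)[OF _ inB(1), of 0] W0[OF inB(1)]
    by (simp_all add: x2_def y2_def)
  note homs = arrM[OF inK(1,5) sub(1)] arrN[OF inK(6,2) sub(2)] arrN[OF inK(2,7) sub(3)]
    arrM[OF inK(10,4) sub(4)] arrM[OF inK(4,3) sub(5)] arrM[OF inK(9,8) sub(6)] arrM[OF inK(8,3) sub(7)]
    arrM[OF inK(5,8) sub(8)] arrN[OF inK(6,7) sub(9)] arrM[OF inK(9,10) sub(10)]
    \<phi>_Hom[OF inB(1), folded v_def] \<psi>_Hom[OF inB(2), folded vv_def] \<psi>_Hom[OF inB(3), folded vw_def]
  have identity: "arr_map M (vv, y2) \<cdot> (\<psi> v \<cdot> \<phi> y) = arr_map M (y, y2)"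
    using eq[OF inB(1)] compM[OF inK(5,12,8) zero(3,4)]
    by (simp add: shift_sigma_def shift_hom_def shift_eta2_def shift_eta_def v_def vv_def y2_def)
  have "shift_sigma Y \<epsilon>' \<epsilon>' M x \<cdot> (shift_hom Y \<epsilon>' (transport N M \<psi>) x \<cdot> transport M N \<phi> x)
    = arr_map M (zz, x2) \<cdot> ((arr_map M (vw, zz) \<cdot> (\<psi> w \<cdot> arr_map N (z, w))) \<cdot>
        (arr_map N (v, z) \<cdot> (\<phi> y \<cdot> arr_map M (x, y))))"
    by (simp add: shift_sigma_def shift_hom_def transport_def zz_def x2_def vw_def w_def v_def z_def y_def)
  also have "\<dots> = (arr_map M (zz, x2) \<cdot> arr_map M (vw, zz)) \<cdot>
      (\<psi> w \<cdot> ((arr_map N (z, w) \<cdot> arr_map N (v, z)) \<cdot> (\<phi> y \<cdot> arr_map M (x, y))))"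
    using homs by (simp add: arrow_simps)
  also have "arr_map N (z, w) \<cdot> arr_map N (v, z) = arr_map N (v, w)"
    by (rule compN[OF inK(6,2,7) sub(2,3)])
  also have "\<psi> w \<cdot> (arr_map N (v, w) \<cdot> (\<phi> y \<cdot> arr_map M (x, y)))
      = (\<psi> w \<cdot> arr_map N (v, w)) \<cdot> (\<phi> y \<cdot> arr_map M (x, y))"
    using homs by (simp add: arrow_simps)
  also have "\<psi> w \<cdot> arr_map N (v, w) = arr_map M (vv, vw) \<cdot> \<psi> v"
    using \<psi> inB sub(9) by (simp add: is_module_hom_iff vv_def vw_def)
  also have "(arr_map M (zz, x2) \<cdot> arr_map M (vw, zz)) \<cdot> (\<dots> \<cdot> (\<phi> y \<cdot> arr_map M (x, y)))
    = ((arr_map M (zz, x2) \<cdot> arr_map M (vw, zz)) \<cdot> arr_map M (vv, vw)) \<cdot> ((\<psi> v \<cdot> \<phi> y) \<cdot> arr_map M (x, y))"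
    using homs by (simp add: arrow_simps)
  also have "(arr_map M (zz, x2) \<cdot> arr_map M (vw, zz)) \<cdot> arr_map M (vv, vw)
    = arr_map M (y2, x2) \<cdot> arr_map M (vv, y2)"
  proof -
    have "vw \<subseteq> x2"
      using sub by blast
    then show ?thesis
      using compM[OF inK(10,4,3) sub(4,5)] compM[OF inK(9,10,3) sub(10)] compM[OF inK(9,8,3) sub(6,7)]
      by simp
  qed
  also have "\<dots> \<cdot> ((\<psi> v \<cdot> \<phi> y) \<cdot> arr_map M (x, y))
    = arr_map M (y2, x2) \<cdot> ((arr_map M (vv, y2) \<cdot> (\<psi> v \<cdot> \<phi> y)) \<cdot> arr_map M (x, y))"
    using homs by (simp add: arrow_simps)
  also have "\<dots> = arr_map M (x, x2)"
  proof -
    have "x \<subseteq> y2"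
      using sub by blast
    then show ?thesis
      unfolding identity using compM[OF inK(1,5,8) sub(1,8)] compM[OF inK(1,8,3) _ sub(7)] by simp
  qed
  also have "\<dots> = shift_eta2 Y 0 (2 * \<epsilon>') M x \<cdot> shift_eta Y 0 M x"
    using compM[OF inK(1,11,3) zero(1,2)] by (simp add: shift_eta2_def shift_eta_def x2_def)
  finally show ?thesis .
qed

theorem weakly_interleaved_transport:
  assumes M: "is_module C (inclusion_poset K) M" and N: "is_module C (inclusion_poset K) N"
    and inter: "weakly_interleaved C (inclusion_poset B) W \<epsilon> M N"
  shows "weakly_interleaved C (inclusion_poset A) Y \<epsilon>' M N"
proof -
  obtain \<phi> \<psi> where \<phi>: "is_module_hom C (inclusion_poset B) M (shift W \<epsilon> N) \<phi>"
    and \<psi>: "is_module_hom C (inclusion_poset B) N (shift W \<epsilon> M) \<psi>"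
    and eqs: "\<And>y. y \<in> B \<Longrightarrow> shift_sigma W \<epsilon> \<epsilon> M y \<cdot> (shift_hom W \<epsilon> \<psi> y \<cdot> \<phi> y) =
          shift_eta2 W 0 (2 * \<epsilon>) M y \<cdot> shift_eta W 0 M y"
      "\<And>y. y \<in> B \<Longrightarrow> shift_sigma W \<epsilon> \<epsilon> N y \<cdot> (shift_hom W \<epsilon> \<phi> y \<cdot> \<psi> y) =
          shift_eta2 W 0 (2 * \<epsilon>) N y \<cdot> shift_eta W 0 N y"
    using inter unfolding weakly_interleaved_def by auto
  show ?thesis
    unfolding weakly_interleaved_def inclusion_poset_simps
    using transport_hom[OF M N \<phi>] transport_hom[OF N M \<psi>]
      transport_identity[OF M N \<phi> \<psi> eqs(1)] transport_identity[OF N M \<psi> \<phi> eqs(2)] by blast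
qed

end

lemma Inf_ennreal_shift:
  assumes "\<And>\<epsilon>. 0 \<le> \<epsilon> \<Longrightarrow> R \<epsilon> \<Longrightarrow> R' (\<epsilon> + c)" and c: "0 \<le> c"
  shows "Inf {ennreal \<epsilon> |\<epsilon>. 0 \<le> \<epsilon> \<and> R' \<epsilon>} \<le> Inf {ennreal \<epsilon> |\<epsilon>. 0 \<le> \<epsilon> \<and> R \<epsilon>} + ennreal c"
    (is "?I' \<le> ?I + _")
proof -
  have "?I' - ennreal c \<le> ennreal \<epsilon>" if "0 \<le> \<epsilon>" "R \<epsilon>" for \<epsilon>
  proof -
    have "?I' \<le> ennreal (\<epsilon> + c)"
      by (intro Inf_lower CollectI exI[of _ "\<epsilon> + c"]) (simp add: assms that)
    then show ?thesis
      using that c by (simp add: ennreal_minus_le_iff ennreal_plus add.commute)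
  qed
  then have "?I' - ennreal c \<le> ?I"
    by (auto intro!: Inf_greatest)
  then show ?thesis
    by (simp add: ennreal_minus_le_iff add.commute)
qed

section \<open>Cells and open stars\<close>

text \<open>Every point of the product of the closures is a limit of points of the product, because
  approximating sequences can be chosen in each coordinate separately.\<close>

lemma closure_vec_product:
  fixes I :: "'n::finite \<Rightarrow> real set"
  shows "closure {x :: real ^ 'n. \<forall>k. x $ k \<in> I k} = {x. \<forall>k. x $ k \<in> closure (I k)}"
proof
  have "closed {x :: real ^ 'n. x $ k \<in> closure (I k)}" for k
    using closed_vimage[OF closed_closure[of "I k"], of "\<lambda>x :: real ^ 'n. x $ k"]
    by (simp add: vimage_def continuous_intros)
  then have "closed {x :: real ^ 'n. \<forall>k. x $ k \<in> closure (I k)}"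
    by (rule closed_Collect_all)
  then show "closure {x :: real ^ 'n. \<forall>k. x $ k \<in> I k} \<subseteq> {x. \<forall>k. x $ k \<in> closure (I k)}"
    by (rule closure_minimal[rotated]) (use closure_subset in blast)
  show "{x :: real ^ 'n. \<forall>k. x $ k \<in> closure (I k)} \<subseteq> closure {x. \<forall>k. x $ k \<in> I k}"
  proof
    fix x :: "real ^ 'n"
    assume "x \<in> {x. \<forall>k. x $ k \<in> closure (I k)}"
    then have "\<forall>k. \<exists>s. (\<forall>i. s i \<in> I k) \<and> s \<longlonglongrightarrow> x $ k"
      by (simp add: closure_sequential)
    then obtain s where s: "\<And>k i. s k i \<in> I k" "\<And>k. s k \<longlonglongrightarrow> x $ k"
      by metis
    have "(\<lambda>i. \<chi> k. s k i) \<longlonglongrightarrow> x"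
      by (rule vec_tendstoI) (simp add: s(2))
    then show "x \<in> closure {x. \<forall>k. x $ k \<in> I k}"
      unfolding closure_sequential using s(1) by (intro exI[of _ "\<lambda>i. \<chi> k. s k i"]) auto
  qed
qed

text \<open>The cell that contains \<open>x\<close>: floor and ceiling of a coordinate, measured in units of \<open>\<delta>\<close>, record
  whether it is a grid coordinate and which grid point or open edge it belongs to. In these terms
  faces, stars and their intersections become inequalities between integers.\<close>

definition grid_cell :: "real \<Rightarrow> real ^ 'n \<Rightarrow> (real ^ 'n) set" where
  "grid_cell \<delta> x = {y. \<forall>k. \<lfloor>y $ k / \<delta>\<rfloor> = \<lfloor>x $ k / \<delta>\<rfloor> \<and> \<lceil>y $ k / \<delta>\<rceil> = \<lceil>x $ k / \<delta>\<rceil>}"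

lemma floor_ceiling_fibre:
  fixes \<delta> :: real
  assumes "\<delta> > 0"
  shows "{t. \<lfloor>t / \<delta>\<rfloor> = m \<and> \<lceil>t / \<delta>\<rceil> = m} = {\<delta> * of_int m}"
    and "{t. \<lfloor>t / \<delta>\<rfloor> = m \<and> \<lceil>t / \<delta>\<rceil> = m + 1} = {\<delta> * of_int m <..< \<delta> * (of_int m + 1)}"
proof -
  show "{t. \<lfloor>t / \<delta>\<rfloor> = m \<and> \<lceil>t / \<delta>\<rceil> = m} = {\<delta> * of_int m}"
    using assms by (auto simp: floor_eq_iff ceiling_eq_iff field_simps)
  show "{t. \<lfloor>t / \<delta>\<rfloor> = m \<and> \<lceil>t / \<delta>\<rceil> = m + 1} = {\<delta> * of_int m <..< \<delta> * (of_int m + 1)}"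
    using assms by (auto simp: floor_eq_iff ceiling_eq_iff field_simps)
qed

lemma floor_ceiling_cases:
  fixes t :: real
  obtains "\<lceil>t\<rceil> = \<lfloor>t\<rfloor>" | "\<lceil>t\<rceil> = \<lfloor>t\<rfloor> + 1"
  by (metis ceiling_altdef)

lemma grid_cells_eq:
  assumes "\<delta> > 0"
  shows "grid_cells \<delta> = range (grid_cell \<delta> :: real ^ 'n \<Rightarrow> _)"
proof
  show "grid_cells \<delta> \<subseteq> range (grid_cell \<delta> :: real ^ 'n \<Rightarrow> _)"
  proof
    fix \<sigma> :: "(real ^ 'n) set"
    assume "\<sigma> \<in> grid_cells \<delta>"
    then obtain I where \<sigma>: "\<sigma> = {x. \<forall>k. x $ k \<in> I k}"
      and I: "\<And>k. \<exists>m::int. I k = {\<delta> * of_int m} \<or> I k = {\<delta> * of_int m <..< \<delta> * (of_int m + 1)}"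
      unfolding grid_cells_def by blast
    have "\<exists>s. I k = {t. \<lfloor>t / \<delta>\<rfloor> = \<lfloor>s / \<delta>\<rfloor> \<and> \<lceil>t / \<delta>\<rceil> = \<lceil>s / \<delta>\<rceil>}" for k
    proof -
      obtain m :: int where "I k = {\<delta> * of_int m} \<or> I k = {\<delta> * of_int m <..< \<delta> * (of_int m + 1)}"
        using I by blast
      then consider "I k = {t. \<lfloor>t / \<delta>\<rfloor> = m \<and> \<lceil>t / \<delta>\<rceil> = m}" | "I k = {t. \<lfloor>t / \<delta>\<rfloor> = m \<and> \<lceil>t / \<delta>\<rceil> = m + 1}"
        using floor_ceiling_fibre[OF assms] by metis
      then show ?thesis
      proof cases
        case 1
        have "\<lfloor>\<delta> * of_int m / \<delta>\<rfloor> = m" "\<lceil>\<delta> * of_int m / \<delta>\<rceil> = m"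
          using assms by simp_all
        with 1 show ?thesis
          by metis
      next
        case 2
        have "\<delta> * (of_int m + 1 / 2) / \<delta> = of_int m + 1 / 2"
          using assms by simp
        moreover have "\<lfloor>of_int m + 1 / 2 :: real\<rfloor> = m" "\<lceil>of_int m + 1 / 2 :: real\<rceil> = m + 1"
          by (simp_all add: floor_eq_iff ceiling_eq_iff)
        ultimately show ?thesis
          using 2 by metis
      qed
    qed
    then have "\<exists>s. \<forall>k. I k = {t. \<lfloor>t / \<delta>\<rfloor> = \<lfloor>s k / \<delta>\<rfloor> \<and> \<lceil>t / \<delta>\<rceil> = \<lceil>s k / \<delta>\<rceil>}"
      by (intro choice allI)
    then obtain s where s: "\<And>k. I k = {t. \<lfloor>t / \<delta>\<rfloor> = \<lfloor>s k / \<delta>\<rfloor> \<and> \<lceil>t / \<delta>\<rceil> = \<lceil>s k / \<delta>\<rceil>}"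
      by blast
    have "\<sigma> = grid_cell \<delta> (\<chi> k. s k)"
      unfolding \<sigma> s grid_cell_def by simp
    then show "\<sigma> \<in> range (grid_cell \<delta> :: real ^ 'n \<Rightarrow> _)"
      by blast
  qed
  show "range (grid_cell \<delta> :: real ^ 'n \<Rightarrow> _) \<subseteq> grid_cells \<delta>"
  proof
    fix \<sigma> :: "(real ^ 'n) set"
    assume "\<sigma> \<in> range (grid_cell \<delta>)"
    then obtain x where x: "\<sigma> = grid_cell \<delta> x"
      by blast
    define I where "I k = {t. \<lfloor>t / \<delta>\<rfloor> = \<lfloor>x $ k / \<delta>\<rfloor> \<and> \<lceil>t / \<delta>\<rceil> = \<lceil>x $ k / \<delta>\<rceil>}" for k
    have "\<sigma> = {y. \<forall>k. y $ k \<in> I k}"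
      by (simp add: x I_def grid_cell_def)
    moreover have "\<exists>m::int. I k = {\<delta> * of_int m} \<or> I k = {\<delta> * of_int m <..< \<delta> * (of_int m + 1)}" for k
      by (rule floor_ceiling_cases[of "x $ k / \<delta>"]) (auto simp: I_def floor_ceiling_fibre[OF assms])
    ultimately show "\<sigma> \<in> grid_cells \<delta>"
      unfolding grid_cells_def by blast
  qed
qed

lemma closure_floor_ceiling_fibre:
  fixes \<delta> s :: real
  assumes "\<delta> > 0"
  shows "closure {t. \<lfloor>t / \<delta>\<rfloor> = \<lfloor>s / \<delta>\<rfloor> \<and> \<lceil>t / \<delta>\<rceil> = \<lceil>s / \<delta>\<rceil>}
    = {t. of_int \<lfloor>s / \<delta>\<rfloor> \<le> t / \<delta> \<and> t / \<delta> \<le> of_int \<lceil>s / \<delta>\<rceil>}"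
proof (rule floor_ceiling_cases[of "s / \<delta>"])
  assume "\<lceil>s / \<delta>\<rceil> = \<lfloor>s / \<delta>\<rfloor>"
  then show ?thesis
    using assms by (auto simp: floor_ceiling_fibre field_simps)
next
  assume *: "\<lceil>s / \<delta>\<rceil> = \<lfloor>s / \<delta>\<rfloor> + 1"
  have "\<delta> * of_int \<lfloor>s / \<delta>\<rfloor> < \<delta> * (of_int \<lfloor>s / \<delta>\<rfloor> + 1)"
    using assms by simp
  then have cl: "closure {t. \<lfloor>t / \<delta>\<rfloor> = \<lfloor>s / \<delta>\<rfloor> \<and> \<lceil>t / \<delta>\<rceil> = \<lfloor>s / \<delta>\<rfloor> + 1}
    = {\<delta> * of_int \<lfloor>s / \<delta>\<rfloor> .. \<delta> * (of_int \<lfloor>s / \<delta>\<rfloor> + 1)}"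
    unfolding floor_ceiling_fibre(2)[OF assms] by (rule closure_greaterThanLessThan)
  show ?thesis
    unfolding * cl
    using assms by (simp add: set_eq_iff pos_le_divide_eq pos_divide_le_eq mult.commute)
qed

lemma closure_grid_cell:
  fixes x :: "real ^ 'n"
  assumes "\<delta> > 0"
  shows "closure (grid_cell \<delta> x)
    = {y. \<forall>k. of_int \<lfloor>x $ k / \<delta>\<rfloor> \<le> y $ k / \<delta> \<and> y $ k / \<delta> \<le> of_int \<lceil>x $ k / \<delta>\<rceil>}"
  using closure_vec_product[of "\<lambda>k. {t. \<lfloor>t / \<delta>\<rfloor> = \<lfloor>x $ k / \<delta>\<rfloor> \<and> \<lceil>t / \<delta>\<rceil> = \<lceil>x $ k / \<delta>\<rceil>}"]
  by (simp add: grid_cell_def closure_floor_ceiling_fibre[OF assms])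

lemma grid_cell_self: "x \<in> grid_cell \<delta> x"
  by (simp add: grid_cell_def)

lemma grid_cell_face_iff:
  fixes x y :: "real ^ 'n"
  assumes "\<delta> > 0"
  shows "grid_cell \<delta> y \<subseteq> closure (grid_cell \<delta> x) \<longleftrightarrow>
    (\<forall>k. \<lfloor>x $ k / \<delta>\<rfloor> \<le> \<lfloor>y $ k / \<delta>\<rfloor> \<and> \<lceil>y $ k / \<delta>\<rceil> \<le> \<lceil>x $ k / \<delta>\<rceil>)"
proof
  assume "grid_cell \<delta> y \<subseteq> closure (grid_cell \<delta> x)"
  then have "y \<in> closure (grid_cell \<delta> x)"
    using grid_cell_self by blast
  then show "\<forall>k. \<lfloor>x $ k / \<delta>\<rfloor> \<le> \<lfloor>y $ k / \<delta>\<rfloor> \<and> \<lceil>y $ k / \<delta>\<rceil> \<le> \<lceil>x $ k / \<delta>\<rceil>"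
    by (simp add: closure_grid_cell[OF assms] le_floor_iff ceiling_le_iff)
next
  assume le: "\<forall>k. \<lfloor>x $ k / \<delta>\<rfloor> \<le> \<lfloor>y $ k / \<delta>\<rfloor> \<and> \<lceil>y $ k / \<delta>\<rceil> \<le> \<lceil>x $ k / \<delta>\<rceil>"
  show "grid_cell \<delta> y \<subseteq> closure (grid_cell \<delta> x)"
  proof
    fix z assume "z \<in> grid_cell \<delta> y"
    then have "\<forall>k. \<lfloor>x $ k / \<delta>\<rfloor> \<le> \<lfloor>z $ k / \<delta>\<rfloor> \<and> \<lceil>z $ k / \<delta>\<rceil> \<le> \<lceil>x $ k / \<delta>\<rceil>"
      using le by (simp add: grid_cell_def)
    then show "z \<in> closure (grid_cell \<delta> x)"
      by (simp add: closure_grid_cell[OF assms] le_floor_iff ceiling_le_iff)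
  qed
qed

lemma grid_cell_eq_iff:
  "grid_cell \<delta> x = grid_cell \<delta> y \<longleftrightarrow>
     (\<forall>k. \<lfloor>x $ k / \<delta>\<rfloor> = \<lfloor>y $ k / \<delta>\<rfloor> \<and> \<lceil>x $ k / \<delta>\<rceil> = \<lceil>y $ k / \<delta>\<rceil>)"
proof
  assume "grid_cell \<delta> x = grid_cell \<delta> y"
  then have "x \<in> grid_cell \<delta> y"
    using grid_cell_self by blast
  then show "\<forall>k. \<lfloor>x $ k / \<delta>\<rfloor> = \<lfloor>y $ k / \<delta>\<rfloor> \<and> \<lceil>x $ k / \<delta>\<rceil> = \<lceil>y $ k / \<delta>\<rceil>"
    by (simp add: grid_cell_def)
qed (simp add: grid_cell_def)

text \<open>The open star of the cell that contains \<open>x\<close>, written as an open box.\<close>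

definition point_star :: "real \<Rightarrow> real ^ 'n \<Rightarrow> (real ^ 'n) set" where
  "point_star \<delta> x = {y. \<forall>k. of_int \<lceil>x $ k / \<delta>\<rceil> - 1 < y $ k / \<delta> \<and> y $ k / \<delta> < of_int \<lfloor>x $ k / \<delta>\<rfloor> + 1}"

lemma mem_point_star_iff:
  "y \<in> point_star \<delta> x \<longleftrightarrow> (\<forall>k. \<lfloor>y $ k / \<delta>\<rfloor> \<le> \<lfloor>x $ k / \<delta>\<rfloor> \<and> \<lceil>x $ k / \<delta>\<rceil> \<le> \<lceil>y $ k / \<delta>\<rceil>)"
proof -
  have "of_int a - 1 < t \<longleftrightarrow> a \<le> \<lceil>t\<rceil>" "t < of_int b + 1 \<longleftrightarrow> \<lfloor>t\<rfloor> \<le> b" for a b :: int and t :: real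
    by linarith+
  then show ?thesis
    by (auto simp: point_star_def)
qed

lemma open_star_grid_cell:
  fixes x :: "real ^ 'n"
  assumes "\<delta> > 0"
  shows "open_star \<delta> (grid_cell \<delta> x) = point_star \<delta> x"
proof -
  have "y \<in> open_star \<delta> (grid_cell \<delta> x) \<longleftrightarrow> grid_cell \<delta> x \<subseteq> closure (grid_cell \<delta> y)" for y
  proof
    assume "y \<in> open_star \<delta> (grid_cell \<delta> x)"
    then obtain z where z: "y \<in> grid_cell \<delta> z" "grid_cell \<delta> x \<subseteq> closure (grid_cell \<delta> z)"
      unfolding open_star_def grid_cells_eq[OF assms] by blast
    then have "grid_cell \<delta> y = grid_cell \<delta> z"
      unfolding grid_cell_eq_iff by (simp add: grid_cell_def)
    with z show "grid_cell \<delta> x \<subseteq> closure (grid_cell \<delta> y)"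
      by simp
  next
    assume "grid_cell \<delta> x \<subseteq> closure (grid_cell \<delta> y)"
    then show "y \<in> open_star \<delta> (grid_cell \<delta> x)"
      unfolding open_star_def grid_cells_eq[OF assms] using grid_cell_self by blast
  qed
  then show ?thesis
    unfolding set_eq_iff mem_point_star_iff grid_cell_face_iff[OF assms] by blast
qed

lemma point_star_self: "x \<in> point_star \<delta> x"
  by (simp add: mem_point_star_iff)

lemma point_star_subset_iff: "point_star \<delta> x \<subseteq> point_star \<delta> y \<longleftrightarrow> x \<in> point_star \<delta> y"
proof
  show "x \<in> point_star \<delta> y" if "point_star \<delta> x \<subseteq> point_star \<delta> y"
    using that point_star_self by blast
  show "point_star \<delta> x \<subseteq> point_star \<delta> y" if "x \<in> point_star \<delta> y"
    using that unfolding subset_iff mem_point_star_iff by (meson order_trans)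
qed

lemma open_point_star: "open (point_star \<delta> (x :: real ^ 'n))"
proof -
  have "open {y :: real ^ 'n. a < y $ k / \<delta> \<and> y $ k / \<delta> < b}" for k a b
    unfolding divide_inverse by (intro open_Collect_conj open_Collect_less continuous_intros)
  then have "open (\<Inter>k. {y. of_int \<lceil>x $ k / \<delta>\<rceil> - 1 < y $ k / \<delta> \<and> y $ k / \<delta> < of_int \<lfloor>x $ k / \<delta>\<rfloor> + 1})"
    by (intro open_INT) auto
  moreover have "point_star \<delta> x
    = (\<Inter>k. {y. of_int \<lceil>x $ k / \<delta>\<rceil> - 1 < y $ k / \<delta> \<and> y $ k / \<delta> < of_int \<lfloor>x $ k / \<delta>\<rfloor> + 1})"
    by (auto simp: point_star_def)
  ultimately show ?thesis
    by simp
qed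

text \<open>The box with the smaller floors and the larger ceilings is the intersection. A point \<open>z\<close> in the
  intersection forces the larger ceiling to exceed the smaller floor by at most one, which makes this
  pair the floor and ceiling of an actual number, namely of their mean.\<close>

lemma point_star_Int:
  fixes x y :: "real ^ 'n"
  assumes "\<delta> > 0" and "point_star \<delta> x \<inter> point_star \<delta> y \<noteq> {}"
  shows "\<exists>w. point_star \<delta> x \<inter> point_star \<delta> y = point_star \<delta> w"
proof -
  obtain z where z: "z \<in> point_star \<delta> x" "z \<in> point_star \<delta> y"
    using assms by blast
  have "\<exists>t :: real. \<lfloor>t\<rfloor> = min \<lfloor>x $ k / \<delta>\<rfloor> \<lfloor>y $ k / \<delta>\<rfloor> \<and> \<lceil>t\<rceil> = max \<lceil>x $ k / \<delta>\<rceil> \<lceil>y $ k / \<delta>\<rceil>" for k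
  proof -
    define a b where "a = min \<lfloor>x $ k / \<delta>\<rfloor> \<lfloor>y $ k / \<delta>\<rfloor>" and "b = max \<lceil>x $ k / \<delta>\<rceil> \<lceil>y $ k / \<delta>\<rceil>"
    have "\<lfloor>z $ k / \<delta>\<rfloor> \<le> a" "b \<le> \<lceil>z $ k / \<delta>\<rceil>"
      using z by (simp_all add: mem_point_star_iff a_def b_def)
    moreover have "a \<le> \<lfloor>x $ k / \<delta>\<rfloor>" "\<lceil>x $ k / \<delta>\<rceil> \<le> b"
      by (simp_all add: a_def b_def)
    ultimately have "a \<le> b" "b \<le> a + 1"
      using floor_le_ceiling[of "x $ k / \<delta>"] ceiling_diff_floor_le_1[of "z $ k / \<delta>"]
      by linarith+
    then consider "b = a" | "b = a + 1"
      by linarith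
    then have "\<lfloor>(of_int a + of_int b) / 2 :: real\<rfloor> = a \<and> \<lceil>(of_int a + of_int b) / 2 :: real\<rceil> = b"
      by cases (auto simp: floor_eq_iff ceiling_eq_iff field_simps)
    then show ?thesis
      unfolding a_def b_def by blast
  qed
  then obtain t :: "'n \<Rightarrow> real" where t: "\<And>k. \<lfloor>t k\<rfloor> = min \<lfloor>x $ k / \<delta>\<rfloor> \<lfloor>y $ k / \<delta>\<rfloor>"
      "\<And>k. \<lceil>t k\<rceil> = max \<lceil>x $ k / \<delta>\<rceil> \<lceil>y $ k / \<delta>\<rceil>"
    by metis
  have "point_star \<delta> x \<inter> point_star \<delta> y = point_star \<delta> (\<chi> k. \<delta> * t k)"
    using assms(1) by (auto simp: set_eq_iff mem_point_star_iff t)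
  then show ?thesis
    by blast
qed

lemma infnorm_less_iff: "infnorm (x :: real ^ 'n) < r \<longleftrightarrow> (\<forall>k. \<bar>x $ k\<bar> < r)"
  by (simp add: infnorm_Max Basis_vec_def inner_axis)

text \<open>In each coordinate the star of a vertex extends less than \<open>\<delta>\<close> to either side, and the star of an edge
  is that edge, of length \<open>\<delta>\<close>. So the star of a cell lies in the ball of radius \<open>\<delta>\<close> about any
  point of that cell.\<close>

lemma point_star_near:
  assumes "\<delta> > 0" and "y \<in> point_star \<delta> x"
  shows "infnorm (y - x) < \<delta>"
  unfolding infnorm_less_iff
proof
  fix k
  have "of_int \<lceil>x $ k / \<delta>\<rceil> - 1 < y $ k / \<delta>" "y $ k / \<delta> < of_int \<lfloor>x $ k / \<delta>\<rfloor> + 1"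
    using assms(2) by (simp_all add: point_star_def)
  then have "x $ k / \<delta> - 1 < y $ k / \<delta>" "y $ k / \<delta> < x $ k / \<delta> + 1"
    by linarith+
  then have "(x $ k - \<delta>) / \<delta> < y $ k / \<delta>" "y $ k / \<delta> < (x $ k + \<delta>) / \<delta>"
    using assms(1) by (simp_all add: diff_divide_distrib add_divide_distrib)
  then show "\<bar>(y - x) $ k\<bar> < \<delta>"
    using assms(1) by (simp add: divide_less_cancel abs_less_iff)
qed

section \<open>Grid opens and the lower approximation translation\<close>

lemma metric_translation_mono: "U \<subseteq> V \<Longrightarrow> metric_translation \<epsilon> U \<subseteq> metric_translation \<epsilon> V"
  by (auto simp: metric_translation_def)

lemma metric_translation_extensive: "0 \<le> \<epsilon> \<Longrightarrow> U \<subseteq> metric_translation \<epsilon> U"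
  by (force simp: metric_translation_def infnorm_0)

lemma metric_translation_superlinear:
  assumes "0 \<le> a" "0 \<le> b"
  shows "metric_translation b (metric_translation a U) \<subseteq> metric_translation (a + b) U"
proof (cases "a = 0 \<or> b = 0")
  case False
  have triangle: "infnorm (z - x) < a + b" if "infnorm (z - y) < b" "infnorm (y - x) < a" for x y z :: "real ^ 'n"
    using infnorm_triangle[of "z - y" "y - x"] that by simp
  have "a \<noteq> 0" "b \<noteq> 0" "a + b \<noteq> 0"
    using False assms by auto
  then show ?thesis
    unfolding metric_translation_def using triangle by auto
qed (auto simp: metric_translation_def)

lemma metric_translation_mono_radius:
  assumes "0 \<le> a" "a \<le> b"
  shows "metric_translation a U \<subseteq> metric_translation b U"
  using metric_translation_superlinear[of a "b - a" U]
    metric_translation_extensive[of "b - a" "metric_translation a U"] assms by auto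

lemma open_metric_translation:
  assumes "open U"
  shows "open (metric_translation \<epsilon> U)"
proof -
  have "open {y. infnorm (y - x) < \<epsilon>}" for x :: "real ^ 'n"
    by (intro open_Collect_less continuous_intros)
  then show ?thesis
    using assms by (auto simp: metric_translation_def)
qed

lemma translation_family_metric:
  "translation_family (inclusion_poset {U :: (real ^ 'n) set. open U}) metric_translation"
  by unfold_locales (auto simp: open_metric_translation metric_translation_mono[THEN subsetD]
      metric_translation_extensive[THEN subsetD] metric_translation_superlinear[THEN subsetD])

text \<open>Point stars are the smallest grid opens around their points.\<close>

lemma grid_opens_iff:
  fixes U :: "(real ^ 'n) set"
  assumes "\<delta> > 0"
  shows "U \<in> grid_opens \<delta> \<longleftrightarrow> (\<forall>x \<in> U. point_star \<delta> x \<subseteq> U)"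
proof
  assume "U \<in> grid_opens \<delta>"
  then obtain S where S: "S \<subseteq> grid_cells \<delta>" "U = (\<Union>\<sigma> \<in> S. open_star \<delta> \<sigma>)"
    by (auto simp: grid_opens_def)
  show "\<forall>x \<in> U. point_star \<delta> x \<subseteq> U"
  proof
    fix x assume "x \<in> U"
    then obtain \<sigma> where \<sigma>: "\<sigma> \<in> S" "x \<in> open_star \<delta> \<sigma>"
      using S by blast
    then obtain z where z: "\<sigma> = grid_cell \<delta> z"
      using S(1) grid_cells_eq[OF assms] by blast
    then have "point_star \<delta> x \<subseteq> open_star \<delta> \<sigma>"
      using \<sigma>(2) by (simp add: open_star_grid_cell[OF assms] point_star_subset_iff)
    then show "point_star \<delta> x \<subseteq> U"
      using \<sigma>(1) S(2) by blast
  qed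
next
  assume stars: "\<forall>x \<in> U. point_star \<delta> x \<subseteq> U"
  then have U: "U = (\<Union>x \<in> U. point_star \<delta> x)"
    using point_star_self by blast
  then have "U = (\<Union>\<sigma> \<in> grid_cell \<delta> ` U. open_star \<delta> \<sigma>)"
    by (simp add: open_star_grid_cell[OF assms])
  moreover have "open U"
    by (subst U) (simp add: open_UN open_point_star)
  moreover have "grid_cell \<delta> ` U \<subseteq> grid_cells \<delta>"
    using grid_cells_eq[OF assms] by blast
  ultimately show "U \<in> grid_opens \<delta>"
    unfolding grid_opens_def by blast
qed

lemma open_grid_opens: "U \<in> grid_opens \<delta> \<Longrightarrow> open U"
  by (simp add: grid_opens_def)

lemma Union_grid_opens:
  assumes "\<delta> > 0" "\<U> \<subseteq> grid_opens \<delta>"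
  shows "\<Union>\<U> \<in> grid_opens \<delta>"
  using assms(2) unfolding grid_opens_iff[OF assms(1)] subset_iff by (meson Union_iff)

lemma lower_approx_eq:
  assumes "\<delta> > 0"
  shows "lower_approx \<delta> V = \<Union>{U \<in> grid_opens \<delta>. U \<subseteq> V}"
proof -
  interpret partial_order "GridO_poset \<delta>"
    unfolding GridO_poset_def by (rule partial_order_inclusion_poset)
  let ?A = "{U \<in> grid_opens \<delta>. U \<subseteq> V}"
  have "\<Union>?A \<in> grid_opens \<delta>"
    by (rule Union_grid_opens[OF assms]) blast
  then have lub: "is_lub (GridO_poset \<delta>) (\<Union>?A) ?A"
    by (intro least_UpperI) (auto simp: GridO_poset_def Upper_def)
  have "(SOME W. is_lub (GridO_poset \<delta>) W ?A) = \<Union>?A"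
    using lub least_unique by (intro some_equality) blast+
  then show ?thesis
    by (simp add: lower_approx_def Lattice.sup_def grid_to_open_def)
qed

lemma lower_approx_grid_open: "\<delta> > 0 \<Longrightarrow> lower_approx \<delta> V \<in> grid_opens \<delta>"
  unfolding lower_approx_eq by (rule Union_grid_opens) auto

lemma lower_approx_subset: "\<delta> > 0 \<Longrightarrow> lower_approx \<delta> V \<subseteq> V"
  by (auto simp: lower_approx_eq)

lemma lower_approx_greatest: "\<delta> > 0 \<Longrightarrow> U \<in> grid_opens \<delta> \<Longrightarrow> U \<subseteq> V \<Longrightarrow> U \<subseteq> lower_approx \<delta> V"
  by (auto simp: lower_approx_eq)

lemma lower_translation_eq: "lower_translation \<delta> \<epsilon> U = lower_approx \<delta> (metric_translation \<epsilon> U)"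
  by (simp add: lower_translation_def grid_to_open_def)

lemma lower_translation_subset: "\<delta> > 0 \<Longrightarrow> lower_translation \<delta> \<epsilon> U \<subseteq> metric_translation \<epsilon> U"
  unfolding lower_translation_eq by (rule lower_approx_subset)

lemma translation_family_lower:
  assumes "\<delta> > 0"
  shows "translation_family (inclusion_poset (grid_opens \<delta>)) (lower_translation \<delta>)"
proof (unfold_locales, unfold inclusion_poset_simps lower_translation_eq)
  fix \<epsilon> \<epsilon>' :: real and U V :: "(real ^ 'n) set"
  show "lower_approx \<delta> (metric_translation \<epsilon> U) \<in> grid_opens \<delta>"
    by (rule lower_approx_grid_open[OF assms])
  show "lower_approx \<delta> (metric_translation \<epsilon> U) \<subseteq> lower_approx \<delta> (metric_translation \<epsilon> V)" if "U \<subseteq> V"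
    by (rule lower_approx_greatest[OF assms lower_approx_grid_open[OF assms]])
      (use lower_approx_subset[OF assms] metric_translation_mono[OF that] in blast)
  show "U \<subseteq> lower_approx \<delta> (metric_translation \<epsilon> U)" if "0 \<le> \<epsilon>" "U \<in> grid_opens \<delta>"
    using lower_approx_greatest[OF assms that(2)] metric_translation_extensive[OF that(1)] by blast
  assume "0 \<le> \<epsilon>" "0 \<le> \<epsilon>'"
  then have "metric_translation \<epsilon>' (lower_approx \<delta> (metric_translation \<epsilon> U)) \<subseteq> metric_translation (\<epsilon> + \<epsilon>') U"
    using metric_translation_mono[OF lower_approx_subset[OF assms]] metric_translation_superlinear by blast
  then show "lower_approx \<delta> (metric_translation \<epsilon>' (lower_approx \<delta> (metric_translation \<epsilon> U)))
      \<subseteq> lower_approx \<delta> (metric_translation (\<epsilon> + \<epsilon>') U)"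
    by (intro lower_approx_greatest[OF assms lower_approx_grid_open[OF assms]])
      (use lower_approx_subset[OF assms] in blast)
qed

text \<open>The smallest grid open that contains \<open>V\<close>.\<close>

definition grid_hull :: "real \<Rightarrow> (real ^ 'n) set \<Rightarrow> (real ^ 'n) set" where
  "grid_hull \<delta> V = (\<Union>x \<in> V. point_star \<delta> x)"

lemma grid_hull_grid_open:
  assumes "\<delta> > 0"
  shows "grid_hull \<delta> V \<in> grid_opens \<delta>"
  unfolding grid_opens_iff[OF assms] grid_hull_def using point_star_subset_iff by blast

lemma grid_hull_extensive: "V \<subseteq> grid_hull \<delta> V"
  using point_star_self by (auto simp: grid_hull_def)

lemma grid_hull_near: "\<delta> > 0 \<Longrightarrow> grid_hull \<delta> V \<subseteq> metric_translation \<delta> V"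
  by (auto simp: grid_hull_def metric_translation_def intro: point_star_near)

text \<open>The grid hull of the translated set is a grid open which is only \<open>\<delta>\<close> larger.\<close>

lemma metric_le_lower_translation:
  assumes "\<delta> > 0" "0 \<le> a" "a + \<delta> \<le> b"
  shows "metric_translation a U \<subseteq> lower_translation \<delta> b U"
proof -
  have "grid_hull \<delta> (metric_translation a U) \<subseteq> metric_translation b U"
    using grid_hull_near[OF assms(1)] metric_translation_superlinear[of a \<delta> U]
      metric_translation_mono_radius[of "a + \<delta>" b U] assms by fastforce
  then have "grid_hull \<delta> (metric_translation a U) \<subseteq> lower_translation \<delta> b U"
    unfolding lower_translation_eq
    by (rule lower_approx_greatest[OF assms(1) grid_hull_grid_open[OF assms(1)]])
  then show ?thesis
    using grid_hull_extensive by blast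
qed

lemma lower_translation_hull_le_metric:
  assumes "\<delta> > 0" "0 \<le> a" "a + \<delta> \<le> b"
  shows "lower_translation \<delta> a (grid_hull \<delta> V) \<subseteq> metric_translation b V"
proof -
  have "lower_translation \<delta> a (grid_hull \<delta> V) \<subseteq> metric_translation a (metric_translation \<delta> V)"
    using lower_translation_subset[OF assms(1)] metric_translation_mono[OF grid_hull_near[OF assms(1)]] by blast
  also have "\<dots> \<subseteq> metric_translation (\<delta> + a) V"
    using assms by (intro metric_translation_superlinear) auto
  also have "\<dots> \<subseteq> metric_translation b V"
    using assms by (intro metric_translation_mono_radius) auto
  finally show ?thesis .
qed

section \<open>Cosheaves on the grid\<close>

lemma partial_order_Cell_poset:
  assumes "\<delta> > 0"
  shows "partial_order (Cell_poset \<delta> :: (real ^ 'n) set gorder)"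
proof unfold_locales
  fix \<sigma> \<tau> \<rho> :: "(real ^ 'n) set"
  show "\<sigma> \<sqsubseteq>\<^bsub>Cell_poset \<delta>\<^esub> \<sigma>"
    by (simp add: Cell_poset_def closure_subset)
  show "\<sigma> .=\<^bsub>Cell_poset \<delta>\<^esub> \<tau>" if le: "\<sigma> \<sqsubseteq>\<^bsub>Cell_poset \<delta>\<^esub> \<tau>" "\<tau> \<sqsubseteq>\<^bsub>Cell_poset \<delta>\<^esub> \<sigma>"
    and cells: "\<sigma> \<in> carrier (Cell_poset \<delta>)" "\<tau> \<in> carrier (Cell_poset \<delta>)"
  proof -
    obtain x y where "\<sigma> = grid_cell \<delta> x" "\<tau> = grid_cell \<delta> y"
      using cells by (auto simp: Cell_poset_def grid_cells_eq[OF assms])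
    then show ?thesis
      using le
      by (auto simp: Cell_poset_def grid_cell_face_iff[OF assms] grid_cell_eq_iff intro: antisym)
  qed
  show "\<sigma> \<sqsubseteq>\<^bsub>Cell_poset \<delta>\<^esub> \<rho>" if "\<sigma> \<sqsubseteq>\<^bsub>Cell_poset \<delta>\<^esub> \<tau>" "\<tau> \<sqsubseteq>\<^bsub>Cell_poset \<delta>\<^esub> \<rho>"
  proof -
    have "closure \<tau> \<subseteq> closure \<sigma>"
      using that(1) by (simp add: Cell_poset_def closure_minimal)
    then show ?thesis
      using that(2) by (simp add: Cell_poset_def)
  qed
qed (simp_all add: Cell_poset_def)

text \<open>The face relation is the inclusion of stars, so cells and stars index the same diagrams.\<close>

lemma cell_le_iff_star_subset:
  assumes "\<delta> > 0" and "\<sigma> \<in> grid_cells \<delta>" "\<tau> \<in> grid_cells \<delta>"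
  shows "\<sigma> \<sqsubseteq>\<^bsub>Cell_poset \<delta>\<^esub> \<tau> \<longleftrightarrow> open_star \<delta> \<sigma> \<subseteq> open_star \<delta> \<tau>"
proof -
  obtain x y where "\<sigma> = grid_cell \<delta> x" "\<tau> = grid_cell \<delta> y"
    using assms by (auto simp: grid_cells_eq)
  then show ?thesis
    by (simp add: Cell_poset_def grid_cell_face_iff[OF assms(1)] open_star_grid_cell[OF assms(1)]
        point_star_subset_iff mem_point_star_iff)
qed

text \<open>Stars are closed under nonempty intersections, and a grid open contains the star of each of its
  points.\<close>

lemma cech_cover_stars:
  fixes U :: "(real ^ 'n) set"
  assumes "\<delta> > 0" "U \<in> grid_opens \<delta>"
  shows "cech_cover U (open_star \<delta> ` {\<sigma> \<in> grid_cells \<delta>. open_star \<delta> \<sigma> \<subseteq> U})"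
proof -
  let ?\<U> = "{V. \<exists>x. V = point_star \<delta> x \<and> V \<subseteq> U}"
  have cover: "open_star \<delta> ` {\<sigma> \<in> grid_cells \<delta>. open_star \<delta> \<sigma> \<subseteq> U} = ?\<U>"
    by (force simp: grid_cells_eq[OF assms(1)] open_star_grid_cell[OF assms(1)])
  have Int: "\<Inter>\<V> \<in> ?\<U>" if "finite \<V>" "\<V> \<noteq> {}" "\<V> \<subseteq> ?\<U>" "\<Inter>\<V> \<noteq> {}" for \<V>
    using that
  proof (induction \<V> rule: finite_ne_induct)
    case (singleton V)
    then show ?case
      by simp
  next
    case (insert V \<V>)
    then have "\<Inter>\<V> \<in> ?\<U>"
      by auto
    then obtain x y where "\<Inter>\<V> = point_star \<delta> x" "V = point_star \<delta> y" "V \<subseteq> U"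
      using insert.prems(1) by auto
    moreover have "\<Inter>(insert V \<V>) = V \<inter> \<Inter>\<V>"
      by simp
    ultimately show ?case
      using point_star_Int[OF assms(1), of y x] insert.prems(2) by auto
  qed
  have "U \<subseteq> \<Union>?\<U>"
  proof
    fix x assume "x \<in> U"
    then show "x \<in> \<Union>?\<U>"
      using assms(2) point_star_self[of x \<delta>] unfolding grid_opens_iff[OF assms(1)] by blast
  qed
  then have "\<Union>?\<U> = U"
    by blast
  then show ?thesis
    unfolding cover cech_cover_def using Int by (auto simp: open_point_star)
qed

text \<open>The cosheaf condition speaks of the map induced from a chosen colimit. As this map is invertible,
  the internal maps into \<open>F U\<close> are themselves a colimit cocone.\<close>

lemma (in category) cosheaf_colimit:
  fixes F :: "((real ^ 'n) set, 'o, 'm) pmodule"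
  assumes cocomp: "cocomplete TYPE((real ^ 'n) set) TYPE((real ^ 'n) set \<times> (real ^ 'n) set) C"
    and F: "cosheaf C F" and U: "open U" and cover: "cech_cover U \<U>"
  shows "is_colimit (poset_cat (inclusion_poset \<U>)) C F (obj_map F U) (\<lambda>V. arr_map F (V, U))"
proof -
  let ?J = "poset_cat (inclusion_poset \<U>)"
  have J: "category ?J"
    by (rule category_poset_cat[OF partial_order_inclusion_poset])
  have mod: "is_module C (inclusion_poset {U. open U}) F"
    using F by (simp add: cosheaf_def Open_poset_def)
  note modD = is_moduleD[OF mod, simplified]
  have sub: "open V" "V \<subseteq> U" if "V \<in> \<U>" for V
    using cover that by (auto simp: cech_cover_def)
  have D: "is_functor ?J C F"
    by (rule is_moduleI) (simp_all add: modD sub)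
  obtain L \<iota> where L: "is_colimit ?J C F L \<iota>"
    using cocomp J D unfolding cocomplete_def by blast
  have coc: "is_cocone ?J C F (obj_map F U) (\<lambda>V. arr_map F (V, U))"
    by (simp add: is_cocone_poset_iff modD sub U)
  let ?u = "colim_desc ?J C F (obj_map F U) (\<lambda>V. arr_map F (V, U))"
  have "is_iso C ?u"
    using F U cover by (simp add: cosheaf_def)
  note col = colimit_along_iso[OF J D colim_is_colimit[OF L] this colim_desc_Hom[OF L coc]]
  show ?thesis
    by (rule is_colimit_cong[OF J _ col]) (rule colim_desc_in[OF L coc])
qed

lemma cell_pushforward_setting:
  assumes "\<delta> > 0" and "category C"
    and "cocomplete TYPE((real ^ 'n) set) TYPE((real ^ 'n) set \<times> (real ^ 'n) set) C"
  shows "pushforward_setting C (Cell_poset \<delta>) (GridO_poset \<delta>)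
    (cell_to_grid \<delta> :: (real ^ 'n) set \<Rightarrow> _)"
proof (rule pushforward_setting.intro[OF assms(2)], rule pushforward_setting_axioms.intro)
  show "partial_order (Cell_poset \<delta> :: (real ^ 'n) set gorder)"
    by (rule partial_order_Cell_poset[OF assms(1)])
  show "partial_order (GridO_poset \<delta> :: (real ^ 'n) set gorder)"
    unfolding GridO_poset_def by (rule partial_order_inclusion_poset)
  show "cell_to_grid \<delta> \<sigma> \<in> carrier (GridO_poset \<delta>)" if \<sigma>: "\<sigma> \<in> carrier (Cell_poset \<delta>)"
    for \<sigma> :: "(real ^ 'n) set"
  proof -
    obtain x where "\<sigma> = grid_cell \<delta> x"
      using \<sigma> by (auto simp: Cell_poset_def grid_cells_eq[OF assms(1)])
    then show ?thesis
      by (simp add: cell_to_grid_def GridO_poset_def open_star_grid_cell[OF assms(1)]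
          grid_opens_iff[OF assms(1)] point_star_subset_iff)
  qed
  show "cell_to_grid \<delta> \<sigma> \<sqsubseteq>\<^bsub>GridO_poset \<delta>\<^esub> cell_to_grid \<delta> \<tau>"
    if "\<sigma> \<in> carrier (Cell_poset \<delta>)" "\<tau> \<in> carrier (Cell_poset \<delta>)" "\<sigma> \<sqsubseteq>\<^bsub>Cell_poset \<delta>\<^esub> \<tau>"
    for \<sigma> \<tau> :: "(real ^ 'n) set"
  proof -
    have "\<sigma> \<in> grid_cells \<delta>" "\<tau> \<in> grid_cells \<delta>"
      using that by (simp_all add: Cell_poset_def)
    then have "open_star \<delta> \<sigma> \<subseteq> open_star \<delta> \<tau>"
      using that(3) cell_le_iff_star_subset[OF assms(1)] by blast
    then show ?thesis
      by (simp add: cell_to_grid_def GridO_poset_def)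
  qed
qed (fact assms(3))

text \<open>The stars inside a grid open \<open>U\<close> form a Cech cover, so \<open>F U\<close> is the colimit of \<open>F\<close> over them, and they
  correspond to the cells that index the pushforward at \<open>U\<close>.\<close>

lemma cosheaf_determined:
  fixes F :: "((real ^ 'n) set, 'o, 'm) pmodule"
  assumes "\<delta> > 0" and C: "category C"
    and cocomp: "cocomplete TYPE((real ^ 'n) set) TYPE((real ^ 'n) set \<times> (real ^ 'n) set) C"
    and F: "cosheaf C F"
  shows "pushforward_setting.determined C (Cell_poset \<delta>) (GridO_poset \<delta>) (cell_to_grid \<delta>) F"
proof -
  interpret pushforward_setting C "Cell_poset \<delta>" "GridO_poset \<delta>"
    "cell_to_grid \<delta> :: (real ^ 'n) set \<Rightarrow> _"
    by (rule cell_pushforward_setting) fact+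
  have mod: "is_module C (inclusion_poset {U. open U}) F"
    using F by (simp add: cosheaf_def Open_poset_def)
  have "is_module C (GridO_poset \<delta>) F"
    unfolding GridO_poset_def
    by (rule is_moduleI) (simp_all add: is_moduleD[OF mod, simplified] open_grid_opens)
  moreover have "is_colimit (push_diagram U) C (pullback (cell_to_grid \<delta>) F) (obj_map F U)
      (\<lambda>\<sigma>. arr_map F (cell_to_grid \<delta> \<sigma>, U))"
    if U: "U \<in> carrier (GridO_poset \<delta>)" for U
  proof -
    let ?A = "{\<sigma> \<in> grid_cells \<delta>. open_star \<delta> \<sigma> \<subseteq> U}"
    let ?P = "below (Cell_poset \<delta>) (GridO_poset \<delta>) (cell_to_grid \<delta>) U"
    have U: "U \<in> grid_opens \<delta>"
      using U by (simp add: GridO_poset_def)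
    have carrier_P: "carrier ?P = ?A"
      by (auto simp: Cell_poset_def GridO_poset_def cell_to_grid_def)
    have emb: "\<sigma> \<sqsubseteq>\<^bsub>?P\<^esub> \<tau> \<longleftrightarrow> open_star \<delta> \<sigma> \<subseteq> open_star \<delta> \<tau>" if "\<sigma> \<in> ?A" "\<tau> \<in> ?A" for \<sigma> \<tau>
      using that by (simp add: cell_le_iff_star_subset[OF assms(1)])
    have "inj_on (open_star \<delta>) ?A"
    proof (rule inj_onI)
      fix \<sigma> \<tau> assume st: "\<sigma> \<in> ?A" "\<tau> \<in> ?A" "open_star \<delta> \<sigma> = open_star \<delta> \<tau>"
      then have "\<sigma> \<sqsubseteq>\<^bsub>Cell_poset \<delta>\<^esub> \<tau>" "\<tau> \<sqsubseteq>\<^bsub>Cell_poset \<delta>\<^esub> \<sigma>"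
        using cell_le_iff_star_subset[OF assms(1)] by blast+
      then show "\<sigma> = \<tau>"
        using partial_order.le_antisym[OF partial_order_Cell_poset[OF assms(1)], of \<sigma> \<tau>] st
        by (simp add: Cell_poset_def)
    qed
    then have bij: "bij_betw (cell_to_grid \<delta>) (carrier ?P) (carrier (inclusion_poset (open_star \<delta> ` ?A)))"
      by (simp only: carrier_P inclusion_poset_simps) (simp add: bij_betw_def cell_to_grid_def[abs_def])
    show ?thesis
    proof (rule colimit_reindex[OF cosheaf_colimit[OF cocomp F open_grid_opens[OF U]
            cech_cover_stars[OF assms(1) U]] bij])
      show "\<sigma> \<sqsubseteq>\<^bsub>?P\<^esub> \<tau> \<longleftrightarrow>
          cell_to_grid \<delta> \<sigma> \<sqsubseteq>\<^bsub>inclusion_poset (open_star \<delta> ` ?A)\<^esub> cell_to_grid \<delta> \<tau>"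
        if "\<sigma> \<in> carrier ?P" "\<tau> \<in> carrier ?P" for \<sigma> \<tau>
        using emb that unfolding carrier_P cell_to_grid_def inclusion_poset_simps by blast
    qed
  qed
  ultimately show ?thesis
    by (simp add: determined_def)
qed

section \<open>Comparison of the three distances\<close>

theorem rel_weak_dist_cells_eq_weak_dist_grid:
  fixes M N :: "((real ^ 'n) set, 'o, 'm) pmodule"
  assumes "\<delta> > 0" and "category C"
    and "cocomplete TYPE((real ^ 'n) set) TYPE((real ^ 'n) set \<times> (real ^ 'n) set) C"
    and "cosheaf C M" and "cosheaf C N"
  shows "rel_weak_dist C (Cell_poset \<delta>) (GridO_poset \<delta>) (cell_to_grid \<delta>) (lower_translation \<delta>)
      (pullback (cell_to_grid \<delta>) M) (pullback (cell_to_grid \<delta>) N)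
    = weak_dist C (GridO_poset \<delta>) (lower_translation \<delta>) M N"
proof -
  have "rel_weakly_interleaved C (Cell_poset \<delta>) (GridO_poset \<delta>) (cell_to_grid \<delta>) (lower_translation \<delta>) \<epsilon>
      (pullback (cell_to_grid \<delta>) M) (pullback (cell_to_grid \<delta>) N)
    \<longleftrightarrow> weakly_interleaved C (GridO_poset \<delta>) (lower_translation \<delta>) \<epsilon> M N" if "0 \<le> \<epsilon>" for \<epsilon>
  proof -
    interpret pushforward_setting C "Cell_poset \<delta>" "GridO_poset \<delta>"
      "cell_to_grid \<delta> :: (real ^ 'n) set \<Rightarrow> _"
      by (rule cell_pushforward_setting) fact+
    interpret translation_family "GridO_poset \<delta>" "lower_translation \<delta> :: _ \<Rightarrow> (real ^ 'n) set \<Rightarrow> _"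
      unfolding GridO_poset_def by (rule translation_family_lower[OF assms(1)])
    interpret relative_setting C "Cell_poset \<delta>" "GridO_poset \<delta>"
      "cell_to_grid \<delta> :: (real ^ 'n) set \<Rightarrow> _" "lower_translation \<delta>" \<epsilon>
      by unfold_locales fact
    show ?thesis
      by (rule rel_weakly_interleaved_iff; rule cosheaf_determined; fact)
  qed
  then show ?thesis
    unfolding rel_weak_dist_def weak_dist_def by (metis (no_types, lifting))
qed

text \<open>Discretizing uses that the grid open inside a \<open>\<delta>\<close> larger neighbourhood already contains the given
  neighbourhood; extending to all open sets evaluates the interleaving at grid hulls. Either way each
  of the two morphisms loses \<open>\<delta>\<close>, and the doubled parameter has room for both losses.\<close>

lemma
  fixes M N :: "((real ^ 'n) set, 'o, 'm) pmodule"
  assumes \<delta>: "\<delta> > 0" and C: "category C"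
    and M: "is_module C Open_poset M" and N: "is_module C Open_poset N"
  shows weak_dist_grid_le: "weak_dist C (GridO_poset \<delta>) (lower_translation \<delta>) M N
      \<le> weak_dist C Open_poset metric_translation M N + ennreal \<delta>"
    and weak_dist_open_le: "weak_dist C Open_poset metric_translation M N
      \<le> weak_dist C (GridO_poset \<delta>) (lower_translation \<delta>) M N + ennreal \<delta>"
proof -
  let ?O = "{U :: (real ^ 'n) set. open U}" and ?G = "grid_opens \<delta> :: (real ^ 'n) set set"
  note mods = M[unfolded Open_poset_def] N[unfolded Open_poset_def]
  have GO: "?G \<subseteq> ?O"
    using open_grid_opens by blast
  have nonneg: "0 \<le> \<delta>"
    using \<delta> by simp
  have discretize: "weakly_interleaved C (inclusion_poset ?G) (lower_translation \<delta>) (\<epsilon> + \<delta>) M N"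
    if e: "0 \<le> \<epsilon>" and i: "weakly_interleaved C (inclusion_poset ?O) metric_translation \<epsilon> M N" for \<epsilon>
  proof (rule interleaving_comparison.weakly_interleaved_transport[OF _ mods i])
    show "interleaving_comparison C ?O ?G ?O (\<lambda>U. U) (lower_translation \<delta>) metric_translation (\<epsilon> + \<delta>) \<epsilon>"
    proof (intro interleaving_comparison.intro[OF C] interleaving_comparison_axioms.intro)
      show "metric_translation \<epsilon> U \<subseteq> lower_translation \<delta> (\<epsilon> + \<delta>) U"
        "metric_translation (2 * \<epsilon>) U \<subseteq> lower_translation \<delta> (2 * (\<epsilon> + \<delta>)) U" for U :: "(real ^ 'n) set"
        using e \<delta> by (simp_all add: metric_le_lower_translation)
    qed (use e \<delta> GO in \<open>simp_all add: translation_family_lower translation_family_metric subset_iff\<close>)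
  qed
  show "weak_dist C (GridO_poset \<delta>) (lower_translation \<delta>) M N
      \<le> weak_dist C Open_poset metric_translation M N + ennreal \<delta>"
    unfolding weak_dist_def GridO_poset_def Open_poset_def
    by (rule Inf_ennreal_shift[OF _ nonneg]) (rule discretize)
  have extend: "weakly_interleaved C (inclusion_poset ?O) metric_translation (\<epsilon> + \<delta>) M N"
    if e: "0 \<le> \<epsilon>" and i: "weakly_interleaved C (inclusion_poset ?G) (lower_translation \<delta>) \<epsilon> M N" for \<epsilon>
  proof (rule interleaving_comparison.weakly_interleaved_transport[OF _ mods i])
    show "interleaving_comparison C ?O ?O ?G (grid_hull \<delta>) metric_translation (lower_translation \<delta>) (\<epsilon> + \<delta>) \<epsilon>"
    proof (intro interleaving_comparison.intro[OF C] interleaving_comparison_axioms.intro)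
      show "lower_translation \<delta> \<epsilon> (grid_hull \<delta> U) \<subseteq> metric_translation (\<epsilon> + \<delta>) U"
        "lower_translation \<delta> (2 * \<epsilon>) (grid_hull \<delta> U) \<subseteq> metric_translation (2 * (\<epsilon> + \<delta>)) U" for U :: "(real ^ 'n) set"
        using e \<delta> by (simp_all add: lower_translation_hull_le_metric)
      show "grid_hull \<delta> U \<subseteq> grid_hull \<delta> V" if "U \<subseteq> V" for U V :: "(real ^ 'n) set"
        using that by (auto simp: grid_hull_def)
      show "U \<subseteq> grid_hull \<delta> U" for U :: "(real ^ 'n) set"
        by (rule grid_hull_extensive)
    qed (use e \<delta> GO in \<open>simp_all add: translation_family_lower translation_family_metric grid_hull_grid_open\<close>)
  qed
  show "weak_dist C Open_poset metric_translation M N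
      \<le> weak_dist C (GridO_poset \<delta>) (lower_translation \<delta>) M N + ennreal \<delta>"
    unfolding weak_dist_def GridO_poset_def Open_poset_def
    by (rule Inf_ennreal_shift[OF _ nonneg]) (rule extend)
qed

theorem corollary6p11:
  fixes C :: "('o, 'm) cat"
    and \<delta> :: real
    and M N :: "((real ^ 'n) set, 'o, 'm) pmodule"
  assumes "\<delta> > 0"
    and "category C"
    and "cocomplete TYPE((real ^ 'n) set) TYPE((real ^ 'n) set \<times> (real ^ 'n) set) C"
    and "cosheaf C M"
    and "cosheaf C N"
  shows "let d = weak_dist C Open_poset metric_translation M N;
             d_GridO = weak_dist C (GridO_poset \<delta>) (lower_translation \<delta>)
                         (pullback grid_to_open M) (pullback grid_to_open N);
             d_Cell = rel_weak_dist C (Cell_poset \<delta>) (GridO_poset \<delta>) (cell_to_grid \<delta>)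
                         (lower_translation \<delta>)
                         (pullback (cell_to_open \<delta>) M) (pullback (cell_to_open \<delta>) N)
         in d_Cell = d_GridO \<and>
            d_Cell \<le> d + ennreal (2 * \<delta>) \<and> d \<le> d_Cell + ennreal (2 * \<delta>) \<and>
            d_GridO \<le> d + ennreal (2 * \<delta>) \<and> d \<le> d_GridO + ennreal (2 * \<delta>)"
proof -
  let ?d = "weak_dist C Open_poset metric_translation M N"
  let ?dG = "weak_dist C (GridO_poset \<delta>) (lower_translation \<delta>) M N"
  have restrict: "pullback grid_to_open F = F" "cell_to_open \<delta> = cell_to_grid \<delta>"
    for F :: "((real ^ 'n) set, 'o, 'm) pmodule"
    by (simp_all add: grid_to_open_def[abs_def] pullback_identity cell_to_open_def[abs_def]
        cell_to_grid_def[abs_def])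
  have "is_module C Open_poset M" "is_module C Open_poset N"
    using assms(4,5) by (simp_all add: cosheaf_def)
  note bounds = weak_dist_grid_le[OF assms(1,2) this] weak_dist_open_le[OF assms(1,2) this]
  have "x + ennreal \<delta> \<le> x + ennreal (2 * \<delta>)" for x
    using assms(1) by (intro add_left_mono ennreal_leI) simp
  then have "?dG \<le> ?d + ennreal (2 * \<delta>)" "?d \<le> ?dG + ennreal (2 * \<delta>)"
    using bounds order_trans by blast+
  then show ?thesis
    unfolding restrict Let_def rel_weak_dist_cells_eq_weak_dist_grid[OF assms] by simp
qed

end
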